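(* Let $K$ be an unramified extension of $F$ of degree $r$. Then for every integer $n$ with $r \leq n \leq 2r-1$, $$-q^{-r} \leq \frac{\rho_n(K)}{\|D_K\|} - \frac{q^{n+1}-q^r}{q^{n+1}-1}\cdot\frac{G_r}{q^r} \leq 4q^{-r},$$ where $G_r$ is the number of elements $\alpha \in \mathbb{F}_{q^r}$ such that $\mathbb{F}_q[\alpha] = \mathbb{F}_{q^r}$.
   Context: Let $p$ be a prime, $F$ a finite extension of $\mathbb{Q}_p$ with ring of integers $\mathcal{O}_F$ and residue field $\mathbb{F}_q$. Let $\|\cdot\|$ be the absolute value on an algebraic closure of $F$ normalized by $\|p\|=p^{-[F:\mathbb{Q}_p]}$. For $m\ge0$, $\Omega_m$ is the set of polynomials of degree at most $m$ over $\mathcal{O}_F$, identified with $\mathcal{O}_F^{m+1}$ with the probability measure $\lambda_F^{\otimes(m+1)}$ ($\lambda_F(\mathcal{O}_F)=1$). For a finite extension $K$ of $F$ of degree $r$, $\lambda_K$ is the Haar measure with $\lambda_K(\mathcal{O}_K)=1$, $D_K$ is the discriminant of $K/F$, and $\rho_{K,n}:K\to\mathbb{R}_{\ge0}$ is defined by: for $x\in\mathcal{O}_K$, $\rho_{K,n}(x)=\frac{\|D_K\|}{\#(\mathcal{O}_K/\mathcal{O}_F[x])}\int_{\Omega_{n-r}}\|Q(x)\|^r\,dQ$ if $n\ge r$ and $F[x]=K$, and $0$ otherwise; for $x\notin\mathcal{O}_K$, $\rho_{K,n}(x)=\|x\|^{-2r}\rho_{K,n}(x^{-1})$. Finally $\rho_n(K)=\int_K\rho_{K,n}(x)\,d\lambda_K(x)$.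 *)

theory Defs
  imports "HOL-Analysis.Analysis" "HOL-Computational_Algebra.Computational_Algebra"
    "Jordan_Normal_Form.Determinant"
begin

text \<open>
  All fields of characteristic 0 in play are subsets of one ambient type, which plays the role of
  the algebraic closure of \<open>F\<close>; \<open>nrm\<close> is the absolute value on it.
\<close>

definition is_subfield :: "'a::field set \<Rightarrow> bool" where
  "is_subfield S \<longleftrightarrow> 0 \<in> S \<and> 1 \<in> S \<and> (\<forall>x\<in>S. \<forall>y\<in>S. x - y \<in> S \<and> x * y \<in> S)
     \<and> (\<forall>x\<in>S. inverse x \<in> S)"

text \<open>\<open>is_basis A M r b\<close>: \<open>b 0, \<dots>, b (r - 1)\<close> is a basis of the \<open>A\<close>-module \<open>M\<close>. It is used both
  for field extensions and for rings of integers.\<close>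

definition is_basis :: "'a::field set \<Rightarrow> 'a set \<Rightarrow> nat \<Rightarrow> (nat \<Rightarrow> 'a) \<Rightarrow> bool" where
  "is_basis A M r b \<longleftrightarrow> (\<forall>i<r. b i \<in> M)
     \<and> (\<forall>x\<in>M. \<exists>!c. c \<in> {..<r} \<rightarrow>\<^sub>E A \<and> x = (\<Sum>i<r. c i * b i))"

definition coords :: "'a::field set \<Rightarrow> nat \<Rightarrow> (nat \<Rightarrow> 'a) \<Rightarrow> 'a \<Rightarrow> nat \<Rightarrow> 'a" where
  "coords A r b x = (THE c. c \<in> {..<r} \<rightarrow>\<^sub>E A \<and> x = (\<Sum>i<r. c i * b i))"

definition field_ext :: "'a::field set \<Rightarrow> 'a set \<Rightarrow> nat \<Rightarrow> bool" where
  "field_ext F K r \<longleftrightarrow> is_subfield F \<and> is_subfield K \<and> F \<subseteq> K \<and> (\<exists>b. is_basis F K r b)"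

definition adjoin :: "'a::field set \<Rightarrow> 'a \<Rightarrow> 'a set" where
  "adjoin A x = {poly P x |P. \<forall>i. coeff P i \<in> A}"

definition algebraic_over :: "'a::field set \<Rightarrow> 'a \<Rightarrow> bool" where
  "algebraic_over F x \<longleftrightarrow> (\<exists>P. P \<noteq> 0 \<and> (\<forall>i. coeff P i \<in> F) \<and> poly P x = 0)"

text \<open>The order of the additive quotient \<open>A / B\<close>, as a number of cosets.\<close>

definition quot_card :: "'a::field set \<Rightarrow> 'a set \<Rightarrow> nat" where
  "quot_card A B = card ((\<lambda>y. (+) y ` B) ` A)"

definition is_nonarch_abs :: "('a::field \<Rightarrow> real) \<Rightarrow> bool" where
  "is_nonarch_abs nrm \<longleftrightarrow> (\<forall>x. nrm x \<ge> 0) \<and> (\<forall>x. nrm x = 0 \<longleftrightarrow> x = 0)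
     \<and> (\<forall>x y. nrm (x * y) = nrm x * nrm y) \<and> (\<forall>x y. nrm (x + y) \<le> max (nrm x) (nrm y))"

definition nrm_topology :: "('a::field \<Rightarrow> real) \<Rightarrow> 'a set \<Rightarrow> 'a topology" where
  "nrm_topology nrm S = Metric_space.mtopology S (\<lambda>x y. nrm (x - y))"

text \<open>\<open>S\<close> is the completion of the rationals for \<open>nrm\<close>. If \<open>nrm\<close> is a nonarchimedean absolute
  value with \<open>nrm p < 1\<close> for a prime \<open>p\<close>, then its restriction to the rationals is a power of the
  \<open>p\<close>-adic absolute value, so that \<open>S\<close> is the field of \<open>p\<close>-adic numbers.\<close>

definition is_completion_of_Rats :: "('a::field_char_0 \<Rightarrow> real) \<Rightarrow> 'a set \<Rightarrow> bool" where
  "is_completion_of_Rats nrm S \<longleftrightarrow> S = nrm_topology nrm UNIV closure_of \<rat>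
     \<and> Metric_space.mcomplete S (\<lambda>x y. nrm (x - y))"

definition int_ring :: "('a::field \<Rightarrow> real) \<Rightarrow> 'a set \<Rightarrow> 'a set" where
  "int_ring nrm K = {x \<in> K. nrm x \<le> 1}"

definition max_ideal :: "('a::field \<Rightarrow> real) \<Rightarrow> 'a set \<Rightarrow> 'a set" where
  "max_ideal nrm K = {x \<in> K. nrm x < 1}"

text \<open>The index of the value group of \<open>F\<close> in the value group of \<open>K\<close>.\<close>

definition ram_index :: "('a::field \<Rightarrow> real) \<Rightarrow> 'a set \<Rightarrow> 'a set \<Rightarrow> nat" where
  "ram_index nrm F K = card ((\<lambda>v. (*) v ` nrm ` (F - {0})) ` nrm ` (K - {0}))"

text \<open>Residue fields are finite here, so no separability condition on the residue extension is
  needed.\<close>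

definition unramified :: "('a::field \<Rightarrow> real) \<Rightarrow> 'a set \<Rightarrow> 'a set \<Rightarrow> bool" where
  "unramified nrm F K \<longleftrightarrow> ram_index nrm F K = 1"

text \<open>The trace of the \<open>F\<close>-linear map \<open>y \<mapsto> x * y\<close>, computed in the basis \<open>b\<close>.\<close>

definition ext_trace :: "'a::field set \<Rightarrow> nat \<Rightarrow> (nat \<Rightarrow> 'a) \<Rightarrow> 'a \<Rightarrow> 'a" where
  "ext_trace F r b x = (\<Sum>i<r. coords F r b (x * b i) i)"

text \<open>The discriminant of \<open>K/F\<close> is defined up to the square of a unit; \<open>is_discriminant\<close> describes
  its representatives.\<close>

definition is_discriminant :: "('a::field \<Rightarrow> real) \<Rightarrow> 'a set \<Rightarrow> 'a set \<Rightarrow> nat \<Rightarrow> 'a \<Rightarrow> bool" where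
  "is_discriminant nrm F K r D \<longleftrightarrow> (\<exists>b. is_basis (int_ring nrm F) (int_ring nrm K) r b
     \<and> D = Determinant.det (Matrix.mat r r (\<lambda>(i, j). ext_trace F r b (b i * b j))))"

text \<open>Finiteness on compact sets follows from translation invariance and \<open>\<lambda>(O\<^sub>K) = 1\<close>, because the
  ring of integers is open.\<close>

definition is_haar :: "('a::field \<Rightarrow> real) \<Rightarrow> 'a set \<Rightarrow> 'a measure \<Rightarrow> bool" where
  "is_haar nrm K \<mu> \<longleftrightarrow> space \<mu> = K
     \<and> sets \<mu> = sigma_sets K {U. openin (nrm_topology nrm K) U}
     \<and> (\<forall>a\<in>K. \<forall>A\<in>sets \<mu>. emeasure \<mu> ((+) a ` A) = emeasure \<mu> A)
     \<and> emeasure \<mu> (int_ring nrm K) = 1"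

text \<open>The probability space of polynomials of degree at most \<open>m\<close> over the ring of integers of \<open>F\<close>;
  a polynomial is the family of its coefficients.\<close>

definition Omega :: "('a::field \<Rightarrow> real) \<Rightarrow> 'a set \<Rightarrow> 'a measure \<Rightarrow> nat \<Rightarrow> (nat \<Rightarrow> 'a) measure" where
  "Omega nrm F lamF m = PiM {..m} (\<lambda>_. restrict_space lamF (int_ring nrm F))"

definition rho_int :: "('a::field \<Rightarrow> real) \<Rightarrow> 'a set \<Rightarrow> 'a set \<Rightarrow> nat \<Rightarrow> 'a \<Rightarrow> 'a measure
    \<Rightarrow> nat \<Rightarrow> 'a \<Rightarrow> ennreal" where
  "rho_int nrm F K r D lamF n x =
     (if r \<le> n \<and> adjoin F x = K
      then ennreal (nrm D / real (quot_card (int_ring nrm K) (adjoin (int_ring nrm F) x)))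
        * (\<integral>\<^sup>+ Q. ennreal (nrm (\<Sum>i\<le>n - r. Q i * x ^ i) ^ r) \<partial>Omega nrm F lamF (n - r))
      else 0)"

definition rho :: "('a::field \<Rightarrow> real) \<Rightarrow> 'a set \<Rightarrow> 'a set \<Rightarrow> nat \<Rightarrow> 'a \<Rightarrow> 'a measure
    \<Rightarrow> nat \<Rightarrow> 'a \<Rightarrow> ennreal" where
  "rho nrm F K r D lamF n x =
     (if x \<in> int_ring nrm K then rho_int nrm F K r D lamF n x
      else ennreal (1 / nrm x ^ (2 * r)) * rho_int nrm F K r D lamF n (inverse x))"

definition rho_total :: "('a::field \<Rightarrow> real) \<Rightarrow> 'a set \<Rightarrow> 'a set \<Rightarrow> nat \<Rightarrow> 'a \<Rightarrow> 'a measure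
    \<Rightarrow> 'a measure \<Rightarrow> nat \<Rightarrow> ennreal" where
  "rho_total nrm F K r D lamF lamK n = (\<integral>\<^sup>+ x. rho nrm F K r D lamF n x \<partial>lamK)"

end

theory Submission
  imports Defs
begin

text \<open>
  Let $k$ be the residue field of $K$, with $q^r$ elements, and call the least $s > 0$ with
  $x^{q^s} = x$ the period of a residue $x$; it divides $r$, and $x$ generates $k$ over the residue
  field of $F$ iff its period is $r$. If the residue of $x \in O_K$ has period $r$, then
  $O_F[x] = O_K$ and $\|Q(x)\|$ is the maximum of the norms of the coefficients of $Q$ (as
  $\deg Q < r$), so that $\rho_{K,n}(x) / \|D_K\|$ is exactly the main factor. If the period is
  $s < r$, then $s \le r / 2$, there are at most $q^s$ such residues, and the index of $O_F[x]$ is at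
  least $q^{r-s}$; these $x$ contribute at most $2 q^{-r}$. The elements outside $O_K$
  contribute at most $\sum_{k \ge 1} q^{-2rk} q^{rk} \le 2 q^{-r}$. The integrals use that a
  uniformizer of $F$ has norm $1/q$, which follows from $\|p\| = p^{-d}$ and
  $[O_F : p O_F] = p^d$. The number of residues of period $r$ is determined by $q$ and $r$ via the
  divisor sums $\sum_{s \mid t} N_s = q^t$, hence it is the same in every field with $q^r$ elements.
\<close>

section \<open>Nonarchimedean absolute values\<close>

text \<open>Residue fields are never formed. All computations are done on elements of the ambient
  field, up to congruence modulo the maximal ideal and with finite systems of representatives. Thus
  the residue field of \<open>K\<close> and the abstract field \<open>'e\<close> in which $G_r$ is
  counted (its own residue field for the trivial norm) are two instances of one theory. The norm of
  a uniformizer \<pi> of \<open>F\<close> is found by measuring the ball p O_F twice. As one of p^d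
  translates that fill O_F it has measure p^(-d); as the ball of radius |\<pi>|^m = |p| it has
  measure q^(-m), a value that can be computed before |\<pi>| is known. With |p| = p^(-d) this gives
  |\<pi>|^m = q^(-m). Since \<open>K\<close> is unramified, \<pi> is a uniformizer of
  \<open>K\<close> too. The discriminant supplies an integral basis, and it can be divided by
  because the trace form is nondegenerate: the trace of 1 is r, which is not 0 in characteristic 0.
  The lower estimate keeps only the residue classes of period r, where the density is known exactly;
  so the difference in the theorem is even nonnegative.\<close>

locale nonarch =
  fixes nrm :: "'a::field \<Rightarrow> real"
  assumes nonarch: "is_nonarch_abs nrm"
begin

lemma nrm_nonneg [simp]: "0 \<le> nrm x"
  and nrm_eq_0_iff [simp]: "nrm x = 0 \<longleftrightarrow> x = 0"
  and nrm_mult: "nrm (x * y) = nrm x * nrm y"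
  and nrm_add: "nrm (x + y) \<le> max (nrm x) (nrm y)"
  using nonarch by (auto simp: is_nonarch_abs_def)

lemma nrm_0 [simp]: "nrm 0 = 0"
  by simp

lemma nrm_pos_iff [simp]: "0 < nrm x \<longleftrightarrow> x \<noteq> 0"
  using nrm_nonneg[of x] nrm_eq_0_iff[of x] by linarith

lemma nrm_1 [simp]: "nrm 1 = 1"
  using nrm_mult[of 1 1] nrm_eq_0_iff[of 1] by simp

lemma nrm_power: "nrm (x ^ k) = nrm x ^ k"
  by (induction k) (auto simp: nrm_mult)

lemma nrm_inverse: "nrm (inverse x) = inverse (nrm x)"
proof (cases "x = 0")
  case False
  then have "nrm x * nrm (inverse x) = 1"
    by (simp flip: nrm_mult)
  with False show ?thesis
    by (simp add: field_simps)
qed simp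

lemma nrm_divide: "nrm (x / y) = nrm x / nrm y"
  by (simp add: divide_inverse nrm_mult nrm_inverse)

lemma nrm_minus [simp]: "nrm (- x) = nrm x"
proof -
  have "nrm (- 1) * nrm (- 1) = 1"
    by (simp flip: nrm_mult)
  then have "nrm (- 1) = 1"
    using nrm_nonneg[of "-1"] by (metis abs_of_nonneg real_sqrt_abs2 real_sqrt_one)
  then show ?thesis
    using nrm_mult[of "-1" x] by simp
qed

lemma nrm_minus_commute: "nrm (x - y) = nrm (y - x)"
  using nrm_minus[of "x - y"] by simp

lemma nrm_diff: "nrm (x - y) \<le> max (nrm x) (nrm y)"
  using nrm_add[of x "- y"] by simp

lemma nrm_add_le: "nrm x \<le> c \<Longrightarrow> nrm y \<le> c \<Longrightarrow> nrm (x + y) \<le> c"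
  and nrm_diff_le: "nrm x \<le> c \<Longrightarrow> nrm y \<le> c \<Longrightarrow> nrm (x - y) \<le> c"
  and nrm_add_less: "nrm x < c \<Longrightarrow> nrm y < c \<Longrightarrow> nrm (x + y) < c"
  and nrm_diff_less: "nrm x < c \<Longrightarrow> nrm y < c \<Longrightarrow> nrm (x - y) < c"
  using nrm_add[of x y] nrm_diff[of x y] by auto

lemma nrm_mult_le_1: "nrm x \<le> 1 \<Longrightarrow> nrm y \<le> 1 \<Longrightarrow> nrm (x * y) \<le> 1"
  by (simp add: nrm_mult mult_le_one)

lemma nrm_mult_le: "nrm x \<le> 1 \<Longrightarrow> nrm y \<le> c \<Longrightarrow> nrm (x * y) \<le> c"
  using mult_mono[of "nrm x" 1 "nrm y" c] by (simp add: nrm_mult)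

lemma nrm_mult_less: "nrm x \<le> 1 \<Longrightarrow> nrm y < c \<Longrightarrow> nrm (x * y) < c"
  using mult_right_mono[of "nrm x" 1 "nrm y"] by (simp add: nrm_mult)

lemma nrm_power_le_1: "nrm x \<le> 1 \<Longrightarrow> nrm (x ^ k) \<le> 1"
  by (simp add: nrm_power power_le_one)

lemma nrm_sum_le:
  assumes "0 \<le> c" "\<And>i. i \<in> I \<Longrightarrow> nrm (f i) \<le> c"
  shows "nrm (sum f I) \<le> c"
proof (cases "finite I")
  case True
  then show ?thesis
    using assms(2) by (induction I) (auto intro: nrm_add_le simp: assms(1))
qed (auto simp: assms(1))

lemma nrm_sum_less:
  assumes "0 < c" "\<And>i. i \<in> I \<Longrightarrow> nrm (f i) < c"
  shows "nrm (sum f I) < c"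
proof (cases "finite I")
  case True
  then show ?thesis
    using assms(2) by (induction I) (auto intro: nrm_add_less simp: assms(1))
qed (auto simp: assms(1))

text \<open>The isosceles triangle property of an ultrametric: a perturbation smaller than
  \<open>x\<close> cannot change the norm.\<close>

lemma nrm_eq_if_diff_less: "nrm (x - y) < nrm x \<Longrightarrow> nrm y = nrm x"
  using nrm_diff[of x "x - y"] nrm_add[of "x - y" y] by auto

lemma nrm_of_nat_le_1: "nrm (of_nat k) \<le> 1"
  by (induction k) (auto intro: nrm_add_le)

lemma nrm_of_int_le_1: "nrm (of_int k) \<le> 1"
  using nrm_of_nat_le_1 by (cases k) (auto simp del: of_nat_Suc)

lemma nrm_poly_le_1:
  assumes "\<And>i. nrm (coeff P i) \<le> 1" "nrm x \<le> 1"
  shows "nrm (poly P x) \<le> 1"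
  unfolding poly_altdef by (intro nrm_sum_le) (auto intro!: nrm_mult_le_1 nrm_power_le_1 assms)

text \<open>Equality of residues. The relation mentions no subfield, so that elements of
  \<open>F\<close> and of \<open>K\<close> are compared directly.\<close>

abbreviation resid_eq :: "'a \<Rightarrow> 'a \<Rightarrow> bool" (infix \<open>\<simeq>\<close> 50) where
  "x \<simeq> y \<equiv> nrm (x - y) < 1"

lemma resid_sym: "x \<simeq> y \<Longrightarrow> y \<simeq> x"
  by (simp add: nrm_minus_commute)

lemma resid_trans [trans]: "x \<simeq> y \<Longrightarrow> y \<simeq> z \<Longrightarrow> x \<simeq> z"
  using nrm_add_less[of "x - y" 1 "y - z"] by simp

lemma resid_nrm_le: "x \<simeq> y \<Longrightarrow> nrm x \<le> 1 \<Longrightarrow> nrm y \<le> 1"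
  using nrm_diff_le[of x 1 "x - y"] by simp

lemma resid_nrm_eq_1: "x \<simeq> y \<Longrightarrow> nrm x = 1 \<Longrightarrow> nrm y = 1"
  using nrm_eq_if_diff_less[of x y] by simp

lemma resid_add: "x \<simeq> y \<Longrightarrow> u \<simeq> v \<Longrightarrow> x + u \<simeq> y + v"
  using nrm_add_less[of "x - y" 1 "u - v"] by (simp add: algebra_simps)

lemma resid_mult:
  assumes "x \<simeq> y" "u \<simeq> v" "nrm x \<le> 1" "nrm u \<le> 1"
  shows "x * u \<simeq> y * v"
proof -
  have "x * u - y * v = u * (x - y) + y * (u - v)"
    by (simp add: algebra_simps)
  then show ?thesis
    using assms resid_nrm_le by (simp add: nrm_add_less nrm_mult_less)
qed

lemma resid_power: "x \<simeq> y \<Longrightarrow> nrm x \<le> 1 \<Longrightarrow> x ^ k \<simeq> y ^ k"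
  by (induction k) (auto intro: resid_mult nrm_power_le_1)

lemma resid_sum: "(\<And>i. i \<in> I \<Longrightarrow> f i \<simeq> g i) \<Longrightarrow> sum f I \<simeq> sum g I"
  by (simp flip: sum_subtractf add: nrm_sum_less)

lemma resid_prod:
  assumes "\<And>i. i \<in> I \<Longrightarrow> f i \<simeq> g i" "\<And>i. i \<in> I \<Longrightarrow> nrm (f i) \<le> 1"
  shows "prod f I \<simeq> prod g I \<and> nrm (prod f I) \<le> 1"
proof (cases "finite I")
  case True
  then show ?thesis
    using assms by (induction I) (auto intro!: resid_mult nrm_mult_le_1)
qed auto

lemma nrm_prod: "nrm (prod f I) = (\<Prod>i\<in>I. nrm (f i))"
  by (induction I rule: infinite_finite_induct) (auto simp: nrm_mult)

text \<open>Sets of integral elements that inject into the residue field; they stand for subsets of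
  it.\<close>

definition incong :: "'a set \<Rightarrow> bool" where
  "incong S \<longleftrightarrow> (\<forall>x\<in>S. nrm x \<le> 1) \<and> (\<forall>x\<in>S. \<forall>y\<in>S. x \<simeq> y \<longrightarrow> x = y)"

lemma incong_subset: "incong S \<Longrightarrow> T \<subseteq> S \<Longrightarrow> incong T"
  by (auto simp: incong_def)

text \<open>The coefficients of the quotient by X - a are values at \<open>a\<close> of tails of
  \<open>P\<close>, hence integral.\<close>

lemma nrm_coeff_synthetic_div:
  assumes "\<forall>i. nrm (coeff P i) \<le> 1" "nrm a \<le> 1"
  shows "nrm (coeff (synthetic_div P a) i) \<le> 1"
  using assms(1)
proof (induction P arbitrary: i)
  case (pCons c P)
  have "\<forall>i. nrm (coeff P i) \<le> 1"
    using pCons.prems by (metis coeff_pCons_Suc)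
  then show ?case
    using pCons.IH nrm_poly_le_1[of P a] assms(2) by (auto simp: coeff_pCons split: nat.split)
qed auto

text \<open>The root count over the residue field, done on lifts: one root \<open>a\<close> is split
  off, and since x - a is a unit for every other \<open>x\<close> in \<open>S\<close>, these remain
  roots of the quotient modulo the maximal ideal.\<close>

lemma resid_poly_eq_0_if_many_roots:
  assumes "finite S" "incong S" "\<forall>i. nrm (coeff P i) \<le> 1" "degree P < card S"
    "\<forall>x\<in>S. poly P x \<simeq> 0"
  shows "coeff P i \<simeq> 0"
  using assms
proof (induction S arbitrary: P i rule: finite_induct)
  case (insert a S)
  define Q where "Q = synthetic_div P a"
  have P: "P = [:-a, 1:] * Q + [:poly P a:]"
    unfolding Q_def by (rule synthetic_div_correct'[symmetric])
  have a: "nrm a \<le> 1" "poly P a \<simeq> 0"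
    using insert.prems by (auto simp: incong_def)
  have roots: "poly Q x \<simeq> 0" if "x \<in> S" for x
  proof -
    have "x \<noteq> a"
      using that insert.hyps by auto
    then have "nrm (x - a) \<ge> 1"
      using insert.prems(1) that unfolding incong_def by (meson insertCI not_le)
    moreover have "(x - a) * poly Q x = poly P x - poly P a"
      using arg_cong[OF P, of "\<lambda>P. poly P x"] by (simp add: algebra_simps)
    then have "nrm (x - a) * nrm (poly Q x) < 1"
      using insert.prems(4) that a(2) by (auto simp flip: nrm_mult intro: nrm_diff_less)
    ultimately show ?thesis
      by (smt (verit) diff_zero mult_le_cancel_right1 nrm_nonneg)
  qed
  have Q: "coeff Q j \<simeq> 0" for j
  \<comment> \<open>Division lowers the degree only if it is positive; for a constant
    \<open>P\<close> the quotient is 0.\<close>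
  proof (cases "degree P = 0")
    case True
    then show ?thesis by (simp add: Q_def synthetic_div_eq_0_iff[THEN iffD2])
  next
    case False
    show ?thesis
    proof (rule insert.IH)
      show "incong S"
        using insert.prems(1) by (rule incong_subset) auto
      show "\<forall>i. nrm (coeff Q i) \<le> 1"
        using insert.prems(2) a by (auto simp: Q_def intro: nrm_coeff_synthetic_div)
      show "degree Q < card S"
        using insert False by (simp add: Q_def degree_synthetic_div)
    qed (use roots in auto)
  qed
  have "nrm (- a * coeff Q i + (case i of 0 \<Rightarrow> 0 | Suc j \<Rightarrow> coeff Q j) + coeff [:poly P a:] i) < 1"
    using Q a by (intro nrm_add_less)
      (auto intro: nrm_mult_less nrm_sum_less simp: coeff_pCons split: nat.split)
  moreover have "coeff P i = - a * coeff Q i + (case i of 0 \<Rightarrow> 0 | Suc j \<Rightarrow> coeff Q j) + coeff [:poly P a:] i"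
    by (subst P) (auto simp: coeff_pCons algebra_simps split: nat.split)
  ultimately show ?case
    by simp
qed simp

lemma card_resid_roots_le:
  assumes "finite S" "incong S" "\<forall>i. nrm (coeff P i) \<le> 1" "\<not> coeff P k \<simeq> 0"
    "\<forall>x\<in>S. poly P x \<simeq> 0"
  shows "card S \<le> degree P"
  using resid_poly_eq_0_if_many_roots[of S P k] assms not_le by metis

text \<open>Fermat's argument: multiplication by \<open>x\<close> permutes the residues in
  \<open>S\<close>, so the product of \<open>S\<close> absorbs the factor \<open>x ^ card S\<close>,
  and this product is a unit.\<close>

lemma power_card_resid_1:
  assumes "finite S" "incong S" "\<forall>t\<in>S. nrm t = 1" "nrm x = 1" "\<forall>t\<in>S. \<exists>t'\<in>S. x * t \<simeq> t'"
  shows "x ^ card S \<simeq> 1"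
proof -
  obtain f where f: "\<And>t. t \<in> S \<Longrightarrow> f t \<in> S \<and> x * t \<simeq> f t"
    using assms(5) by metis
  have "inj_on f S"
  proof (rule inj_onI)
    fix s t assume st: "s \<in> S" "t \<in> S" "f s = f t"
    then have "x * s \<simeq> x * t"
      using f[of s] f[of t] resid_sym resid_trans by metis
    then have "nrm x * nrm (s - t) < 1"
      by (simp flip: nrm_mult add: algebra_simps)
    with st assms(2,4) show "s = t"
      by (auto simp: incong_def)
  qed
  moreover have "f ` S \<subseteq> S"
    using f by auto
  ultimately have "bij_betw f S S"
    using assms(1) by (simp add: bij_betw_def endo_inj_surj)
  then have "prod f S = \<Prod>S"
    using prod.reindex_bij_betw[of f S S "\<lambda>x. x"] by simp
  moreover have "(\<Prod>t\<in>S. x * t) \<simeq> prod f S"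
    using f assms(3,4) resid_prod[of S "\<lambda>t. x * t" f] by (auto simp: nrm_mult)
  ultimately have "x ^ card S * \<Prod>S \<simeq> \<Prod>S"
    by (simp add: prod.distrib)
  then have "nrm (x ^ card S - 1) * nrm (\<Prod>S) < 1"
    by (simp flip: nrm_mult add: algebra_simps)
  then show ?thesis
    using assms(3) by (simp add: nrm_prod)
qed

end

section \<open>Residue fields and the Frobenius map\<close>

lemma subfield_0: "is_subfield S \<Longrightarrow> 0 \<in> S"
  and subfield_1: "is_subfield S \<Longrightarrow> 1 \<in> S"
  and subfield_diff: "is_subfield S \<Longrightarrow> x \<in> S \<Longrightarrow> y \<in> S \<Longrightarrow> x - y \<in> S"
  and subfield_mult: "is_subfield S \<Longrightarrow> x \<in> S \<Longrightarrow> y \<in> S \<Longrightarrow> x * y \<in> S"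
  and subfield_inverse: "is_subfield S \<Longrightarrow> x \<in> S \<Longrightarrow> inverse x \<in> S"
  by (auto simp: is_subfield_def)

lemma subfield_minus: "is_subfield S \<Longrightarrow> x \<in> S \<Longrightarrow> - x \<in> S"
  using subfield_diff[of S 0 x] subfield_0 by auto

lemma subfield_add: "is_subfield S \<Longrightarrow> x \<in> S \<Longrightarrow> y \<in> S \<Longrightarrow> x + y \<in> S"
  using subfield_diff[of S x "- y"] subfield_minus[of S y] by auto

lemma subfield_divide: "is_subfield S \<Longrightarrow> x \<in> S \<Longrightarrow> y \<in> S \<Longrightarrow> x / y \<in> S"
  by (simp add: divide_inverse subfield_mult subfield_inverse)

lemma subfield_power: "is_subfield S \<Longrightarrow> x \<in> S \<Longrightarrow> x ^ k \<in> S"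
  by (induction k) (auto intro: subfield_1 subfield_mult)

lemma subfield_sum: "is_subfield S \<Longrightarrow> (\<And>i. i \<in> I \<Longrightarrow> f i \<in> S) \<Longrightarrow> sum f I \<in> S"
  by (induction I rule: infinite_finite_induct) (auto intro: subfield_0 subfield_add)

lemma subfield_of_nat: "is_subfield S \<Longrightarrow> of_nat k \<in> S"
  by (induction k) (auto intro: subfield_0 subfield_1 subfield_add)

lemmas subfield_intros = subfield_0 subfield_1 subfield_diff subfield_mult subfield_inverse
  subfield_minus subfield_add subfield_divide subfield_power subfield_sum subfield_of_nat

text \<open>A transversal of the integers modulo the maximal ideal. It replaces the residue field
  and at the same time records that this field is finite.\<close>

definition is_reps :: "('a::field \<Rightarrow> real) \<Rightarrow> 'a set \<Rightarrow> 'a set \<Rightarrow> bool" where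
  "is_reps nrm K R \<longleftrightarrow> R \<subseteq> int_ring nrm K \<and> finite R
     \<and> (\<forall>x\<in>int_ring nrm K. \<exists>!t. t \<in> R \<and> nrm (x - t) < 1)"

context nonarch
begin

lemma int_ring_add: "is_subfield K \<Longrightarrow> x \<in> int_ring nrm K \<Longrightarrow> y \<in> int_ring nrm K \<Longrightarrow> x + y \<in> int_ring nrm K"
  and int_ring_diff: "is_subfield K \<Longrightarrow> x \<in> int_ring nrm K \<Longrightarrow> y \<in> int_ring nrm K \<Longrightarrow> x - y \<in> int_ring nrm K"
  and int_ring_mult: "is_subfield K \<Longrightarrow> x \<in> int_ring nrm K \<Longrightarrow> y \<in> int_ring nrm K \<Longrightarrow> x * y \<in> int_ring nrm K"
  and int_ring_0: "is_subfield K \<Longrightarrow> 0 \<in> int_ring nrm K"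
  and int_ring_1: "is_subfield K \<Longrightarrow> 1 \<in> int_ring nrm K"
  by (auto simp: int_ring_def intro: subfield_intros nrm_add_le nrm_diff_le nrm_mult_le_1)

lemma int_ring_power: "is_subfield K \<Longrightarrow> x \<in> int_ring nrm K \<Longrightarrow> x ^ k \<in> int_ring nrm K"
  by (induction k) (auto intro: int_ring_1 int_ring_mult)

lemma int_ring_sum:
  "is_subfield K \<Longrightarrow> (\<And>i. i \<in> I \<Longrightarrow> f i \<in> int_ring nrm K) \<Longrightarrow> sum f I \<in> int_ring nrm K"
  by (induction I rule: infinite_finite_induct) (auto intro: int_ring_0 int_ring_add)

lemmas int_ring_intros = int_ring_add int_ring_diff int_ring_mult int_ring_0 int_ring_1
  int_ring_power int_ring_sum

lemma int_ringD: "x \<in> int_ring nrm K \<Longrightarrow> nrm x \<le> 1" "x \<in> int_ring nrm K \<Longrightarrow> x \<in> K"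
  by (auto simp: int_ring_def)

lemma reps_incong: "is_reps nrm K R \<Longrightarrow> incong R"
proof -
  assume *: "is_reps nrm K R"
  have "x = y" if "x \<in> R" "y \<in> R" "x \<simeq> y" for x y
  proof -
    have "\<exists>!t. t \<in> R \<and> x \<simeq> t"
      using * that(1) by (auto simp: is_reps_def)
    moreover have "x \<simeq> x" by simp
    ultimately show ?thesis using that by blast
  qed
  moreover have "\<forall>x\<in>R. nrm x \<le> 1"
    using * by (auto simp: is_reps_def int_ring_def)
  ultimately show ?thesis
    by (auto simp: incong_def)
qed

lemma reps_finite: "is_reps nrm K R \<Longrightarrow> finite R"
  by (simp add: is_reps_def)

lemma reps_int_ring: "is_reps nrm K R \<Longrightarrow> t \<in> R \<Longrightarrow> t \<in> int_ring nrm K"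
  by (auto simp: is_reps_def)

lemma reps_ex: "is_reps nrm K R \<Longrightarrow> x \<in> int_ring nrm K \<Longrightarrow> \<exists>t\<in>R. x \<simeq> t"
  unfolding is_reps_def by blast

text \<open>For a non-unit both sides vanish. For a unit the representative \<open>w0\<close> of 0
  is removed, and multiplication by \<open>x\<close> permutes the rest. As closure under this one
  multiplication suffices, \<open>W\<close> may be a residue system, but also a set of combinations
  of powers of \<open>x\<close>.\<close>

lemma power_card_resid_self:
  assumes "finite W" "incong W" "w0 \<in> W" "w0 \<simeq> 0" "nrm x \<le> 1" "\<forall>w\<in>W. \<exists>w'\<in>W. x * w \<simeq> w'"
  shows "x ^ card W \<simeq> x"
proof (cases "nrm x = 1")
  case False
  then have "nrm x < 1" using assms(5) by simp
  moreover have "card W > 0"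
    using assms(1,3) by (auto simp: card_gt_0_iff)
  then have "nrm x ^ card W \<le> nrm x"
    using assms(5) power_decreasing[of 1 "card W" "nrm x"] by simp
  ultimately show ?thesis
    by (intro nrm_diff_less) (auto simp: nrm_power)
next
  case True
  define S where "S = W - {w0}"
  have S: "nrm w = 1" if "w \<in> S" for w
  proof (rule ccontr)
    assume "nrm w \<noteq> 1"
    then have "w \<simeq> 0"
      using that assms(2) by (force simp: S_def incong_def)
    then have "w \<simeq> w0"
      using assms(4) resid_sym resid_trans by blast
    then show False
      using that assms(2,3) by (auto simp: S_def incong_def)
  qed
  have "x ^ card S \<simeq> 1"
  proof (rule power_card_resid_1)
    show "incong S" using assms(2) by (rule incong_subset) (auto simp: S_def)
    show "\<forall>t\<in>S. \<exists>t'\<in>S. x * t \<simeq> t'"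
    proof
      fix t assume t: "t \<in> S"
      then obtain w where w: "w \<in> W" "x * t \<simeq> w"
        using assms(6) by (auto simp: S_def)
      have "nrm (x * t) = 1"
        using S[OF t] True by (simp add: nrm_mult)
      then have "nrm w = 1"
        using w resid_nrm_eq_1 by blast
      then have "w \<noteq> w0"
        using assms(4) by auto
      then show "\<exists>t'\<in>S. x * t \<simeq> t'"
        using w by (auto simp: S_def)
    qed
  qed (use assms S True in \<open>auto simp: S_def\<close>)
  then have "x ^ card S * x \<simeq> 1 * x"
    using True by (intro resid_mult) (auto simp: nrm_power_le_1)
  moreover have "card W = Suc (card S)"
    unfolding S_def by (rule card.remove) (use assms in auto)
  ultimately show ?thesis
    by (simp add: mult.commute)
qed

lemma reps_power_card:
  assumes "is_subfield K" "is_reps nrm K R" "x \<in> int_ring nrm K"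
  shows "x ^ card R \<simeq> x"
proof -
  obtain w0 where "w0 \<in> R" "0 \<simeq> w0"
    using reps_ex[OF assms(2) int_ring_0[OF assms(1)]] by blast
  then show ?thesis
    using power_card_resid_self[of R w0 x] reps_incong[OF assms(2)] assms reps_ex[OF assms(2)]
      reps_int_ring[OF assms(2)]
    by (auto simp: reps_finite int_ringD int_ring_mult)
qed

lemma card_reps_ge_2:
  assumes "is_subfield K" "is_reps nrm K R"
  shows "2 \<le> card R"
proof -
  obtain s t where st: "s \<in> R" "0 \<simeq> s" "t \<in> R" "1 \<simeq> t"
    using reps_ex[OF assms(2)] int_ring_0[OF assms(1)] int_ring_1[OF assms(1)] by metis
  have "s \<noteq> t"
    using st resid_nrm_eq_1[of 1 t] by auto
  then have "card {s, t} = 2" by simp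
  then show ?thesis
    using card_mono[of R "{s, t}"] st reps_finite[OF assms(2)] by auto
qed

end

text \<open>The residue extension enters through the sizes \<open>q\<close> and \<open>q ^ r\<close>
  alone, not through degrees or bases. The locale thus covers the fields \<open>F\<close> and
  \<open>K\<close> of the theorem as well as a finite field with the trivial norm.\<close>

locale resid_ext = nonarch nrm for nrm :: "'a::field \<Rightarrow> real" +
  fixes F K RF R :: "'a set" and q r :: nat
  assumes subF: "is_subfield F" and subK: "is_subfield K" and FK: "F \<subseteq> K"
    and RF: "is_reps nrm F RF" and card_RF: "card RF = q"
    and R: "is_reps nrm K R" and card_R: "card R = q ^ r" and r_pos: "0 < r"
begin

lemma q_ge_2: "2 \<le> q"
  using card_reps_ge_2[OF subF RF] card_RF by simp

lemma int_ring_F_K: "c \<in> int_ring nrm F \<Longrightarrow> c \<in> int_ring nrm K"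
  using FK by (auto simp: int_ring_def)

lemma frobenius_F: "c \<in> int_ring nrm F \<Longrightarrow> c ^ q \<simeq> c"
  using reps_power_card[OF subF RF] card_RF by simp

lemma frobenius_F_power: "c \<in> int_ring nrm F \<Longrightarrow> c ^ (q ^ s) \<simeq> c"
proof (induction s)
  case (Suc s)
  have "(c ^ q) ^ (q ^ s) \<simeq> c ^ (q ^ s)"
    using frobenius_F[OF Suc.prems] int_ringD(1)[OF Suc.prems]
    by (intro resid_power nrm_power_le_1)
  also have "c ^ (q ^ s) \<simeq> c" using Suc by simp
  finally show ?case by (simp only: power_Suc power_mult)
qed simp

lemma frobenius_K: "x \<in> int_ring nrm K \<Longrightarrow> x ^ (q ^ r) \<simeq> x"
  using reps_power_card[OF subK R] card_R by simp

text \<open>The polynomial $(X+1)^q - X^q - 1$ has degree less than $q$ and vanishes on the residue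
  field with $q$ elements.\<close>

lemma binomial_resid_0:
  assumes "0 < i" "i < q"
  shows "of_nat (q choose i) \<simeq> 0"
proof -
  define P :: "'a poly" where "P = (\<Sum>i=1..<q. monom (of_nat (q choose i)) i)"
  have coeff: "coeff P i = (if 0 < i \<and> i < q then of_nat (q choose i) else 0)" for i
    by (auto simp: P_def coeff_sum)
  have poly: "poly P x = (x + 1) ^ q - x ^ q - 1" for x
  proof -
    have "{..q} = insert 0 (insert q {1..<q})"
      using q_ge_2 by auto
    then have "(x + 1) ^ q = 1 + x ^ q + (\<Sum>i=1..<q. of_nat (q choose i) * x ^ i)"
      unfolding binomial_ring using q_ge_2 by (simp add: sum.insert)
    then show ?thesis
      by (simp add: P_def poly_sum poly_monom)
  qed
  have "coeff P i \<simeq> 0"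
  proof (rule resid_poly_eq_0_if_many_roots)
    show "finite RF" "incong RF"
      using RF by (auto intro: reps_finite reps_incong)
    show "\<forall>i. nrm (coeff P i) \<le> 1"
      by (auto simp: coeff nrm_of_nat_le_1)
    have "degree P \<le> q - 1"
      by (rule degree_le) (auto simp: coeff)
    then show "degree P < card RF"
      using q_ge_2 card_RF by simp
    show "\<forall>x\<in>RF. poly P x \<simeq> 0"
    proof
      fix x assume "x \<in> RF"
      then have x: "x \<in> int_ring nrm F"
        using RF by (rule reps_int_ring[rotated])
      have "(x + 1) ^ q - x ^ q - 1 = ((x + 1) ^ q - (x + 1)) - (x ^ q - x)"
        by simp
      moreover have "(x + 1) ^ q \<simeq> x + 1" "x ^ q \<simeq> x"
        by (intro frobenius_F x int_ring_intros subF)+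
      ultimately show "poly P x \<simeq> 0"
        unfolding poly by (simp only: diff_zero nrm_diff_less)
    qed
  qed
  then show ?thesis
    using assms coeff by simp
qed

text \<open>Here \<open>q\<close> is known as a number of residues, not as a power of a
  characteristic; the inner binomial coefficients vanish by \<open>binomial_resid_0\<close>.\<close>

lemma frobenius_add:
  assumes "nrm x \<le> 1" "nrm y \<le> 1"
  shows "(x + y) ^ q \<simeq> x ^ q + y ^ q"
proof -
  have "{..q} = insert 0 (insert q {1..<q})"
    using q_ge_2 by auto
  then have "(x + y) ^ q = y ^ q + x ^ q + (\<Sum>i=1..<q. of_nat (q choose i) * x ^ i * y ^ (q - i))"
    unfolding binomial_ring using q_ge_2 by (simp add: sum.insert)
  moreover have "nrm (\<Sum>i=1..<q. of_nat (q choose i) * x ^ i * y ^ (q - i)) < 1"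
  proof (rule nrm_sum_less)
    fix i assume "i \<in> {1..<q}"
    then have "nrm (x ^ i * y ^ (q - i) * of_nat (q choose i)) < 1"
      using binomial_resid_0[of i] assms
      by (intro nrm_mult_less nrm_mult_le_1 nrm_power_le_1) auto
    then show "nrm (of_nat (q choose i) * x ^ i * y ^ (q - i)) < 1"
      by (simp add: mult.commute mult.left_commute)
  qed simp
  ultimately show ?thesis
    by simp
qed

lemma frobenius_power_add:
  assumes "nrm x \<le> 1" "nrm y \<le> 1"
  shows "(x + y) ^ (q ^ s) \<simeq> x ^ (q ^ s) + y ^ (q ^ s)"
proof (induction s)
  case (Suc s)
  have "((x + y) ^ (q ^ s)) ^ q \<simeq> (x ^ (q ^ s) + y ^ (q ^ s)) ^ q"
    by (intro resid_power Suc.IH nrm_power_le_1 nrm_add_le assms)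
  also have "(x ^ (q ^ s) + y ^ (q ^ s)) ^ q \<simeq> (x ^ (q ^ s)) ^ q + (y ^ (q ^ s)) ^ q"
    by (intro frobenius_add nrm_power_le_1 assms)
  finally show ?case
    by (simp add: power_mult[symmetric] mult.commute)
qed simp

lemma frobenius_power_sum:
  assumes "\<And>i. i \<in> I \<Longrightarrow> nrm (f i) \<le> 1"
  shows "(sum f I) ^ (q ^ s) \<simeq> (\<Sum>i\<in>I. f i ^ (q ^ s))"
proof (cases "finite I")
  case True
  then show ?thesis using assms
  proof (induction I)
    case empty
    then show ?case using q_ge_2 by (simp add: power_0_left)
  next
    case (insert i I)
    have "(f i + sum f I) ^ (q ^ s) \<simeq> f i ^ (q ^ s) + sum f I ^ (q ^ s)"
      using insert.prems by (intro frobenius_power_add nrm_sum_le) auto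
    also have "f i ^ (q ^ s) + sum f I ^ (q ^ s) \<simeq> f i ^ (q ^ s) + (\<Sum>i\<in>I. f i ^ (q ^ s))"
      using insert by (intro resid_add) auto
    finally show ?case using insert.hyps by simp
  qed
qed (use q_ge_2 in \<open>auto simp: power_0_left\<close>)

text \<open>Modulo the maximal ideal the iterated Frobenius map is a ring homomorphism that fixes
  the residues of \<open>F\<close>; once it fixes \<open>x\<close>, it fixes all polynomials in
  \<open>x\<close>.\<close>

lemma frobenius_fixes_polys:
  assumes "\<And>i. i \<in> I \<Longrightarrow> c i \<in> int_ring nrm F" "nrm x \<le> 1" "x ^ (q ^ s) \<simeq> x"
  shows "(\<Sum>i\<in>I. c i * x ^ i) ^ (q ^ s) \<simeq> (\<Sum>i\<in>I. c i * x ^ i)"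
proof -
  have "(\<Sum>i\<in>I. c i * x ^ i) ^ (q ^ s) \<simeq> (\<Sum>i\<in>I. (c i * x ^ i) ^ (q ^ s))"
    using assms int_ringD(1) by (intro frobenius_power_sum nrm_mult_le_1 nrm_power_le_1) auto
  also have "(\<Sum>i\<in>I. (c i * x ^ i) ^ (q ^ s)) \<simeq> (\<Sum>i\<in>I. c i * x ^ i)"
  proof (rule resid_sum)
    fix i assume i: "i \<in> I"
    have "c i ^ (q ^ s) * (x ^ (q ^ s)) ^ i \<simeq> c i * x ^ i"
      using frobenius_F_power[OF assms(1)[OF i]] int_ringD(1)[OF assms(1)[OF i]] assms(2,3)
      by (intro resid_mult resid_power nrm_power_le_1)
    then show "(c i * x ^ i) ^ (q ^ s) \<simeq> c i * x ^ i"
      by (simp add: power_mult_distrib power_mult[symmetric] mult.commute)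
  qed
  finally show ?thesis .
qed

text \<open>A root count for X^(q^s) - X; \<open>0 < s\<close> keeps the two exponents apart, so
  that the leading coefficient is 1.\<close>

lemma card_fixed_le:
  assumes "finite S" "incong S" "\<forall>x\<in>S. x ^ (q ^ s) \<simeq> x" "0 < s"
  shows "card S \<le> q ^ s"
proof -
  define P :: "'a poly" where "P = monom 1 (q ^ s) - monom 1 1"
  have s: "1 < q ^ s"
    using q_ge_2 assms(4) by (intro one_less_power) auto
  have coeff: "coeff P i = (if i = q ^ s then 1 else if i = 1 then - 1 else 0)" for i
    using s by (auto simp: P_def)
  have "card S \<le> degree P"
    by (rule card_resid_roots_le[of _ _ "q ^ s"])
      (use assms s in \<open>auto simp: coeff, auto simp: P_def poly_monom\<close>)
  also have "degree P \<le> q ^ s"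
    by (rule degree_le) (use s in \<open>auto simp: coeff\<close>)
  finally show ?thesis .
qed

text \<open>The upper bound is \<open>card_fixed_le\<close>. For the lower bound, the elements that
  are not fixed are units and roots of (X^(q^r - 1) - 1) / (X^(q^s - 1) - 1), so there are at most
  q^r - q^s of them.\<close>

lemma card_fixed:
  assumes "s dvd r" "0 < s"
  shows "card {x \<in> R. x ^ (q ^ s) \<simeq> x} = q ^ s"
proof -
  have s: "1 < q ^ s"
    using q_ge_2 assms(2) by (intro one_less_power) auto
  obtain k where k: "r = s * k" using assms by auto
  \<comment> \<open>As \<open>s\<close> divides \<open>r\<close>, the product \<open>a * m\<close>
    is q^r - 1, and the quotient of X^(a m) - 1 by X^a - 1 is the sum \<open>P\<close> of
    \<open>m\<close> monomials below, of degree q^r - q^s.\<close>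
  define a where "a = q ^ s - 1"
  define m where "m = (\<Sum>i<k. (q ^ s) ^ i)"
  have a: "0 < a" using s by (simp add: a_def)
  have "int (a * m) = int (q ^ r - 1)"
  proof -
    have "(int (q ^ s) - 1) * (\<Sum>i<k. int (q ^ s) ^ i) = int (q ^ s) ^ k - 1"
      by (metis power_diff_1_eq)
    then show ?thesis
      using s q_ge_2 by (simp add: a_def m_def k of_nat_diff power_mult Suc_leI)
  qed
  then have am: "a * m = q ^ r - 1" by linarith
  have rs: "1 < q ^ r" using q_ge_2 r_pos by (intro one_less_power) auto
  have m: "0 < m" using am rs by (cases m) auto
  define B where "B = {x \<in> R. \<not> x ^ (q ^ s) \<simeq> x}"
  define P :: "'a poly" where "P = (\<Sum>i<m. monom 1 (a * i))"
  have coeff: "coeff P i = (\<Sum>j<m. if a * j = i then 1 else 0)" for i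
    by (simp add: P_def coeff_sum)
  have "card B \<le> degree P"
  proof (rule card_resid_roots_le[of _ _ 0])
    show "finite B" "incong B"
      using reps_finite[OF R] incong_subset[OF reps_incong[OF R], of B] by (auto simp: B_def)
    have "coeff P i = 0 \<or> coeff P i = 1" for i
    proof (cases "\<exists>j<m. a * j = i")
      case True
      then obtain j where j: "j < m" "a * j = i" by blast
      then have "(\<Sum>j<m. if a * j = i then 1 else 0) = (\<Sum>j'<m. if j' = j then 1 else (0::'a))"
        using a by (intro sum.cong) auto
      then show ?thesis using j by (simp add: coeff)
    qed (auto simp: coeff intro!: sum.neutral)
    then show "\<forall>i. nrm (coeff P i) \<le> 1"
      by (metis nrm_0 nrm_1 zero_le_one order_refl)
    \<comment> \<open>The constant term 1 shows that \<open>P\<close> is not zero modulo the maximal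
      ideal.\<close>
    have "coeff P 0 = (\<Sum>j<m. if j = 0 then 1 else 0)"
      using a unfolding coeff by (intro sum.cong) auto
    then show "\<not> coeff P 0 \<simeq> 0" using m by simp
    show "\<forall>x\<in>B. poly P x \<simeq> 0"
    proof
      fix x assume x: "x \<in> B"
      then have O: "x \<in> int_ring nrm K"
        using R by (auto simp: B_def reps_int_ring)
      have x1: "nrm x = 1"
      proof (rule ccontr)
        assume "nrm x \<noteq> 1"
        then have "nrm x < 1" using int_ringD(1)[OF O] by simp
        then have "x ^ (q ^ s) \<simeq> x"
          using s power_decreasing[of 1 "q ^ s" "nrm x"] by (intro nrm_diff_less) (auto simp: nrm_power)
        then show False using x by (simp add: B_def)
      qed
      have y: "(x ^ a - 1) * poly P x = x ^ (a * m) - 1"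
      proof -
        have "poly P x = (\<Sum>i<m. (x ^ a) ^ i)"
          by (simp add: P_def poly_sum poly_monom power_mult)
        then show ?thesis
          by (metis power_diff_1_eq power_mult)
      qed
      have "x * (x ^ (a * m) - 1) = x ^ (q ^ r) - x"
        using rs q_ge_2 power_minus_mult[of "q ^ r" x] by (simp add: am algebra_simps)
      then have "nrm (x ^ (a * m) - 1) < 1"
        using frobenius_K[OF O] x1 nrm_mult[of x "x ^ (a * m) - 1"] by simp
      then have 1: "nrm (x ^ a - 1) * nrm (poly P x) < 1"
        by (simp flip: nrm_mult add: y)
      have "x * (x ^ a - 1) = x ^ (q ^ s) - x"
        using s q_ge_2 power_minus_mult[of "q ^ s" x] by (simp add: a_def algebra_simps)
      then have "nrm (x ^ a - 1) \<ge> 1"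
        using x x1 nrm_mult[of x "x ^ a - 1"] by (simp add: B_def)
      with 1 show "poly P x \<simeq> 0"
        by (smt (verit) diff_zero mult_le_cancel_right1 nrm_nonneg)
    qed
  qed
  also have "degree P \<le> a * (m - 1)"
  proof (rule degree_le, intro allI impI)
    fix i assume i: "a * (m - 1) < i"
    have "a * j \<noteq> i" if "j < m" for j
      using that i mult_le_mono2[of j "m - 1" a] by linarith
    then show "coeff P i = 0" by (simp add: coeff)
  qed
  finally have "card B \<le> q ^ r - q ^ s"
    using am s by (simp add: a_def algebra_simps)
  moreover have "card {x \<in> R. x ^ (q ^ s) \<simeq> x} + card B = q ^ r"
  proof -
    have "{x \<in> R. x ^ (q ^ s) \<simeq> x} \<union> B = R" "{x \<in> R. x ^ (q ^ s) \<simeq> x} \<inter> B = {}"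
      by (auto simp: B_def)
    then show ?thesis
      using card_Un_disjoint[of "{x \<in> R. x ^ (q ^ s) \<simeq> x}" B] reps_finite[OF R] card_R
      by (simp add: B_def)
  qed
  moreover have "card {x \<in> R. x ^ (q ^ s) \<simeq> x} \<le> q ^ s"
    using incong_subset[OF reps_incong[OF R]] reps_finite[OF R] assms
    by (intro card_fixed_le) auto
  moreover have "q ^ s \<le> q ^ r"
    using assms r_pos q_ge_2 by (intro power_increasing dvd_imp_le) auto
  ultimately show ?thesis
    by linarith
qed

end

section \<open>Periods of residues\<close>

context resid_ext
begin

text \<open>For integral \<open>x\<close>, this is the degree of its residue over the residue field
  of \<open>F\<close>.\<close>

definition period :: "'a \<Rightarrow> nat" where
  "period x = (LEAST s. 0 < s \<and> x ^ (q ^ s) \<simeq> x)"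

lemma period:
  assumes "x \<in> int_ring nrm K"
  shows "0 < period x" "x ^ (q ^ period x) \<simeq> x"
  using LeastI[of "\<lambda>s. 0 < s \<and> x ^ (q ^ s) \<simeq> x" r] frobenius_K[OF assms] r_pos
  by (auto simp: period_def)

lemma period_le: "0 < s \<Longrightarrow> x ^ (q ^ s) \<simeq> x \<Longrightarrow> period x \<le> s"
  unfolding period_def by (rule Least_le) simp

lemma frobenius_iterate:
  assumes "nrm x \<le> 1" "x ^ (q ^ s) \<simeq> x"
  shows "x ^ (q ^ (s * k)) \<simeq> x"
proof (induction k)
  case (Suc k)
  have "(x ^ (q ^ s)) ^ (q ^ (s * k)) \<simeq> x ^ (q ^ (s * k))"
    using assms by (intro resid_power nrm_power_le_1)
  also have "x ^ (q ^ (s * k)) \<simeq> x" by (rule Suc.IH)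
  finally show ?case
    by (simp only: power_mult[symmetric] power_add[symmetric] mult_Suc_right)
qed simp

text \<open>Division with remainder: the Frobenius power of exponent \<open>t mod period x\<close>
  fixes \<open>x\<close> too, and this exponent is below the least positive one.\<close>

lemma period_dvd_iff:
  assumes "x \<in> int_ring nrm K"
  shows "period x dvd t \<longleftrightarrow> x ^ (q ^ t) \<simeq> x"
proof
  note x = int_ringD(1)[OF assms]
  show "x ^ (q ^ t) \<simeq> x" if "period x dvd t"
    using that frobenius_iterate[OF x period(2)[OF assms]] by (auto elim!: dvdE)
  assume t: "x ^ (q ^ t) \<simeq> x"
  define s where "s = period x"
  have "(x ^ (q ^ (s * (t div s)))) ^ (q ^ (t mod s)) \<simeq> x ^ (q ^ (t mod s))"
    using frobenius_iterate[OF x period(2)[OF assms]] x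
    by (intro resid_power nrm_power_le_1) (simp_all add: s_def)
  then have "x ^ (q ^ t) \<simeq> x ^ (q ^ (t mod s))"
    by (simp only: power_mult[symmetric] power_add[symmetric] mult_div_mod_eq)
  then have "x ^ (q ^ (t mod s)) \<simeq> x"
    using t resid_sym resid_trans by blast
  then have "t mod s = 0"
    using period_le[of "t mod s" x] period(1)[OF assms] mod_less_divisor[of s t]
    unfolding s_def by linarith
  then show "period x dvd t"
    by (auto simp: s_def)
qed

lemma period_dvd_r: "x \<in> int_ring nrm K \<Longrightarrow> period x dvd r"
  using period_dvd_iff frobenius_K by blast

text \<open>The fixed points of the \<open>t\<close>-fold Frobenius map, sorted by their exact
  period.\<close>

lemma sum_card_period:
  assumes "t dvd r"
  shows "(\<Sum>s | s dvd t. card {x \<in> R. period x = s}) = q ^ t"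
proof -
  have "0 < t" using assms r_pos by (auto intro: Nat.gr0I)
  have "(\<Sum>s | s dvd t. card {x \<in> R. period x = s}) = card (\<Union>s\<in>{s. s dvd t}. {x \<in> R. period x = s})"
    using reps_finite[OF R] \<open>0 < t\<close> by (intro card_UN_disjoint[symmetric]) (auto intro: finite_divisors_nat)
  also have "(\<Union>s\<in>{s. s dvd t}. {x \<in> R. period x = s}) = {x \<in> R. x ^ (q ^ t) \<simeq> x}"
    using period_dvd_iff reps_int_ring[OF R] by auto
  finally show ?thesis
    using card_fixed[OF assms \<open>0 < t\<close>] by simp
qed

text \<open>The residue of \<open>x\<close> is a root of a monic polynomial of degree
  \<open>j\<close> over the residue field of \<open>F\<close>.\<close>

definition reduces :: "'a \<Rightarrow> nat \<Rightarrow> bool" where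
  "reduces x j \<longleftrightarrow> (\<exists>a. (\<forall>i. a i \<in> int_ring nrm F) \<and> x ^ j \<simeq> (\<Sum>i<j. a i * x ^ i))"

text \<open>Division by the last unit coefficient makes the relation monic, because the terms beyond
  it vanish modulo the maximal ideal.\<close>

lemma reducesI:
  assumes "\<And>i. i < n \<Longrightarrow> c i \<in> int_ring nrm F" "nrm x \<le> 1" "(\<Sum>i<n. c i * x ^ i) \<simeq> 0"
    "i < n" "nrm (c i) = 1"
  shows "\<exists>j<n. reduces x j"
proof -
  define j where "j = Max {i. i < n \<and> nrm (c i) = 1}"
  have "j \<in> {i. i < n \<and> nrm (c i) = 1}"
    unfolding j_def by (rule Max_in) (use assms in auto)
  then have j: "j < n" "nrm (c j) = 1" by auto
  have big: "nrm (c i) < 1" if "j < i" "i < n" for i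
  proof -
    have "nrm (c i) \<noteq> 1"
      using that Max_ge[of "{i. i < n \<and> nrm (c i) = 1}" i] unfolding j_def by fastforce
    then show ?thesis using int_ringD(1)[OF assms(1)[OF that(2)]] by simp
  qed
  define a where "a = (\<lambda>i. if i < j then - (c i / c j) else 0)"
  have aF: "a i \<in> int_ring nrm F" for i
    using assms(1)[of i] assms(1)[of j] j subF
    by (auto simp: a_def int_ring_def nrm_divide intro: subfield_0 intro!: subfield_minus subfield_divide)
  have "{..<n} = {..<j} \<union> {j} \<union> {j<..<n}" using j by auto
  then have split: "(\<Sum>i<n. c i * x ^ i) = (\<Sum>i<j. c i * x ^ i) + c j * x ^ j + (\<Sum>i\<in>{j<..<n}. c i * x ^ i)"
    by (simp add: sum.union_disjoint disjoint_iff)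
  have "nrm (\<Sum>i\<in>{j<..<n}. c i * x ^ i) < 1"
    using big assms(2) nrm_mult_less[OF nrm_power_le_1[OF assms(2)]]
    by (intro nrm_sum_less) (auto simp: mult.commute)
  then have "nrm ((\<Sum>i<n. c i * x ^ i) - (\<Sum>i\<in>{j<..<n}. c i * x ^ i)) < 1"
    using assms(3) by (intro nrm_diff_less) auto
  then have 1: "nrm ((\<Sum>i<j. c i * x ^ i) + c j * x ^ j) < 1"
    unfolding split by simp
  have cj: "c j \<noteq> 0" using j by auto
  have "(\<Sum>i<j. a i * x ^ i) = - (\<Sum>i<j. c i * x ^ i) / c j"
    unfolding sum_negf[symmetric] sum_divide_distrib by (intro sum.cong) (auto simp: a_def)
  then have "c j * (x ^ j - (\<Sum>i<j. a i * x ^ i)) = (\<Sum>i<j. c i * x ^ i) + c j * x ^ j"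
    using cj by (simp add: field_simps)
  then have "nrm (c j) * nrm (x ^ j - (\<Sum>i<j. a i * x ^ i)) < 1"
    using 1 by (simp flip: nrm_mult)
  then have "reduces x j"
    using aF j by (auto simp: reduces_def)
  then show ?thesis using j by blast
qed

text \<open>Lifts of the span of 1, x, ..., x^(j-1) over the residue field of
  \<open>F\<close>.\<close>

definition rep_sums :: "'a \<Rightarrow> nat \<Rightarrow> 'a set" where
  "rep_sums x j = (\<lambda>a. \<Sum>i<j. a i * x ^ i) ` ({..<j} \<rightarrow>\<^sub>E RF)"

lemma finite_rep_sums: "finite (rep_sums x j)"
  using reps_finite[OF RF] by (auto simp: rep_sums_def intro: finite_PiE)

lemma rep_sums_subset: "x \<in> int_ring nrm K \<Longrightarrow> rep_sums x j \<subseteq> int_ring nrm K"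
  using reps_int_ring[OF RF] int_ring_F_K
  by (auto simp: rep_sums_def intro!: int_ring_intros subK)

lemma rep_sums_ex:
  assumes "x \<in> int_ring nrm K" "\<And>i. i < j \<Longrightarrow> c i \<in> int_ring nrm F"
  shows "\<exists>w\<in>rep_sums x j. (\<Sum>i<j. c i * x ^ i) \<simeq> w"
proof -
  obtain t where t: "\<And>i. i < j \<Longrightarrow> t i \<in> RF \<and> c i \<simeq> t i"
    using reps_ex[OF RF assms(2)] by metis
  have "(\<Sum>i<j. c i * x ^ i) \<simeq> (\<Sum>i<j. t i * x ^ i)"
    using t assms int_ringD(1) by (intro resid_sum resid_mult nrm_power_le_1) auto
  moreover have "(\<Sum>i<j. t i * x ^ i) = (\<Sum>i<j. restrict t {..<j} i * x ^ i)"
    by (intro sum.cong) auto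
  then have "(\<Sum>i<j. t i * x ^ i) \<in> rep_sums x j"
    using t unfolding rep_sums_def by (intro image_eqI[of _ _ "restrict t {..<j}"]) simp_all
  ultimately show ?thesis by blast
qed

text \<open>Distinct representatives differ by a unit, so two different sums with the same residue
  would give a relation to which \<open>reducesI\<close> applies.\<close>

lemma rep_sums_incong:
  assumes "x \<in> int_ring nrm K" "\<And>i. i < j \<Longrightarrow> \<not> reduces x i"
  shows "incong (rep_sums x j)" "card (rep_sums x j) = q ^ j"
proof -
  have *: "a = b" if a: "a \<in> {..<j} \<rightarrow>\<^sub>E RF" and b: "b \<in> {..<j} \<rightarrow>\<^sub>E RF"
    and ab: "(\<Sum>i<j. a i * x ^ i) \<simeq> (\<Sum>i<j. b i * x ^ i)" for a b
  proof (rule ccontr)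
    assume "a \<noteq> b"
    then obtain i where i: "i < j" "a i \<noteq> b i"
      using PiE_ext[OF a b] by auto
    have F: "a i \<in> int_ring nrm F" "b i \<in> int_ring nrm F" if "i < j" for i
      using a b that RF by (auto intro: reps_int_ring)
    have "\<not> a i \<simeq> b i"
      using reps_incong[OF RF] i a b by (auto simp: incong_def PiE_iff)
    moreover have "nrm (a i - b i) \<le> 1"
      using F[OF i(1)] int_ringD(1) by (intro nrm_diff_le) auto
    ultimately have "nrm (a i - b i) = 1" by simp
    moreover have "(\<Sum>i<j. (a i - b i) * x ^ i) \<simeq> 0"
      using ab by (simp add: left_diff_distrib sum_subtractf)
    ultimately obtain k where "k < j" "reduces x k"
      using reducesI[of j "\<lambda>i. a i - b i" x i] F assms(1) i
      by (auto simp: int_ringD intro: int_ring_diff subF)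
    then show False using assms(2) by blast
  qed
  have "inj_on (\<lambda>a. \<Sum>i<j. a i * x ^ i) ({..<j} \<rightarrow>\<^sub>E RF)"
  proof (rule inj_onI)
    fix a b assume "a \<in> {..<j} \<rightarrow>\<^sub>E RF" "b \<in> {..<j} \<rightarrow>\<^sub>E RF"
      "(\<Sum>i<j. a i * x ^ i) = (\<Sum>i<j. b i * x ^ i)"
    then show "a = b" using *[of a b] by simp
  qed
  then have "card (rep_sums x j) = card ({..<j} \<rightarrow>\<^sub>E RF)"
    unfolding rep_sums_def by (rule card_image)
  then show "card (rep_sums x j) = q ^ j"
    by (simp add: card_PiE card_RF)
  show "incong (rep_sums x j)"
    unfolding incong_def
  proof (intro conjI ballI impI)
    show "nrm w \<le> 1" if "w \<in> rep_sums x j" for w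
      using that rep_sums_subset[OF assms(1), of j] int_ringD(1) by blast
    show "v = w" if vw: "v \<in> rep_sums x j" "w \<in> rep_sums x j" "v \<simeq> w" for v w
    proof -
      from vw(1,2) obtain a b where ab: "a \<in> {..<j} \<rightarrow>\<^sub>E RF" "b \<in> {..<j} \<rightarrow>\<^sub>E RF"
        "v = (\<Sum>i<j. a i * x ^ i)" "w = (\<Sum>i<j. b i * x ^ i)"
        unfolding rep_sums_def by blast
      then show ?thesis using *[OF ab(1,2)] vw(3) by simp
    qed
  qed
qed

text \<open>For the least such exponent \<open>j0\<close> the span of the lower powers has q^j0
  residues, and it is stable under multiplication by \<open>x\<close> because \<open>x ^ j0\<close>
  reduces to it. Then \<open>power_card_resid_self\<close> shows that the \<open>j0\<close>-fold
  Frobenius map fixes \<open>x\<close>.\<close>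

lemma period_le_if_reduces:
  assumes x: "x \<in> int_ring nrm K" and "reduces x j"
  shows "period x \<le> j"
proof -
  define j0 where "j0 = (LEAST j. reduces x j)"
  have red: "reduces x j0" and le: "j0 \<le> j" and min: "\<And>i. i < j0 \<Longrightarrow> \<not> reduces x i"
    using LeastI[of "reduces x", OF assms(2)] Least_le[of "reduces x", OF assms(2)]
      not_less_Least[of _ "reduces x"]
    unfolding j0_def by blast+
  obtain a where a: "\<And>i. a i \<in> int_ring nrm F" "x ^ j0 \<simeq> (\<Sum>i<j0. a i * x ^ i)"
    using red by (auto simp: reduces_def)
  have j0: "0 < j0"
    using a(2) by (cases "j0 = 0") auto
  note x1 = int_ringD(1)[OF x]
  define W where "W = rep_sums x j0"
  obtain w0 where w0: "w0 \<in> W" "0 \<simeq> w0"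
    using rep_sums_ex[OF x, of j0 "\<lambda>_. 0"] int_ring_0[OF subF] by (auto simp: W_def)
  have "x ^ card W \<simeq> x"
  proof (rule power_card_resid_self)
    show "\<forall>w\<in>W. \<exists>w'\<in>W. x * w \<simeq> w'"
    proof
      fix w assume "w \<in> W"
      then obtain b where b: "b \<in> {..<j0} \<rightarrow>\<^sub>E RF" "w = (\<Sum>i<j0. b i * x ^ i)"
        by (auto simp: W_def rep_sums_def)
      have bF: "b i \<in> int_ring nrm F" if "i < j0" for i
        using b(1) that RF by (auto intro: reps_int_ring)
      obtain m where m: "j0 = Suc m" using j0 by (cases j0) auto
      \<comment> \<open>Multiplication by \<open>x\<close> shifts the coefficients by one; the
        overflow \<open>b m * x ^ j0\<close> is redistributed by the relation
        \<open>a\<close>.\<close>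
      define c where "c = (\<lambda>i. (if i = 0 then 0 else b (i - 1)) + b m * a i)"
      have "x * w = (\<Sum>i<j0. b i * x ^ Suc i)"
        by (simp add: b(2) sum_distrib_left mult_ac)
      also have "\<dots> = (\<Sum>i<m. b i * x ^ Suc i) + b m * x ^ j0"
        by (simp add: m)
      also have "\<dots> \<simeq> (\<Sum>i<m. b i * x ^ Suc i) + b m * (\<Sum>i<j0. a i * x ^ i)"
        using a(2) int_ringD(1)[OF bF[of m]] x1 m
        by (intro resid_add resid_mult nrm_power_le_1) auto
      also have "(\<Sum>i<m. b i * x ^ Suc i) = (\<Sum>i<j0. (if i = 0 then 0 else b (i - 1)) * x ^ i)"
        by (simp only: m sum.lessThan_Suc_shift) simp
      also have "\<dots> + b m * (\<Sum>i<j0. a i * x ^ i) = (\<Sum>i<j0. c i * x ^ i)"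
        by (simp add: c_def sum_distrib_left distrib_right sum.distrib mult.assoc)
      finally have 1: "x * w \<simeq> (\<Sum>i<j0. c i * x ^ i)" .
      have "c i \<in> int_ring nrm F" if "i < j0" for i
        using that a(1) bF m by (auto simp: c_def intro!: int_ring_intros subF)
      then show "\<exists>w'\<in>W. x * w \<simeq> w'"
        using rep_sums_ex[OF x, of j0 c] 1 resid_trans unfolding W_def by blast
    qed
  qed (use w0 x1 rep_sums_incong[OF x min] in \<open>auto simp: W_def finite_rep_sums\<close>)
  then have "x ^ (q ^ j0) \<simeq> x"
    using rep_sums_incong[OF x min] by (simp add: W_def)
  then show ?thesis
    using period_le[OF j0] le by fastforce
qed

lemma period_r_independent:
  assumes "x \<in> int_ring nrm K" "period x = r" "\<And>i. i < r \<Longrightarrow> c i \<in> int_ring nrm F"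
    "(\<Sum>i<r. c i * x ^ i) \<simeq> 0" "i < r"
  shows "c i \<simeq> 0"
proof (rule ccontr)
  assume "\<not> c i \<simeq> 0"
  then have "nrm (c i) = 1"
    using int_ringD(1)[OF assms(3)[OF assms(5)]] by simp
  then obtain j where "j < r" "reduces x j"
    using reducesI[OF assms(3) _ assms(4,5)] int_ringD(1)[OF assms(1)] by blast
  then show False
    using period_le_if_reduces[OF assms(1)] assms(2) by fastforce
qed

text \<open>By counting: q^r pairwise incongruent sums inject into \<open>R\<close>, which has as
  many elements, so every residue is attained.\<close>

lemma period_r_generates:
  assumes x: "x \<in> int_ring nrm K" and "period x = r" and y: "y \<in> int_ring nrm K"
  shows "\<exists>c. (\<forall>i<r. c i \<in> int_ring nrm F) \<and> y \<simeq> (\<Sum>i<r. c i * x ^ i)"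
proof -
  have "\<not> reduces x i" if "i < r" for i
    using that period_le_if_reduces[OF x] assms(2) by fastforce
  note W = rep_sums_incong[OF x this, of r]
  obtain f where f: "\<And>w. w \<in> rep_sums x r \<Longrightarrow> f w \<in> R \<and> w \<simeq> f w"
    using reps_ex[OF R] rep_sums_subset[OF x, of r] by (metis subset_iff)
  have "inj_on f (rep_sums x r)"
  proof (rule inj_onI)
    fix v w assume vw: "v \<in> rep_sums x r" "w \<in> rep_sums x r" "f v = f w"
    then have "v \<simeq> w" using f[of v] f[of w] resid_sym resid_trans by metis
    then show "v = w" using W(1) vw by (auto simp: incong_def)
  qed
  then have "card (f ` rep_sums x r) = card R"
    using W(2) card_R by (simp add: card_image)
  then have "f ` rep_sums x r = R"
    using f reps_finite[OF R] by (intro card_subset_eq) auto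
  moreover obtain t where t: "t \<in> R" "y \<simeq> t"
    using reps_ex[OF R y] by blast
  ultimately obtain w where w: "w \<in> rep_sums x r" "y \<simeq> w"
    using f resid_sym resid_trans by (metis imageE)
  then obtain c where "c \<in> {..<r} \<rightarrow>\<^sub>E RF" "w = (\<Sum>i<r. c i * x ^ i)"
    by (auto simp: rep_sums_def)
  then show ?thesis
    using w(2) reps_int_ring[OF RF] by (intro exI[of _ c]) (auto simp: PiE_iff)
qed

text \<open>The Frobenius power that fixes \<open>x\<close> fixes every residue of O_F[x]. This
  bounds the image of O_F[x] in the residue field, and thereby its index from below.\<close>

lemma card_poly_values_le:
  assumes x: "x \<in> int_ring nrm K"
  shows "card {t \<in> R. \<exists>y\<in>adjoin (int_ring nrm F) x. t \<simeq> y} \<le> q ^ period x"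
proof (rule card_fixed_le)
  show "\<forall>t\<in>{t \<in> R. \<exists>y\<in>adjoin (int_ring nrm F) x. t \<simeq> y}. t ^ (q ^ period x) \<simeq> t"
  proof safe
    fix t y assume t: "t \<in> R" "y \<in> adjoin (int_ring nrm F) x" "t \<simeq> y"
    then obtain P where P: "y = poly P x" "\<forall>i. coeff P i \<in> int_ring nrm F"
      by (auto simp: adjoin_def)
    have "t ^ (q ^ period x) \<simeq> y ^ (q ^ period x)"
      using t R by (intro resid_power) (auto dest: reps_int_ring intro: int_ringD)
    also have "y ^ (q ^ period x) \<simeq> y"
      unfolding P poly_altdef using P period(2)[OF x] int_ringD(1)[OF x]
      by (intro frobenius_fixes_polys) auto
    also have "y \<simeq> t" using t(3) by (rule resid_sym)
    finally show "t ^ (q ^ period x) \<simeq> t" .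
  qed
qed (use x R period in \<open>auto simp: reps_finite intro: incong_subset[OF reps_incong]\<close>)

end

text \<open>Moebius inversion as an induction: once the terms of the proper divisors agree, the sum
  for \<open>t\<close> leaves only the term of \<open>t\<close>.\<close>

lemma divisor_sum_determines:
  fixes g h :: "nat \<Rightarrow> nat"
  assumes "\<And>t. t dvd r \<Longrightarrow> (\<Sum>s | s dvd t. g s) = (\<Sum>s | s dvd t. h s)" "0 < r" "t dvd r"
  shows "g t = h t"
  using assms(3)
proof (induction t rule: less_induct)
  case (less t)
  have t: "0 < t" using less.prems assms(2) by (auto intro: Nat.gr0I)
  have split: "{s. s dvd t} = insert t {s. s dvd t \<and> s < t}"
    using t by (auto dest: dvd_imp_le simp: le_less)
  have fin: "finite {s. s dvd t \<and> s < t}"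
    by (rule finite_subset[of _ "{..<t}"]) auto
  have "(\<Sum>s | s dvd t \<and> s < t. g s) = (\<Sum>s | s dvd t \<and> s < t. h s)"
    using less by (intro sum.cong) (auto intro: dvd_trans)
  then show ?case
    using assms(1)[OF less.prems] fin by (simp add: split)
qed

section \<open>Linear algebra over a subfield and the trace form\<close>

text \<open>One step of Gaussian elimination, with the pivot \<open>a j\<close> of the equation
  \<open>a\<close>.\<close>

lemma sum_eliminate:
  fixes a f w :: "'i \<Rightarrow> 'a::field"
  assumes "finite I" "j \<in> I" "a j \<noteq> 0" "(\<Sum>i\<in>I. a i * w i) = 0"
  shows "(\<Sum>i\<in>I. f i * w i) = (\<Sum>i\<in>I - {j}. (f i - f j * a i / a j) * w i)"
proof -
  have "a j * w j = - (\<Sum>i\<in>I - {j}. a i * w i)"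
    using assms(4) sum.remove[OF assms(1,2), of "\<lambda>i. a i * w i"] by (simp add: eq_neg_iff_add_eq_0)
  then have w: "w j = - (\<Sum>i\<in>I - {j}. a i * w i) / a j"
    using assms(3) by (simp add: field_simps)
  have "(\<Sum>i\<in>I - {j}. (f i - f j * a i / a j) * w i)
      = (\<Sum>i\<in>I - {j}. f i * w i) - f j / a j * (\<Sum>i\<in>I - {j}. a i * w i)"
    by (simp add: left_diff_distrib sum_subtractf sum_distrib_left mult.assoc)
  also have "\<dots> = (\<Sum>i\<in>I - {j}. f i * w i) + f j * w j"
    by (simp add: w)
  finally show ?thesis
    using sum.remove[OF assms(1,2), of "\<lambda>i. f i * w i"] by simp
qed

text \<open>Back substitution: a solution of the eliminated system is completed by computing the
  unknown \<open>j\<close> from the equation \<open>a\<close>.\<close>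

lemma solution_extend:
  fixes A :: "'e \<Rightarrow> 'i \<Rightarrow> 'a::field"
  assumes F: "is_subfield F" and "finite I" "j \<in> I" "a j \<noteq> 0" "\<forall>i\<in>I. a i \<in> F"
    and v: "\<forall>i\<in>I - {j}. v i \<in> F" "\<exists>i\<in>I - {j}. v i \<noteq> 0"
    "\<forall>e\<in>E. (\<Sum>i\<in>I - {j}. (A e i - A e j * a i / a j) * v i) = 0"
  shows "\<exists>w. (\<forall>i\<in>I. w i \<in> F) \<and> (\<exists>i\<in>I. w i \<noteq> 0) \<and> (\<Sum>i\<in>I. a i * w i) = 0
    \<and> (\<forall>e\<in>E. (\<Sum>i\<in>I. A e i * w i) = 0)"
proof -
  define w where "w = v(j := - (\<Sum>i\<in>I - {j}. a i * v i) / a j)"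
  have eq: "(\<Sum>i\<in>I - {j}. f i * w i) = (\<Sum>i\<in>I - {j}. f i * v i)" for f
    by (intro sum.cong) (auto simp: w_def)
  have 0: "(\<Sum>i\<in>I. a i * w i) = 0"
    using sum.remove[OF assms(2,3), of "\<lambda>i. a i * w i"] assms(4) by (simp add: eq) (simp add: w_def)
  have "(\<Sum>i\<in>I. A e i * w i) = 0" if "e \<in> E" for e
    using sum_eliminate[OF assms(2,3,4) 0, of "A e"] v(3) that by (simp add: eq)
  moreover have "\<exists>i\<in>I. w i \<noteq> 0"
    using v(2) by (auto simp: w_def)
  moreover have "w i \<in> F" if "i \<in> I" for i
    using that assms(3,5) v(1) F by (auto simp: w_def intro!: subfield_divide subfield_minus subfield_sum subfield_mult)
  ultimately show ?thesis
    using 0 by blast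
qed

lemma homogeneous_solution:
  fixes A :: "'e \<Rightarrow> 'i \<Rightarrow> 'a::field"
  assumes F: "is_subfield F" and "finite E" "finite I" "card E < card I" "\<forall>e\<in>E. \<forall>i\<in>I. A e i \<in> F"
  shows "\<exists>v. (\<forall>i\<in>I. v i \<in> F) \<and> (\<exists>i\<in>I. v i \<noteq> 0) \<and> (\<forall>e\<in>E. (\<Sum>i\<in>I. A e i * v i) = 0)"
  using assms(2-)
proof (induction E arbitrary: I A rule: finite_induct)
  case empty
  then obtain i where "i \<in> I" by fastforce
  then show ?case
    using subfield_1[OF F] by (intro exI[of _ "\<lambda>_. 1"]) auto
next
  case (insert e E)
  show ?case
  proof (cases "\<forall>i\<in>I. A e i = 0")
    case True
    then show ?thesis
      using insert.IH[of I A] insert.prems insert.hyps by auto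
  next
    case False
    then obtain j where j: "j \<in> I" "A e j \<noteq> 0" by blast
    have "\<exists>v. (\<forall>i\<in>I - {j}. v i \<in> F) \<and> (\<exists>i\<in>I - {j}. v i \<noteq> 0)
      \<and> (\<forall>f\<in>E. (\<Sum>i\<in>I - {j}. (A f i - A f j * A e i / A e j) * v i) = 0)"
      using insert.prems insert.hyps j F
      by (intro insert.IH) (auto intro!: subfield_diff subfield_divide subfield_mult)
    then show ?thesis
      using solution_extend[of F I j "A e" _ E A] F insert.prems j by auto
  qed
qed

text \<open>Elimination with pivots in \<open>F\<close> works for a solution \<open>u\<close> in the
  larger field as well, so an induction on the number of unknowns ends with a solution in
  \<open>F\<close>. It is used for kernel vectors whose entries lie in the ambient field.\<close>

lemma homogeneous_solution_descent:
  fixes A :: "'e \<Rightarrow> 'i \<Rightarrow> 'a::field"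
  assumes F: "is_subfield F" and "finite I" "\<forall>e\<in>E. \<forall>i\<in>I. A e i \<in> F"
    "\<exists>i\<in>I. u i \<noteq> 0" "\<forall>e\<in>E. (\<Sum>i\<in>I. A e i * u i) = 0"
  shows "\<exists>v. (\<forall>i\<in>I. v i \<in> F) \<and> (\<exists>i\<in>I. v i \<noteq> 0) \<and> (\<forall>e\<in>E. (\<Sum>i\<in>I. A e i * v i) = 0)"
  using assms(2-)
proof (induction "card I" arbitrary: I A)
  case 0
  then show ?case by auto
next
  case (Suc n)
  show ?case
  proof (cases "\<forall>e\<in>E. \<forall>i\<in>I. A e i = 0")
    case True
    then show ?thesis
      using Suc.prems subfield_1[OF F] by (intro exI[of _ "\<lambda>_. 1"]) auto
  next
    case False
    then obtain e j where e: "e \<in> E" and j: "j \<in> I" "A e j \<noteq> 0" by blast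
    have e0: "(\<Sum>i\<in>I. A e i * u i) = 0" using Suc.prems e by blast
    \<comment> \<open>The solution stays nontrivial after elimination: if it vanished off the pivot,
      the equation \<open>e\<close> would force \<open>u j = 0\<close>.\<close>
    have "\<exists>i\<in>I - {j}. u i \<noteq> 0"
    proof (rule ccontr)
      assume *: "\<not> (\<exists>i\<in>I - {j}. u i \<noteq> 0)"
      then have "u j = 0"
        using e0 j sum.remove[OF Suc.prems(1) j(1), of "\<lambda>i. A e i * u i"] by simp
      then show False using * Suc.prems(3) by blast
    qed
    then have "\<exists>v. (\<forall>i\<in>I - {j}. v i \<in> F) \<and> (\<exists>i\<in>I - {j}. v i \<noteq> 0)
      \<and> (\<forall>f\<in>E. (\<Sum>i\<in>I - {j}. (A f i - A f j * A e i / A e j) * v i) = 0)"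
      using Suc.prems Suc.hyps(2) e j F sum_eliminate[of I j "A e" u, OF Suc.prems(1) j e0]
      by (intro Suc.hyps(1)) (auto intro!: subfield_diff subfield_divide subfield_mult)
    then show ?thesis
      using solution_extend[of F I j "A e" _ E A] F Suc.prems(1,2) j e by blast
  qed
qed

lemma is_basis_mem: "is_basis A M r b \<Longrightarrow> i < r \<Longrightarrow> b i \<in> M"
  by (simp add: is_basis_def)

lemma is_basis_unique:
  assumes "is_basis A M r b" "\<And>i. i < r \<Longrightarrow> c i \<in> A" "\<And>i. i < r \<Longrightarrow> c' i \<in> A"
    "(\<Sum>i<r. c i * b i) \<in> M" "(\<Sum>i<r. c i * b i) = (\<Sum>i<r. c' i * b i)" "i < r"
  shows "c i = c' i"
proof -
  let ?x = "\<Sum>i<r. c i * b i"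
  have "\<exists>!c. c \<in> {..<r} \<rightarrow>\<^sub>E A \<and> ?x = (\<Sum>i<r. c i * b i)"
    using assms(1,4) by (simp add: is_basis_def)
  moreover have "restrict c {..<r} \<in> {..<r} \<rightarrow>\<^sub>E A \<and> ?x = (\<Sum>i<r. restrict c {..<r} i * b i)"
    using assms(2) by (auto intro!: sum.cong)
  moreover have "restrict c' {..<r} \<in> {..<r} \<rightarrow>\<^sub>E A \<and> ?x = (\<Sum>i<r. restrict c' {..<r} i * b i)"
    using assms(3,5) by (auto intro!: sum.cong)
  ultimately have "restrict c {..<r} = restrict c' {..<r}"
    by blast
  then show ?thesis
    using assms(6) by (metis lessThan_iff restrict_apply')
qed

lemma coords:
  assumes "is_basis A M r b" "x \<in> M"
  shows "i < r \<Longrightarrow> coords A r b x i \<in> A" "x = (\<Sum>i<r. coords A r b x i * b i)"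
proof -
  have "\<exists>!c. c \<in> {..<r} \<rightarrow>\<^sub>E A \<and> x = (\<Sum>i<r. c i * b i)"
    using assms by (simp add: is_basis_def)
  from theI'[OF this] show "i < r \<Longrightarrow> coords A r b x i \<in> A" "x = (\<Sum>i<r. coords A r b x i * b i)"
    by (auto simp: coords_def)
qed

lemma is_basis_ex:
  assumes "is_basis A M r b" "x \<in> M"
  shows "\<exists>c. (\<forall>i<r. c i \<in> A) \<and> x = (\<Sum>i<r. c i * b i)"
  using coords[OF assms] by blast

lemma coords_eq:
  assumes "is_basis A M r b" "x \<in> M" "\<And>i. i < r \<Longrightarrow> c i \<in> A" "x = (\<Sum>i<r. c i * b i)" "i < r"
  shows "coords A r b x i = c i"
proof (rule is_basis_unique[OF assms(1) _ _ _ _ assms(5)])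
  show "(\<Sum>i<r. coords A r b x i * b i) \<in> M" "(\<Sum>i<r. coords A r b x i * b i) = (\<Sum>i<r. c i * b i)"
    using coords(2)[OF assms(1,2)] assms(2,4) by simp_all
qed (use coords(1)[OF assms(1,2)] assms(3) in auto)

context
  fixes F K :: "'a::field set" and r :: nat and b :: "nat \<Rightarrow> 'a"
  assumes F: "is_subfield F" and K: "is_subfield K" and FK: "F \<subseteq> K" and b: "is_basis F K r b"
begin

lemma basis_independent:
  assumes "\<And>i. i < r \<Longrightarrow> c i \<in> F" "(\<Sum>i<r. c i * b i) = 0" "i < r"
  shows "c i = 0"
  using is_basis_unique[OF b, of c "\<lambda>_. 0"] assms subfield_0[OF F] subfield_0[OF K] by auto

lemma basis_size_pos: "0 < r"
proof (rule ccontr)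
  assume "\<not> 0 < r"
  then have "(1::'a) = 0"
    using is_basis_ex[OF b subfield_1[OF K]] by auto
  then show False by simp
qed

lemma family_dependent:
  assumes "finite I" "r < card I" "\<And>i. i \<in> I \<Longrightarrow> v i \<in> K"
  shows "\<exists>c. (\<forall>i\<in>I. c i \<in> F) \<and> (\<exists>i\<in>I. c i \<noteq> 0) \<and> (\<Sum>i\<in>I. c i * v i) = 0"
proof -
  have "\<exists>c. (\<forall>i\<in>I. c i \<in> F) \<and> (\<exists>i\<in>I. c i \<noteq> 0) \<and> (\<forall>e\<in>{..<r}. (\<Sum>i\<in>I. coords F r b (v i) e * c i) = 0)"
    using assms coords(1)[OF b] by (intro homogeneous_solution[OF F]) auto
  then obtain c where c: "\<forall>i\<in>I. c i \<in> F" "\<exists>i\<in>I. c i \<noteq> 0"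
    "\<forall>e<r. (\<Sum>i\<in>I. coords F r b (v i) e * c i) = 0" by auto
  have "(\<Sum>i\<in>I. c i * v i) = (\<Sum>i\<in>I. c i * (\<Sum>e<r. coords F r b (v i) e * b e))"
    using assms(3) coords(2)[OF b] by (intro sum.cong) auto
  also have "\<dots> = (\<Sum>e<r. (\<Sum>i\<in>I. coords F r b (v i) e * c i) * b e)"
    by (simp add: sum_distrib_left sum_distrib_right mult_ac) (rule sum.swap)
  also have "\<dots> = 0" using c(3) by simp
  finally show ?thesis using c by blast
qed

text \<open>Otherwise the \<open>r\<close> basis vectors, expanded in fewer than \<open>r\<close>
  elements, satisfy a nontrivial relation.\<close>

lemma spanning_size_ge:
  assumes "\<And>x. x \<in> K \<Longrightarrow> \<exists>c. (\<forall>i<k. c i \<in> F) \<and> x = (\<Sum>i<k. c i * e i)"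
  shows "r \<le> k"
proof (rule ccontr)
  assume *: "\<not> r \<le> k"
  have "\<forall>j\<in>{..<r}. \<exists>c. (\<forall>i<k. c i \<in> F) \<and> b j = (\<Sum>i<k. c i * e i)"
    using assms is_basis_mem[OF b] by simp
  from bchoice[OF this] obtain A where
    A: "\<And>j. j < r \<Longrightarrow> (\<forall>i<k. A j i \<in> F) \<and> b j = (\<Sum>i<k. A j i * e i)"
    by auto
  have "\<exists>c. (\<forall>j\<in>{..<r}. c j \<in> F) \<and> (\<exists>j\<in>{..<r}. c j \<noteq> 0) \<and> (\<forall>i\<in>{..<k}. (\<Sum>j<r. A j i * c j) = 0)"
    using A * by (intro homogeneous_solution[OF F]) auto
  then obtain c where c: "\<forall>j<r. c j \<in> F" "\<exists>j<r. c j \<noteq> 0" "\<forall>i<k. (\<Sum>j<r. A j i * c j) = 0"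
    by auto
  have "c j * b j = c j * (\<Sum>i<k. A j i * e i)" if "j < r" for j
    using A[OF that] by simp
  then have "(\<Sum>j<r. c j * b j) = (\<Sum>j<r. c j * (\<Sum>i<k. A j i * e i))"
    by (intro sum.cong) auto
  also have "\<dots> = (\<Sum>i<k. (\<Sum>j<r. A j i * c j) * e i)"
    by (simp add: sum_distrib_left sum_distrib_right mult_ac) (rule sum.swap)
  also have "\<dots> = 0" using c(3) by simp
  finally show False using basis_independent[of c] c(1,2) by blast
qed

text \<open>With \<open>y\<close> added at the index \<open>r\<close>, there are r + 1 elements and
  hence a relation; independence of the others makes the coefficient of \<open>y\<close>
  nonzero.\<close>

lemma independent_spans:
  assumes "\<And>i. i < r \<Longrightarrow> e i \<in> K"
    and ind: "\<And>c i. (\<And>i. i < r \<Longrightarrow> c i \<in> F) \<Longrightarrow> (\<Sum>i<r. c i * e i) = 0 \<Longrightarrow> i < r \<Longrightarrow> c i = 0"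
    and "y \<in> K"
  shows "\<exists>c. (\<forall>i<r. c i \<in> F) \<and> y = (\<Sum>i<r. c i * e i)"
proof -
  have "\<exists>c. (\<forall>i\<in>{..r}. c i \<in> F) \<and> (\<exists>i\<in>{..r}. c i \<noteq> 0)
      \<and> (\<Sum>i\<le>r. c i * (if i < r then e i else y)) = 0"
    using assms(1,3) by (intro family_dependent) auto
  then obtain c where c: "\<forall>i\<in>{..r}. c i \<in> F" "\<exists>i\<in>{..r}. c i \<noteq> 0"
    "(\<Sum>i\<le>r. c i * (if i < r then e i else y)) = 0"
    by blast
  have sum: "(\<Sum>i<r. c i * e i) + c r * y = 0"
    using c(3) by (simp flip: lessThan_Suc_atMost)
  have "c r \<noteq> 0"
  proof
    assume 0: "c r = 0"
    then have "c i = 0" if "i < r" for i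
      using ind[of c i] c(1) sum that by simp
    then show False using c(2) 0 by (metis atMost_iff le_less)
  qed
  then have "y = (\<Sum>i<r. - c i / c r * e i)"
  proof -
    assume cr: "c r \<noteq> 0"
    have "c r * (\<Sum>i<r. - c i / c r * e i) = - (\<Sum>i<r. c i * e i)"
      using cr by (simp add: sum_distrib_left sum_negf)
    then have "c r * y = c r * (\<Sum>i<r. - c i / c r * e i)"
      using sum by (simp add: add_eq_0_iff)
    then show ?thesis using cr by simp
  qed
  moreover have "\<forall>i<r. - c i / c r \<in> F"
    using c(1) F by (auto intro!: subfield_divide subfield_minus)
  ultimately show ?thesis by (intro exI[of _ "\<lambda>i. - c i / c r"] conjI)
qed

lemma ext_trace_sum:
  assumes "\<And>j. j \<in> J \<Longrightarrow> c j \<in> F" "\<And>j. j \<in> J \<Longrightarrow> y j \<in> K"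
  shows "ext_trace F r b (\<Sum>j\<in>J. c j * y j) = (\<Sum>j\<in>J. c j * ext_trace F r b (y j))"
proof -
  have "coords F r b ((\<Sum>j\<in>J. c j * y j) * b i) i = (\<Sum>j\<in>J. c j * coords F r b (y j * b i) i)"
    if i: "i < r" for i
  proof (rule coords_eq[OF b, where c = "\<lambda>k. \<Sum>j\<in>J. c j * coords F r b (y j * b i) k"])
    have yb: "y j * b i \<in> K" if "j \<in> J" for j
      using assms(2)[OF that] is_basis_mem[OF b i] K by (auto intro: subfield_mult)
    show "(\<Sum>j\<in>J. c j * y j) * b i \<in> K"
      using assms is_basis_mem[OF b i] K FK by (auto intro!: subfield_mult subfield_sum)
    show "(\<Sum>j\<in>J. c j * coords F r b (y j * b i) k) \<in> F" if "k < r" for k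
      using that assms(1) coords(1)[OF b yb] F by (auto intro!: subfield_mult subfield_sum)
    have "(\<Sum>j\<in>J. c j * y j) * b i = (\<Sum>j\<in>J. c j * (y j * b i))"
      by (simp add: sum_distrib_right mult.assoc)
    also have "\<dots> = (\<Sum>j\<in>J. c j * (\<Sum>k<r. coords F r b (y j * b i) k * b k))"
      using coords(2)[OF b yb] by (intro sum.cong) auto
    also have "\<dots> = (\<Sum>k<r. (\<Sum>j\<in>J. c j * coords F r b (y j * b i) k) * b k)"
      by (simp add: sum_distrib_left sum_distrib_right mult.assoc) (rule sum.swap)
    finally show "(\<Sum>j\<in>J. c j * y j) * b i = (\<Sum>k<r. (\<Sum>j\<in>J. c j * coords F r b (y j * b i) k) * b k)" .
  qed fact
  then have "ext_trace F r b (\<Sum>j\<in>J. c j * y j) = (\<Sum>i<r. \<Sum>j\<in>J. c j * coords F r b (y j * b i) i)"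
    by (simp add: ext_trace_def)
  also have "\<dots> = (\<Sum>j\<in>J. c j * ext_trace F r b (y j))"
    unfolding ext_trace_def by (simp add: sum_distrib_left) (rule sum.swap)
  finally show ?thesis .
qed

lemma ext_trace_1: "ext_trace F r b 1 = of_nat r"
proof -
  have "coords F r b (1 * b i) i = 1" if i: "i < r" for i
  proof -
    have "(\<Sum>j<r. (if j = i then 1 else 0) * b j) = (\<Sum>j<r. if j = i then b j else 0)"
      by (intro sum.cong) auto
    then have "b i = (\<Sum>j<r. (if j = i then 1 else 0) * b j)"
      using i by simp
    then have "coords F r b (b i) i = (if i = i then 1 else 0)"
      using i subfield_0[OF F] subfield_1[OF F] is_basis_mem[OF b i]
      by (intro coords_eq[OF b]) auto
    then show ?thesis by simp
  qed
  then show ?thesis by (simp add: ext_trace_def)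
qed

lemma ext_trace_mem:
  assumes "x \<in> K"
  shows "ext_trace F r b x \<in> F"
  unfolding ext_trace_def using assms is_basis_mem[OF b] K
  by (intro subfield_sum[OF F] coords(1)[OF b]) (auto intro: subfield_mult)

text \<open>A vector in the kernel of the trace form gives some nonzero \<open>y\<close> with trace
  0 against every basis element. By linearity the trace of \<open>inverse y * y\<close> is 0 as
  well, but the trace of 1 is \<open>r\<close>.\<close>

lemma trace_form_det_nonzero:
  assumes "of_nat r \<noteq> (0::'a)"
  shows "Determinant.det (Matrix.mat r r (\<lambda>(i, j). ext_trace F r b (b i * b j))) \<noteq> 0"
proof
  define T where "T = (\<lambda>i j. ext_trace F r b (b i * b j))"
  define M where "M = Matrix.mat r r (\<lambda>(i, j). T i j)"
  have M: "M \<in> carrier_mat r r" by (simp add: M_def)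
  assume "Determinant.det (Matrix.mat r r (\<lambda>(i, j). ext_trace F r b (b i * b j))) = 0"
  then have "Determinant.det M = 0" by (simp add: M_def T_def)
  then obtain v where v: "v \<in> carrier_vec r" "v \<noteq> 0\<^sub>v r" "M *\<^sub>v v = 0\<^sub>v r"
    using det_0_iff_vec_prod_zero_field[OF M] by blast
  \<comment> \<open>The vanishing determinant yields a kernel vector over the ambient field, whereas
    \<open>y\<close> has to lie in \<open>K\<close> and so needs coordinates in
    \<open>F\<close>.\<close>
  have "\<exists>u. (\<forall>i\<in>{..<r}. u i \<in> F) \<and> (\<exists>i\<in>{..<r}. u i \<noteq> 0) \<and> (\<forall>e\<in>{..<r}. (\<Sum>i<r. T e i * u i) = 0)"
  proof (rule homogeneous_solution_descent[OF F])
    show "\<forall>e\<in>{..<r}. \<forall>i\<in>{..<r}. T e i \<in> F"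
      using is_basis_mem[OF b] K by (auto simp: T_def intro!: ext_trace_mem subfield_mult)
    show "\<exists>i\<in>{..<r}. vec_index v i \<noteq> 0"
      using v(1,2) by (metis carrier_vecD eq_vecI index_zero_vec lessThan_iff)
    show "\<forall>e\<in>{..<r}. (\<Sum>i<r. T e i * vec_index v i) = 0"
    proof
      fix e assume e: "e \<in> {..<r}"
      then have "vec_index (M *\<^sub>v v) e = (\<Sum>i<r. T e i * vec_index v i)"
        using v(1) by (auto simp: M_def scalar_prod_def lessThan_atLeast0 intro!: sum.cong)
      then show "(\<Sum>i<r. T e i * vec_index v i) = 0"
        using v(3) e by simp
    qed
  qed simp
  then obtain u where u: "\<forall>i<r. u i \<in> F" "\<exists>i<r. u i \<noteq> 0" "\<forall>e<r. (\<Sum>i<r. T e i * u i) = 0"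
    by auto
  define y where "y = (\<Sum>i<r. u i * b i)"
  have y: "y \<noteq> 0" using basis_independent[of u] u by (auto simp: y_def)
  have yK: "y \<in> K"
    using u(1) is_basis_mem[OF b] K FK by (auto simp: y_def intro!: subfield_sum subfield_mult)
  have 0: "ext_trace F r b (b e * y) = 0" if "e < r" for e
  proof -
    have "b e * y = (\<Sum>i<r. u i * (b e * b i))"
      by (simp add: y_def sum_distrib_left mult_ac)
    then have "ext_trace F r b (b e * y) = (\<Sum>i<r. u i * T e i)"
      using ext_trace_sum[of "{..<r}" u "\<lambda>i. b e * b i"] u(1) is_basis_mem[OF b] K that
      by (simp add: T_def subfield_mult)
    then show ?thesis
      using u(3) that by (simp add: mult.commute)
  qed
  obtain c where c: "\<forall>i<r. c i \<in> F" "inverse y = (\<Sum>i<r. c i * b i)"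
    using is_basis_ex[OF b subfield_inverse[OF K yK]] by blast
  have "1 = inverse y * y" using y by simp
  also have "\<dots> = (\<Sum>i<r. c i * (b i * y))"
    by (simp add: c(2) sum_distrib_right mult.assoc)
  finally have "ext_trace F r b 1 = (\<Sum>i<r. c i * ext_trace F r b (b i * y))"
    using ext_trace_sum[of "{..<r}" c "\<lambda>i. b i * y"] c(1) is_basis_mem[OF b] K yK
    by (simp add: subfield_mult)
  then show False
    using 0 ext_trace_1 assms by simp
qed

end

section \<open>The index of $p O_F$ and the uniformizer\<close>

context nonarch
begin

lemma Metric_space_nrm: "Metric_space S (\<lambda>x y. nrm (x - y))"
proof
  fix x y z
  show "nrm (x - z) \<le> nrm (x - y) + nrm (y - z)"
    using nrm_add[of "x - y" "y - z"] nrm_nonneg[of "x - y"] nrm_nonneg[of "y - z"]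
    unfolding diff_add_cancel add_diff_eq by linarith
qed (auto simp: nrm_minus_commute)

lemma partial_sums_close:
  assumes "0 \<le> c" "c < 1" "\<And>n. nrm (a n) \<le> c ^ n" "N \<le> m" "N \<le> n"
  shows "nrm ((\<Sum>i<m. a i) - (\<Sum>i<n. a i)) \<le> c ^ N"
proof -
  have *: "nrm ((\<Sum>i<n. a i) - (\<Sum>i<N. a i)) \<le> c ^ N" if "N \<le> n" for n
  proof -
    have "(\<Sum>i<n. a i) - (\<Sum>i<N. a i) = (\<Sum>i\<in>{N..<n}. a i)"
      using that sum_diff_nat_ivl[of 0 N n a] by (simp add: lessThan_atLeast0)
    also have "nrm \<dots> \<le> c ^ N"
    proof (rule nrm_sum_le)
      fix i assume "i \<in> {N..<n}"
      then have "c ^ i \<le> c ^ N" using assms(1,2) by (intro power_decreasing) auto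
      then show "nrm (a i) \<le> c ^ N" using assms(3)[of i] by linarith
    qed (use assms(1) in simp)
    finally show ?thesis .
  qed
  have "nrm (((\<Sum>i<m. a i) - (\<Sum>i<N. a i)) - ((\<Sum>i<n. a i) - (\<Sum>i<N. a i))) \<le> c ^ N"
    by (rule nrm_diff_le[OF *[OF assms(4)] *[OF assms(5)]])
  then show ?thesis by simp
qed

text \<open>In an ultrametric the tail from N on is bounded by its largest term, which gives an
  explicit error for every partial sum; digit expansions are compared with their limits through
  it.\<close>

lemma series_converges:
  assumes S: "is_subfield S" "Metric_space.mcomplete S (\<lambda>x y. nrm (x - y))"
    and "0 < c" "c < 1" "\<And>n. a n \<in> S" "\<And>n. nrm (a n) \<le> c ^ n"
  shows "\<exists>s\<in>S. \<forall>N. nrm ((\<Sum>i<N. a i) - s) \<le> c ^ N"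
proof -
  interpret Metric_space S "\<lambda>x y. nrm (x - y)"
    by (rule Metric_space_nrm)
  have mem: "(\<Sum>i<N. a i) \<in> S" for N
    using assms(5) S(1) by (intro subfield_sum)
  have "MCauchy (\<lambda>N. \<Sum>i<N. a i)"
    unfolding MCauchy_def
  proof (intro conjI allI impI)
    fix \<epsilon> :: real assume "0 < \<epsilon>"
    then obtain N where "c ^ N < \<epsilon>"
      using real_arch_pow_inv[of \<epsilon> c] assms(4) by blast
    then show "\<exists>N. \<forall>n n'. N \<le> n \<longrightarrow> N \<le> n' \<longrightarrow> nrm (sum a {..<n} - sum a {..<n'}) < \<epsilon>"
      using partial_sums_close[OF less_imp_le[OF assms(3)] assms(4,6)] by (meson order_le_less_trans)
  qed (use mem in auto)
  then obtain s where "limitin mtopology (\<lambda>N. \<Sum>i<N. a i) s sequentially"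
    using S(2) by (auto simp: mcomplete_def)
  then have s: "s \<in> S" "\<And>\<epsilon>. 0 < \<epsilon> \<Longrightarrow> \<exists>N. \<forall>n\<ge>N. nrm ((\<Sum>i<n. a i) - s) < \<epsilon>"
    unfolding limit_metric_sequentially by blast+
  have "nrm ((\<Sum>i<N. a i) - s) \<le> c ^ N" for N
  proof -
    have "0 < c ^ N" using assms(3) by simp
    then obtain M where M: "\<And>n. n \<ge> M \<Longrightarrow> nrm ((\<Sum>i<n. a i) - s) < c ^ N"
      using s(2) by blast
    have "nrm ((\<Sum>i<N. a i) - (\<Sum>i<max M N. a i) + ((\<Sum>i<max M N. a i) - s)) \<le> c ^ N"
      using partial_sums_close[OF less_imp_le[OF assms(3)] assms(4,6), of N N "max M N"] M[of "max M N"]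
      by (intro nrm_add_le) auto
    then show ?thesis by simp
  qed
  then show ?thesis using s(1) by blast
qed

text \<open>\<open>y\<close> is divided by the highest power of \<open>\<pi>\<close> whose norm
  still bounds it; the quotient has norm above that of \<open>\<pi>\<close>, hence 1.\<close>

lemma nrm_eq_uniformizer_power:
  assumes K: "is_subfield K" and \<pi>: "\<pi> \<in> K" "\<pi> \<noteq> 0" "nrm \<pi> < 1"
    and le: "\<And>x. x \<in> K \<Longrightarrow> nrm x < 1 \<Longrightarrow> nrm x \<le> nrm \<pi>"
    and y: "y \<in> K" "y \<noteq> 0" "nrm y \<le> 1"
  shows "\<exists>m. nrm y = nrm \<pi> ^ m"
proof -
  obtain N where N: "nrm \<pi> ^ N < nrm y"
    using real_arch_pow_inv[of "nrm y" "nrm \<pi>"] y(2) \<pi>(3) by auto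
  \<comment> \<open>The bound \<open>N\<close> makes the set finite, so that the maximum exists;
    \<open>N\<close> itself is not a member.\<close>
  define m where "m = Max {m. m \<le> N \<and> nrm y \<le> nrm \<pi> ^ m}"
  have "m \<in> {m. m \<le> N \<and> nrm y \<le> nrm \<pi> ^ m}"
    unfolding m_def using y(3) by (intro Max_in) (auto intro!: exI[of _ 0])
  moreover have "m \<noteq> N" using calculation N by auto
  ultimately have m: "m < N" "nrm y \<le> nrm \<pi> ^ m" by auto
  have "nrm \<pi> ^ Suc m < nrm y"
  proof (rule ccontr)
    assume "\<not> nrm \<pi> ^ Suc m < nrm y"
    then have "Suc m \<in> {m. m \<le> N \<and> nrm y \<le> nrm \<pi> ^ m}" using m(1) by auto
    then have "Suc m \<le> m" unfolding m_def by (intro Max_ge) auto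
    then show False by simp
  qed
  then have "\<not> nrm (y / \<pi> ^ m) \<le> nrm \<pi>"
    using \<pi>(2) by (simp add: nrm_divide nrm_power field_simps)
  then have "\<not> nrm (y / \<pi> ^ m) < 1"
    using le[of "y / \<pi> ^ m"] \<pi>(1) y(1) K by (auto intro!: subfield_divide subfield_power)
  then have "nrm y = nrm \<pi> ^ m"
    using m(2) \<pi>(2) by (simp add: nrm_divide nrm_power field_simps)
  then show ?thesis by blast
qed

end

section \<open>Digits modulo p in the integers of F\<close>

locale padic = nonarch nrm for nrm :: "'a::field_char_0 \<Rightarrow> real" +
  fixes Qp F :: "'a set" and p d :: nat and b :: "nat \<Rightarrow> 'a"
  assumes prime_p: "prime p" and Qp: "is_completion_of_Rats nrm Qp" and nrm_p: "nrm (of_nat p) < 1"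
    and subQp: "is_subfield Qp" and subF: "is_subfield F" and QpF: "Qp \<subseteq> F" and b: "is_basis Qp F d b"
begin

abbreviation "\<omega> \<equiv> nrm (of_nat p)"

lemma p_pos: "0 < p"
  using prime_p by (rule prime_gt_0_nat)

lemma \<omega>_pos: "0 < \<omega>"
  using p_pos by simp

lemma nrm_of_int_dvd: "int p dvd m \<Longrightarrow> nrm (of_int m) \<le> \<omega>"
  using nrm_mult_le[OF nrm_of_int_le_1, of "of_nat p" \<omega>] by (auto elim!: dvdE simp: mult.commute)

lemma bezout_p:
  assumes "\<not> int p dvd m"
  obtains u v where "u * m + v * int p = 1"
proof -
  have "coprime m (int p)"
    using prime_imp_coprime[of "int p" m] assms prime_p by (simp add: coprime_commute)
  then show ?thesis
    using bezout_int[of m "int p"] that by (metis coprime_iff_gcd_eq_1)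
qed

lemma nrm_of_int_eq_1:
  assumes "\<not> int p dvd m"
  shows "nrm (of_int m) = 1"
proof (rule ccontr)
  assume "nrm (of_int m) \<noteq> 1"
  then have 1: "nrm (of_int m) < 1" using nrm_of_int_le_1[of m] by simp
  obtain u v where "u * m + v * int p = 1" using bezout_p[OF assms] .
  then have "of_int u * of_int m + of_int v * of_nat p = (1::'a)"
    by (metis of_int_1 of_int_add of_int_mult of_int_of_nat_eq)
  moreover have "nrm (of_int u * of_int m + of_int v * of_nat p) < 1"
    using 1 nrm_p by (intro nrm_add_less nrm_mult_less nrm_of_int_le_1)
  ultimately show False by simp
qed

lemma int_digit: "\<exists>z<p. int p dvd m - int z \<and> nrm (of_int m - of_nat z) \<le> \<omega>"
proof -
  define z where "z = nat (m mod int p)"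
  have z: "int z = m mod int p" "z < p"
    using p_pos by (auto simp: z_def nat_less_iff)
  then have "int p dvd m - int z" by (simp add: mod_eq_dvd_iff[symmetric])
  moreover from this have "nrm (of_int (m - int z)) \<le> \<omega>" by (rule nrm_of_int_dvd)
  ultimately show ?thesis using z(2) by auto
qed

lemma Qp_rat_approx:
  assumes "c \<in> Qp" "0 < \<epsilon>"
  shows "\<exists>y\<in>\<rat>. nrm (c - y) < \<epsilon>"
proof -
  interpret Metric_space UNIV "\<lambda>x y. nrm (x - y)"
    by (rule Metric_space_nrm)
  have "Qp = mtopology closure_of \<rat>"
    using Qp by (simp add: is_completion_of_Rats_def nrm_topology_def)
  then show ?thesis
    using assms by (auto simp: metric_closure_of)
qed

text \<open>Density reduces this to a rational number m/n of norm at most 1. Its denominator is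
  prime to \<open>p\<close>, and m/n is congruent to the integer u m, where u inverts n modulo
  \<open>p\<close>.\<close>

lemma Qp_digit:
  assumes "c \<in> Qp" "nrm c \<le> 1"
  shows "\<exists>z<p. nrm (c - of_nat z) \<le> \<omega>"
proof -
  obtain y where y: "y \<in> \<rat>" "nrm (c - y) < \<omega>"
    using Qp_rat_approx[OF assms(1) \<omega>_pos] by blast
  have y1: "nrm y \<le> 1"
    using nrm_diff_le[of c 1 "c - y"] assms(2) y(2) nrm_p by simp
  obtain m n where mn: "n > 0" "coprime m n" "y = of_int m / of_int n"
    using Rats_cases'[OF y(1)] .
  have n: "\<not> int p dvd n"
  proof
    assume *: "int p dvd n"
    then have "\<not> int p dvd m"
      using coprime_common_divisor[OF mn(2), of "int p"] prime_p by (auto simp: prime_nat_iff)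
    then have "nrm y = 1 / nrm (of_int n)"
      using nrm_of_int_eq_1 by (simp add: mn(3) nrm_divide)
    moreover have "nrm (of_int n) < 1" "0 < nrm (of_int n :: 'a)"
      using nrm_of_int_dvd[OF *] nrm_p mn(1) by auto
    ultimately show False using y1 by (simp add: field_simps)
  qed
  obtain u v where uv: "u * n + v * int p = 1" using bezout_p[OF n] .
  have "of_int u * of_int n + of_int v * of_nat p = (1::'a)"
    using uv by (metis of_int_1 of_int_add of_int_mult of_int_of_nat_eq)
  then have "of_int m * (of_int u * of_int n + of_int v * of_nat p) = (of_int m :: 'a)"
    by simp
  then have eq: "y - of_int (u * m) = of_int (v * m) / of_int n * of_nat p"
    using mn(1) by (simp add: mn(3) field_simps)
  have "nrm (of_int (v * m) / of_int n) \<le> 1"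
    using nrm_of_int_eq_1[OF n] nrm_of_int_le_1[of "v * m"] by (simp add: nrm_divide)
  then have "nrm (y - of_int (u * m)) \<le> \<omega>"
    unfolding eq by (rule nrm_mult_le) simp
  moreover obtain z where z: "z < p" "nrm (of_int (u * m) - of_nat z) \<le> \<omega>"
    using int_digit by blast
  ultimately have "nrm ((c - y) + (y - of_int (u * m)) + (of_int (u * m) - of_nat z)) \<le> \<omega>"
    using y(2) by (intro nrm_add_le) auto
  then show ?thesis using z(1) by auto
qed

text \<open>Linear independence over the prime field in O_F / p O_F, with digits below
  \<open>p\<close> as coefficients; norm at most \<open>\<omega>\<close> means divisibility by
  \<open>p\<close>.\<close>

definition digit_independent :: "(nat \<Rightarrow> 'a) \<Rightarrow> nat \<Rightarrow> bool" where
  "digit_independent e k \<longleftrightarrow> (\<forall>i<k. e i \<in> int_ring nrm F)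
    \<and> (\<forall>z. (\<forall>i<k. z i < p) \<and> nrm (\<Sum>i<k. of_nat (z i) * e i) \<le> \<omega> \<longrightarrow> (\<forall>i<k. z i = (0::nat)))"

text \<open>More than \<open>d\<close> elements satisfy a relation over \<open>Qp\<close>. After
  division by its largest coefficient \<open>c j\<close>, passing to digits gives a relation modulo
  \<open>p\<close> in which the digit of \<open>c j / c j = 1\<close> is not 0.\<close>

lemma digit_independent_le:
  assumes "digit_independent e k"
  shows "k \<le> d"
proof (rule ccontr)
  assume "\<not> k \<le> d"
  then have "\<exists>c. (\<forall>i\<in>{..<k}. c i \<in> Qp) \<and> (\<exists>i\<in>{..<k}. c i \<noteq> 0) \<and> (\<Sum>i<k. c i * e i) = 0"
    using assms by (intro family_dependent[OF subQp subF QpF b]) (auto simp: digit_independent_def int_ringD)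
  then obtain c where c: "\<And>i. i < k \<Longrightarrow> c i \<in> Qp" "\<exists>i<k. c i \<noteq> 0" "(\<Sum>i<k. c i * e i) = 0"
    by auto
  define M where "M = Max ((\<lambda>i. nrm (c i)) ` {..<k})"
  have "k \<noteq> 0" using c(2) by auto
  then have "M \<in> (\<lambda>i. nrm (c i)) ` {..<k}"
    unfolding M_def by (intro Max_in) auto
  then obtain j where j: "j < k" "nrm (c j) = M" by auto
  have le: "nrm (c i) \<le> nrm (c j)" if "i < k" for i
    using that unfolding j(2) M_def by (intro Max_ge) auto
  have cj: "c j \<noteq> 0"
    using c(2) le by (metis nrm_eq_0_iff nrm_nonneg order_antisym)
  have "\<forall>i\<in>{..<k}. \<exists>z<p. nrm (c i / c j - of_nat z) \<le> \<omega>"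
    using c(1) j(1) le cj subQp by (intro ballI Qp_digit subfield_divide) (auto simp: nrm_divide)
  from bchoice[OF this] obtain z where z: "\<And>i. i < k \<Longrightarrow> z i < p \<and> nrm (c i / c j - of_nat (z i)) \<le> \<omega>"
    by auto
  have "(\<Sum>i<k. c i / c j * e i) = 0"
    using c(3) by (simp add: sum_divide_distrib[symmetric])
  then have "(\<Sum>i<k. of_nat (z i) * e i) = - (\<Sum>i<k. e i * (c i / c j - of_nat (z i)))"
    by (simp add: algebra_simps sum_subtractf)
  moreover have "nrm (\<Sum>i<k. e i * (c i / c j - of_nat (z i))) \<le> \<omega>"
    using z assms by (intro nrm_sum_le nrm_mult_le) (auto simp: digit_independent_def int_ringD)
  ultimately have "z j = 0"
    using assms z j(1) by (auto simp: digit_independent_def)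
  then show False
    using z[OF j(1)] cj nrm_p by simp
qed

text \<open>The digits \<open>w\<close> of the differences form a relation modulo \<open>p\<close>,
  so they vanish; numbers below \<open>p\<close> that are congruent modulo \<open>p\<close> are
  equal.\<close>

lemma digits_distinct:
  assumes "digit_independent e k" "\<And>i. i < k \<Longrightarrow> z i < p" "\<And>i. i < k \<Longrightarrow> z' i < p"
    "nrm ((\<Sum>i<k. of_nat (z i) * e i) - (\<Sum>i<k. of_nat (z' i) * e i)) \<le> \<omega>" "i < k"
  shows "z i = z' i"
proof -
  have "\<forall>i. \<exists>w<p. int p dvd (int (z i) - int (z' i)) - int w
      \<and> nrm (of_int (int (z i) - int (z' i)) - of_nat w) \<le> \<omega>"
    by (intro allI int_digit)
  from choice[OF this] obtain w where w: "\<And>i. w i < p \<and> int p dvd (int (z i) - int (z' i)) - int (w i)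
      \<and> nrm (of_int (int (z i) - int (z' i)) - of_nat (w i)) \<le> \<omega>"
    by blast
  have e: "nrm (e i) \<le> 1" if "i < k" for i
    using assms(1) that by (auto simp: digit_independent_def int_ringD)
  have "(\<Sum>i<k. of_nat (w i) * e i) = ((\<Sum>i<k. of_nat (z i) * e i) - (\<Sum>i<k. of_nat (z' i) * e i))
      - (\<Sum>i<k. e i * (of_int (int (z i) - int (z' i)) - of_nat (w i)))"
    by (simp add: algebra_simps sum_subtractf sum.distrib)
  moreover have "nrm (\<Sum>i<k. e i * (of_int (int (z i) - int (z' i)) - of_nat (w i))) \<le> \<omega>"
    using w e by (intro nrm_sum_le nrm_mult_le) auto
  ultimately have "nrm (\<Sum>i<k. of_nat (w i) * e i) \<le> \<omega>"
    using nrm_diff_le[OF assms(4)] by (simp only:)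
  then have "w i = 0"
    using assms(1,5) w by (auto simp: digit_independent_def)
  then have "int p dvd int (z i) - int (z' i)"
    using w[of i] by simp
  then have "int (z i) mod int p = int (z' i) mod int p"
    by (simp add: mod_eq_dvd_iff)
  then show ?thesis
    using assms(2,3)[OF assms(5)] by simp
qed

text \<open>By maximality \<open>x\<close> and the \<open>e i\<close> are dependent modulo
  \<open>p\<close>. The digit of \<open>x\<close> in this relation is not 0, as the
  \<open>e i\<close> alone are independent, and it is inverted modulo \<open>p\<close> to solve for
  \<open>x\<close>.\<close>

lemma digits_span:
  assumes e: "digit_independent e k" and max: "\<And>e. \<not> digit_independent e (Suc k)"
    and x: "x \<in> int_ring nrm F"
  shows "\<exists>z. (\<forall>i<k. z i < p) \<and> nrm (x - (\<Sum>i<k. of_nat (z i) * e i)) \<le> \<omega>"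
proof -
  have eF: "e i \<in> int_ring nrm F" if "i < k" for i
    using e that by (auto simp: digit_independent_def)
  define f where "f = e(k := x)"
  have sum_f: "(\<Sum>i<Suc k. of_nat (z i) * f i) = (\<Sum>i<k. of_nat (z i) * e i) + of_nat (z k) * x" for z :: "nat \<Rightarrow> nat"
    by (simp add: f_def)
  have "\<forall>i<Suc k. f i \<in> int_ring nrm F"
    using eF x by (auto simp: f_def less_Suc_eq)
  then obtain z where z: "\<And>i. i < Suc k \<Longrightarrow> z i < p"
    "nrm ((\<Sum>i<k. of_nat (z i) * e i) + of_nat (z k) * x) \<le> \<omega>" "\<exists>i<Suc k. z i \<noteq> (0::nat)"
    using max[of f] unfolding digit_independent_def sum_f by blast
  have "z k \<noteq> 0"
  proof
    assume 0: "z k = 0"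
    then have "\<forall>i<k. z i = 0"
      using e z(1,2) by (auto simp: digit_independent_def)
    then show False using z(3) 0 by (auto simp: less_Suc_eq)
  qed
  then have "\<not> int p dvd int (z k)"
    using z(1)[of k] by (auto dest: dvd_imp_le)
  then obtain u v where uv: "u * int (z k) + v * int p = 1" using bezout_p by blast
  have uv': "of_int u * of_nat (z k) + of_int v * of_nat p = (1::'a)"
    using uv by (metis of_int_1 of_int_add of_int_mult of_int_of_nat_eq)
  have "\<forall>i. \<exists>w<p. nrm (of_int (- u * int (z i)) - of_nat w) \<le> \<omega>"
    using int_digit by blast
  from choice[OF this] obtain w where w: "\<And>i. w i < p \<and> nrm (of_int (- u * int (z i)) - of_nat (w i)) \<le> \<omega>"
    by blast
  have "x = x * (of_int u * of_nat (z k) + of_int v * of_nat p)"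
    by (simp add: uv')
  then have "x - (\<Sum>i<k. of_nat (w i) * e i) =
      of_int u * ((\<Sum>i<k. of_nat (z i) * e i) + of_nat (z k) * x) + (of_int v * x) * of_nat p
      + (\<Sum>i<k. e i * (of_int (- u * int (z i)) - of_nat (w i)))"
    by (simp add: algebra_simps sum_subtractf sum.distrib sum_distrib_left sum_negf)
  moreover have "nrm (of_int u * ((\<Sum>i<k. of_nat (z i) * e i) + of_nat (z k) * x)
      + (of_int v * x) * of_nat p + (\<Sum>i<k. e i * (of_int (- u * int (z i)) - of_nat (w i)))) \<le> \<omega>"
    using z(2) w int_ringD(1)[OF eF] int_ringD(1)[OF x]
    by (intro nrm_add_le[where x = "_ * _ + _ * _"] nrm_add_le[where x = "of_int u * _"]
        nrm_mult_le nrm_sum_le nrm_mult_le_1 nrm_of_int_le_1) auto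
  ultimately have "nrm (x - (\<Sum>i<k. of_nat (w i) * e i)) \<le> \<omega>"
    by (simp only:)
  then show ?thesis using w by blast
qed

text \<open>Iterating \<open>digits_span\<close>, each time writing the element as a digit
  combination plus \<open>p\<close> times a new integral element, gives for every \<open>e i\<close>
  a digit series that converges in the complete field \<open>Qp\<close>.\<close>

lemma digits_span_all:
  assumes e: "digit_independent e k" and max: "\<And>e. \<not> digit_independent e (Suc k)"
    and x: "x \<in> int_ring nrm F"
  shows "\<exists>c. (\<forall>i<k. c i \<in> Qp) \<and> x = (\<Sum>i<k. c i * e i)"
proof -
  have eF: "e i \<in> int_ring nrm F" if "i < k" for i
    using e that by (auto simp: digit_independent_def)
  obtain Z where Z: "\<And>x. x \<in> int_ring nrm F \<Longrightarrow>
      (\<forall>i<k. Z x i < p) \<and> nrm (x - (\<Sum>i<k. of_nat (Z x i) * e i)) \<le> \<omega>"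
    using digits_span[OF e max] by metis
  \<comment> \<open>The integral element that remains after one digit combination is subtracted and
    the rest is divided by \<open>p\<close>.\<close>
  define step where "step = (\<lambda>x. (x - (\<Sum>i<k. of_nat (Z x i) * e i)) / of_nat p)"
  define X where "X = (\<lambda>n. (step ^^ n) x)"
  have X: "X n \<in> int_ring nrm F" for n
  proof (induction n)
    case (Suc n)
    have "nrm (step (X n)) \<le> 1"
      using Z[OF Suc] \<omega>_pos by (simp add: step_def nrm_divide)
    moreover have "step (X n) \<in> F"
      using Suc eF subF unfolding step_def
      by (intro subfield_divide subfield_diff subfield_sum subfield_mult subfield_of_nat) (auto simp: int_ringD)
    ultimately show ?case by (simp add: X_def int_ring_def)
  qed (use x in \<open>simp add: X_def\<close>)
  define a where "a = (\<lambda>i n. of_nat p ^ n * of_nat (Z (X n) i) :: 'a)"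
  have expand: "x = (\<Sum>i<k. (\<Sum>n<N. a i n) * e i) + of_nat p ^ N * X N" for N
  proof (induction N)
    case (Suc N)
    have "X N = (\<Sum>i<k. of_nat (Z (X N) i) * e i) + of_nat p * X (Suc N)"
      using p_pos by (simp add: X_def step_def)
    then have "of_nat p ^ N * X N
        = of_nat p ^ N * ((\<Sum>i<k. of_nat (Z (X N) i) * e i) + of_nat p * X (Suc N))"
      by simp
    then have "of_nat p ^ N * X N = (\<Sum>i<k. a i N * e i) + of_nat p ^ Suc N * X (Suc N)"
      by (simp add: a_def sum_distrib_left distrib_left mult_ac)
    then show ?case
      using Suc by (simp add: distrib_right sum.distrib)
  qed (simp add: X_def)
  have "\<exists>s\<in>Qp. \<forall>N. nrm ((\<Sum>n<N. a i n) - s) \<le> \<omega> ^ N" for i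
  proof (rule series_converges[OF subQp])
    show "Metric_space.mcomplete Qp (\<lambda>x y. nrm (x - y))"
      using Qp unfolding is_completion_of_Rats_def by blast
    show "a i n \<in> Qp" for n
      using subQp by (auto simp: a_def intro!: subfield_mult subfield_power subfield_of_nat)
    show "nrm (a i n) \<le> \<omega> ^ n" for n
      using nrm_mult_le[OF nrm_of_nat_le_1[of "Z (X n) i"], of "of_nat p ^ n" "\<omega> ^ n"]
      by (simp add: a_def nrm_power mult.commute)
  qed (use nrm_p \<omega>_pos in auto)
  then obtain s where s: "\<And>i. s i \<in> Qp" "\<And>i N. nrm ((\<Sum>n<N. a i n) - s i) \<le> \<omega> ^ N"
    by metis
  \<comment> \<open>The truncated coefficients and the remainder each contribute at most
    \<open>\<omega> ^ N\<close>; as \<open>N\<close> is arbitrary, the difference is 0.\<close>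
  have "nrm (x - (\<Sum>i<k. s i * e i)) \<le> \<omega> ^ N" for N
  proof -
    have "x - (\<Sum>i<k. s i * e i) = (\<Sum>i<k. e i * ((\<Sum>n<N. a i n) - s i)) + X N * of_nat p ^ N"
      by (subst expand[of N]) (simp add: algebra_simps sum_subtractf)
    also have "nrm \<dots> \<le> \<omega> ^ N"
      using s(2) int_ringD(1)[OF eF] int_ringD(1)[OF X]
      by (intro nrm_add_le nrm_sum_le nrm_mult_le) (auto simp: nrm_power)
    finally show ?thesis .
  qed
  moreover have "\<exists>N. \<omega> ^ N < nrm (x - (\<Sum>i<k. s i * e i))" if "x \<noteq> (\<Sum>i<k. s i * e i)"
    using that nrm_p by (intro real_arch_pow_inv) auto
  ultimately have "x = (\<Sum>i<k. s i * e i)"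
    using not_less by blast
  then show ?thesis using s(1) by (intro exI[of _ s] conjI allI impI)
qed

text \<open>A maximal independent family has at most \<open>d\<close> members by
  \<open>digit_independent_le\<close>, and at least \<open>d\<close> because, after scaling by
  powers of \<open>p\<close>, it spans \<open>F\<close> over \<open>Qp\<close>. Its p^d digit
  combinations represent O_F modulo p O_F.\<close>

lemma reps_mod_p:
  "\<exists>T. finite T \<and> card T = p ^ d \<and> T \<subseteq> int_ring nrm F \<and> (\<forall>x\<in>int_ring nrm F. \<exists>!t. t \<in> T \<and> nrm (x - t) \<le> \<omega>)"
proof -
  have "\<exists>k. (\<exists>e. digit_independent e k) \<and> (\<forall>m. (\<exists>e. digit_independent e m) \<longrightarrow> m \<le> k)"
    by (rule Nat.ex_has_greatest_nat[of _ 0 d]) (auto simp: digit_independent_def digit_independent_le)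
  then obtain k e where e: "digit_independent e k" and max: "\<And>e. \<not> digit_independent e (Suc k)"
    by (metis Suc_n_not_le_n)
  have eF: "e i \<in> int_ring nrm F" if "i < k" for i
    using e that by (auto simp: digit_independent_def)
  have "d \<le> k"
  proof (rule spanning_size_ge[OF subQp subF QpF b])
    fix y assume y: "y \<in> F"
    show "\<exists>c. (\<forall>i<k. c i \<in> Qp) \<and> y = (\<Sum>i<k. c i * e i)"
    proof (cases "y = 0")
      case True
      then show ?thesis using subQp by (intro exI[of _ "\<lambda>_. 0"]) (auto intro: subfield_0)
    next
      case False
      then obtain N where N: "\<omega> ^ N < 1 / nrm y"
        using real_arch_pow_inv[of "1 / nrm y" \<omega>] nrm_p by auto
      then have "nrm (of_nat p ^ N * y) \<le> 1"
        using False by (simp add: nrm_mult nrm_power field_simps)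
      then have "of_nat p ^ N * y \<in> int_ring nrm F"
        using y subF by (auto simp: int_ring_def intro!: subfield_mult subfield_power subfield_of_nat)
      then obtain c where c: "\<forall>i<k. c i \<in> Qp" "of_nat p ^ N * y = (\<Sum>i<k. c i * e i)"
        using digits_span_all[OF e max] by blast
      have "y = (\<Sum>i<k. c i / of_nat p ^ N * e i)"
        using c(2) p_pos by (simp add: sum_divide_distrib[symmetric] field_simps)
      then show ?thesis
        using c(1) subQp
        by (intro exI[of _ "\<lambda>i. c i / of_nat p ^ N"]) (auto intro!: subfield_divide subfield_power subfield_of_nat)
    qed
  qed
  with digit_independent_le[OF e] have k: "k = d" by simp
  define g where "g = (\<lambda>z. \<Sum>i<k. of_nat (z i) * e i)"
  define T where "T = g ` ({..<k} \<rightarrow>\<^sub>E {..<p})"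
  have dist: "z = z'" if "z \<in> {..<k} \<rightarrow>\<^sub>E {..<p}" "z' \<in> {..<k} \<rightarrow>\<^sub>E {..<p}" "nrm (g z - g z') \<le> \<omega>" for z z'
  proof (rule PiE_ext[OF that(1,2)])
    fix i assume "i \<in> {..<k}"
    then show "z i = z' i"
      using that by (intro digits_distinct[OF e]) (auto simp: g_def PiE_iff)
  qed
  have "inj_on g ({..<k} \<rightarrow>\<^sub>E {..<p})"
    using dist \<omega>_pos by (intro inj_onI) auto
  then have "card T = p ^ d"
    by (simp add: T_def card_image card_PiE k)
  moreover have "T \<subseteq> int_ring nrm F"
  proof -
    have "of_nat m \<in> int_ring nrm F" for m
      using subF by (simp add: int_ring_def nrm_of_nat_le_1 subfield_of_nat)
    then show ?thesis
      using eF subF by (auto simp: T_def g_def intro!: int_ring_sum int_ring_mult)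
  qed
  moreover have "\<exists>!t. t \<in> T \<and> nrm (x - t) \<le> \<omega>" if x: "x \<in> int_ring nrm F" for x
  proof (rule ex_ex1I)
    obtain z where z: "\<forall>i<k. z i < p" "nrm (x - g z) \<le> \<omega>"
      using digits_span[OF e max x] by (auto simp: g_def)
    have "g z = g (restrict z {..<k})" by (auto simp: g_def intro!: sum.cong)
    then have "g z \<in> T" using z(1) by (auto simp: T_def)
    then show "\<exists>t. t \<in> T \<and> nrm (x - t) \<le> \<omega>" using z by blast
    fix s t assume st: "s \<in> T \<and> nrm (x - s) \<le> \<omega>" "t \<in> T \<and> nrm (x - t) \<le> \<omega>"
    then have "nrm ((x - t) - (x - s)) \<le> \<omega>" using nrm_diff_le by blast
    then show "s = t" using st dist by (auto simp: T_def)
  qed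
  ultimately show ?thesis
    by (intro exI[of _ T]) (auto simp: T_def intro: finite_PiE)
qed

text \<open>Discreteness comes from the finiteness of O_F modulo \<open>p\<close>: an element with
  norm strictly between \<open>\<omega>\<close> and 1 has the norm of its representative, so the
  norms below 1 have a maximum.\<close>

lemma uniformizer_ex:
  "\<exists>\<pi>\<in>F. \<pi> \<noteq> 0 \<and> nrm \<pi> < 1 \<and> (\<forall>x\<in>F. nrm x < 1 \<longrightarrow> nrm x \<le> nrm \<pi>) \<and> (\<exists>m>0. nrm \<pi> ^ m = \<omega>)"
proof -
  obtain T where T: "finite T" "T \<subseteq> int_ring nrm F" "\<And>x. x \<in> int_ring nrm F \<Longrightarrow> \<exists>t\<in>T. nrm (x - t) \<le> \<omega>"
    using reps_mod_p by metis
  \<comment> \<open>\<open>\<omega>\<close> is included for the case that \<open>p\<close> itself is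
    a uniformizer.\<close>
  define V where "V = insert \<omega> {v \<in> nrm ` T. \<omega> < v \<and> v < 1}"
  have V: "finite V" using T(1) by (simp add: V_def)
  have "Max V \<in> V" by (rule Max_in) (use V in \<open>auto simp: V_def\<close>)
  moreover have "of_nat p \<in> F" using subF by (rule subfield_of_nat)
  ultimately have "\<exists>\<pi>\<in>F. nrm \<pi> = Max V" "\<omega> \<le> Max V" "Max V < 1"
    using T(2) nrm_p by (auto simp: V_def int_ring_def)
  then obtain \<pi> where \<pi>: "\<pi> \<in> F" "nrm \<pi> = Max V" "\<omega> \<le> nrm \<pi>" "nrm \<pi> < 1" by auto
  have le: "nrm x \<le> nrm \<pi>" if "x \<in> F" "nrm x < 1" for x
  proof (cases "nrm x \<le> \<omega>")
    case False
    have "x \<in> int_ring nrm F" using that by (simp add: int_ring_def)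
    then obtain t where t: "t \<in> T" "nrm (x - t) \<le> \<omega>"
      using T(3) by blast
    then have "nrm t = nrm x"
      using False by (intro nrm_eq_if_diff_less) auto
    then have "nrm x \<in> V"
      using False that t by (auto simp: V_def image_iff intro!: bexI[of _ t])
    then show ?thesis using Max_ge[OF V] \<pi> by simp
  qed (use \<pi> in auto)
  have \<pi>0: "\<pi> \<noteq> 0"
    using \<pi>(3) \<omega>_pos nrm_pos_iff[of \<pi>] by linarith
  obtain m where "nrm (of_nat p) = nrm \<pi> ^ m"
    using nrm_eq_uniformizer_power[OF subF \<pi>(1) \<pi>0 \<pi>(4) le, of "of_nat p"] nrm_p p_pos subF
    by (auto intro: subfield_of_nat)
  then have "nrm \<pi> ^ m = \<omega>" by simp
  moreover from this have "0 < m" using nrm_p by (cases m) auto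
  ultimately show ?thesis
    using \<pi> \<pi>0 le by blast
qed

end

section \<open>Haar measure and integrals\<close>

lemma ennreal_of_nat_mult_eqD:
  assumes "of_nat N * x = ennreal y" "0 < N" "0 \<le> y"
  shows "x = ennreal (y / real N)"
proof (cases x)
  case (real v)
  then have "ennreal (real N * v) = ennreal y"
    using assms(1) by (simp add: ennreal_mult ennreal_of_nat_eq_real_of_nat)
  then have "real N * v = y"
    using real assms by (simp add: ennreal_inj)
  then have "v = y / real N"
    using assms(2) by (simp add: field_simps)
  then show ?thesis
    using real by simp
next
  case top
  then show ?thesis
    using assms by (simp add: ennreal_mult_eq_top_iff ennreal_mult_top)
qed

locale haar = nonarch nrm for nrm :: "'a::field \<Rightarrow> real" +
  fixes K :: "'a set" and \<mu> :: "'a measure"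
  assumes subK: "is_subfield K" and haar: "is_haar nrm K \<mu>"
begin

lemma space_\<mu>: "space \<mu> = K"
  using haar by (simp add: is_haar_def)

lemma uniformly_open_sets:
  assumes "U \<subseteq> K" "0 < c" "\<And>x y. x \<in> U \<Longrightarrow> y \<in> K \<Longrightarrow> nrm (x - y) < c \<Longrightarrow> y \<in> U"
  shows "U \<in> sets \<mu>"
proof -
  interpret Metric_space K "\<lambda>x y. nrm (x - y)"
    by (rule Metric_space_nrm)
  have "openin (nrm_topology nrm K) U"
    unfolding nrm_topology_def openin_mtopology
  proof (intro conjI allI impI exI[of _ c] subsetI)
    fix x y assume "x \<in> U" "y \<in> mball x c"
    then show "y \<in> U" using assms(3) by (auto simp: in_mball)
  qed (use assms in auto)
  then show ?thesis
    using haar by (auto simp: is_haar_def intro: sigma_sets.Basic)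
qed

lemma cball_sets: "0 < c \<Longrightarrow> {y \<in> K. nrm y \<le> c} \<in> sets \<mu>"
proof (rule uniformly_open_sets[of _ c])
  fix x y assume "x \<in> {y \<in> K. nrm y \<le> c}" "y \<in> K" "nrm (x - y) < c"
  then show "y \<in> {y \<in> K. nrm y \<le> c}"
    using nrm_diff_le[of x c "x - y"] by simp
qed auto

lemma ball_sets: "0 < c \<Longrightarrow> {y \<in> K. nrm (y - a) < c} \<in> sets \<mu>"
proof (rule uniformly_open_sets[of _ c])
  fix x y assume "x \<in> {y \<in> K. nrm (y - a) < c}" "y \<in> K" "nrm (x - y) < c"
  then show "y \<in> {y \<in> K. nrm (y - a) < c}"
    using nrm_diff_less[of "x - a" c "x - y"] by simp
qed auto

lemma emeasure_translate: "a \<in> K \<Longrightarrow> A \<in> sets \<mu> \<Longrightarrow> emeasure \<mu> ((+) a ` A) = emeasure \<mu> A"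
  using haar by (simp add: is_haar_def)

lemma emeasure_int_ring: "emeasure \<mu> {y \<in> K. nrm y \<le> 1} = 1"
  using haar by (simp add: is_haar_def int_ring_def)

lemma translate_eq:
  assumes "a \<in> K"
  shows "(+) a ` {y \<in> K. P y} = {y \<in> K. P (y - a)}"
proof (rule subset_antisym; rule subsetI)
  fix y assume "y \<in> {y \<in> K. P (y - a)}"
  then show "y \<in> (+) a ` {y \<in> K. P y}"
    using assms subK by (intro image_eqI[of _ _ "y - a"]) (auto intro: subfield_diff)
qed (use assms subK in \<open>auto intro: subfield_add\<close>)

text \<open>Translation invariance for a finite disjoint union of translates. Stated with a
  predicate, it serves for open and closed balls alike.\<close>

lemma emeasure_partition:
  assumes "finite S" "S \<subseteq> K" "{y \<in> K. P y} \<in> sets \<mu>"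
    "\<And>s y. s \<in> S \<Longrightarrow> {y \<in> K. P (y - s)} \<in> sets \<mu>"
    "\<And>y. y \<in> A \<Longrightarrow> \<exists>!s. s \<in> S \<and> P (y - s)" "A \<subseteq> K"
    "\<And>s y. s \<in> S \<Longrightarrow> y \<in> K \<Longrightarrow> P (y - s) \<Longrightarrow> y \<in> A"
  shows "emeasure \<mu> A = of_nat (card S) * emeasure \<mu> {y \<in> K. P y}"
proof -
  have A: "A = (\<Union>s\<in>S. {y \<in> K. P (y - s)})"
  proof (rule subset_antisym; rule subsetI)
    fix y assume "y \<in> A"
    then show "y \<in> (\<Union>s\<in>S. {y \<in> K. P (y - s)})"
      using assms(5)[of y] assms(6) by auto
  qed (use assms(7) in auto)
  have "disjoint_family_on (\<lambda>s. {y \<in> K. P (y - s)}) S"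
    unfolding disjoint_family_on_def
  proof (intro ballI impI equals0I)
    fix s t y assume st: "s \<in> S" "t \<in> S" "s \<noteq> t" "y \<in> {y \<in> K. P (y - s)} \<inter> {y \<in> K. P (y - t)}"
    then have "\<exists>!s. s \<in> S \<and> P (y - s)" using assms(5,7) by auto
    then show False using st by auto
  qed
  then have "emeasure \<mu> A = (\<Sum>s\<in>S. emeasure \<mu> {y \<in> K. P (y - s)})"
    unfolding A using assms(1,4) by (intro sum_emeasure[symmetric]) auto
  also have "\<dots> = (\<Sum>s\<in>S. emeasure \<mu> {y \<in> K. P y})"
    using assms(2,3) emeasure_translate[of _ "{y \<in> K. P y}"] translate_eq by (intro sum.cong) auto
  finally show ?thesis by simp
qed

text \<open>For the radius |p| this gives the measure of p O_F as the reciprocal of its index, one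
  of the two values whose comparison determines the norm of \<open>\<pi>\<close>.\<close>

lemma emeasure_cball_reps:
  assumes "finite T" "T \<subseteq> int_ring nrm K" "\<forall>x\<in>int_ring nrm K. \<exists>!t. t \<in> T \<and> nrm (x - t) \<le> c"
    "0 < c" "c \<le> 1"
  shows "1 = of_nat (card T) * emeasure \<mu> {y \<in> K. nrm y \<le> c}"
proof -
  have "emeasure \<mu> {y \<in> K. nrm y \<le> 1} = of_nat (card T) * emeasure \<mu> {y \<in> K. nrm y \<le> c}"
  proof (rule emeasure_partition)
    show "{y \<in> K. nrm (y - s) \<le> c} \<in> sets \<mu>" for s
    proof (rule uniformly_open_sets[of _ c])
      fix x y assume "x \<in> {y \<in> K. nrm (y - s) \<le> c}" "y \<in> K" "nrm (x - y) < c"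
      then show "y \<in> {y \<in> K. nrm (y - s) \<le> c}"
        using nrm_diff_le[of "x - s" c "x - y"] by simp
    qed (use assms in auto)
    show "y \<in> {y \<in> K. nrm y \<le> 1}" if "s \<in> T" "y \<in> K" "nrm (y - s) \<le> c" for s y
    proof -
      have "nrm s \<le> 1" using that(1) assms(2) by (auto simp: int_ring_def)
      then show ?thesis
        using nrm_add_le[of "y - s" 1 s] that assms(5) by simp
    qed
    show "\<exists>!s. s \<in> T \<and> nrm (y - s) \<le> c" if "y \<in> {y \<in> K. nrm y \<le> 1}" for y
      using that assms(3) by (simp add: int_ring_def)
  qed (use assms cball_sets in \<open>auto simp: int_ring_def\<close>)
  then show ?thesis by (simp add: emeasure_int_ring)
qed

end

text \<open>Used for \<open>F\<close> and for \<open>K\<close> with the same \<open>\<pi>\<close>,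
  as \<open>K\<close> is unramified. The norm of \<open>\<pi>\<close> is left open, because it will
  be determined by means of the measure.\<close>

locale local_haar = haar nrm K \<mu> for nrm :: "'a::field \<Rightarrow> real" and K \<mu> +
  fixes R :: "'a set" and \<pi> :: 'a
  assumes R: "is_reps nrm K R" and \<pi>: "\<pi> \<in> K" "\<pi> \<noteq> 0" "nrm \<pi> < 1"
    and le_\<pi>: "\<And>x. x \<in> K \<Longrightarrow> nrm x < 1 \<Longrightarrow> nrm x \<le> nrm \<pi>"
begin

lemma card_R_pos: "0 < card R"
  using card_reps_ge_2[OF subK R] by simp

text \<open>Scaled by \<open>c\<close>, the residue representatives represent the closed ball modulo
  the open ball of the same radius.\<close>

lemma emeasure_cball_step:
  assumes "c \<in> K" "c \<noteq> 0"
  shows "emeasure \<mu> {y \<in> K. nrm y \<le> nrm c} = of_nat (card R) * emeasure \<mu> {y \<in> K. nrm y < nrm c}"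
proof -
  have inj: "inj_on ((*) c) R" using assms(2) by (auto intro: inj_onI)
  have "emeasure \<mu> {y \<in> K. nrm y \<le> nrm c} = of_nat (card ((*) c ` R)) * emeasure \<mu> {y \<in> K. nrm y < nrm c}"
  proof (rule emeasure_partition)
    show "(*) c ` R \<subseteq> K"
      using reps_int_ring[OF R] assms(1) subK by (auto simp: int_ring_def intro: subfield_mult)
    show "{y \<in> K. nrm y < nrm c} \<in> sets \<mu>" "{y \<in> K. nrm (y - s) < nrm c} \<in> sets \<mu>" for s
      using ball_sets[of "nrm c" 0] ball_sets[of "nrm c" s] assms(2) by auto
    fix y assume "y \<in> {y \<in> K. nrm y \<le> nrm c}"
    then have "y / c \<in> int_ring nrm K"
      using assms subK by (auto simp: int_ring_def nrm_divide intro: subfield_divide)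
    then have "\<exists>!t. t \<in> R \<and> nrm (y / c - t) < 1"
      using R by (simp add: is_reps_def)
    moreover have "nrm (y / c - t) < 1 \<longleftrightarrow> nrm (y - c * t) < nrm c" for t
    proof -
      have "y - c * t = c * (y / c - t)" using assms(2) by (simp add: algebra_simps)
      then show ?thesis using assms(2) by (simp add: nrm_mult)
    qed
    ultimately show "\<exists>!s. s \<in> (*) c ` R \<and> nrm (y - s) < nrm c"
      by auto
  next
    fix s y assume s: "s \<in> (*) c ` R" and y: "y \<in> K" "nrm (y - s) < nrm c"
    have "nrm s \<le> nrm c"
      using s int_ringD(1)[OF reps_int_ring[OF R]] by (auto simp: nrm_mult mult_left_le)
    then show "y \<in> {y \<in> K. nrm y \<le> nrm c}"
      using nrm_add_le[of "y - s" "nrm c" s] y by simp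
  qed (use reps_finite[OF R] in auto)
  then show ?thesis by (simp add: card_image[OF inj])
qed

text \<open>No element of \<open>K\<close> has a norm strictly between those of
  \<open>c * \<pi>\<close> and \<open>c\<close>.\<close>

lemma ball_eq_cball:
  assumes "c \<in> K" "c \<noteq> 0"
  shows "{y \<in> K. nrm y < nrm c} = {y \<in> K. nrm y \<le> nrm (c * \<pi>)}"
proof (intro Collect_cong conj_cong refl iffI)
  fix y assume "y \<in> K" "nrm y < nrm c"
  then have "nrm (y / c) \<le> nrm \<pi>"
    using assms subK by (intro le_\<pi>) (auto simp: nrm_divide intro: subfield_divide)
  then show "nrm y \<le> nrm (c * \<pi>)"
    using assms by (simp add: nrm_divide nrm_mult field_simps)
next
  fix y assume "nrm y \<le> nrm (c * \<pi>)"
  moreover have "nrm c * nrm \<pi> < nrm c * 1"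
    using assms \<pi> by (intro mult_strict_left_mono) auto
  ultimately show "nrm y < nrm c"
    by (simp add: nrm_mult)
qed

text \<open>The measure depends on the number of residues and on the exponent, not on the value of
  \<open>nrm \<pi>\<close>.\<close>

lemma emeasure_cball_power: "emeasure \<mu> {y \<in> K. nrm y \<le> nrm \<pi> ^ k} = ennreal (1 / real (card R) ^ k)"
proof (induction k)
  case 0
  then show ?case by (simp add: emeasure_int_ring)
next
  case (Suc k)
  have "\<pi> ^ k \<in> K" "\<pi> ^ k \<noteq> 0" using \<pi> subK by (auto intro: subfield_power)
  then have "of_nat (card R) * emeasure \<mu> {y \<in> K. nrm y \<le> nrm \<pi> ^ Suc k} = ennreal (1 / real (card R) ^ k)"
    using emeasure_cball_step[of "\<pi> ^ k"] ball_eq_cball[of "\<pi> ^ k"] Suc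
    by (simp add: nrm_power nrm_mult mult.commute)
  from ennreal_of_nat_mult_eqD[OF this card_R_pos] show ?case by (simp add: field_simps)
qed

lemma emeasure_cball_neg_power: "emeasure \<mu> {y \<in> K. nrm y \<le> (1 / nrm \<pi>) ^ k} = ennreal (real (card R) ^ k)"
proof (induction k)
  case 0
  then show ?case by (simp add: emeasure_int_ring)
next
  case (Suc k)
  define c where "c = inverse \<pi> ^ Suc k"
  have c: "c \<in> K" "c \<noteq> 0" using \<pi> subK by (auto simp: c_def intro!: subfield_mult subfield_power subfield_inverse)
  have "nrm c = (1 / nrm \<pi>) ^ Suc k"
    by (simp add: c_def nrm_power nrm_mult nrm_inverse nrm_divide inverse_eq_divide)
  moreover have "nrm (c * \<pi>) = (1 / nrm \<pi>) ^ k"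
    using \<pi>(2) by (simp add: c_def nrm_power nrm_mult nrm_inverse nrm_divide inverse_eq_divide)
  ultimately have "emeasure \<mu> {y \<in> K. nrm y \<le> (1 / nrm \<pi>) ^ Suc k}
      = of_nat (card R) * emeasure \<mu> {y \<in> K. nrm y \<le> (1 / nrm \<pi>) ^ k}"
    using emeasure_cball_step[OF c] ball_eq_cball[OF c] by simp
  then show ?case
    by (simp add: Suc ennreal_mult ennreal_of_nat_eq_real_of_nat)
qed

lemma emeasure_residue_class:
  assumes "t \<in> K"
  shows "emeasure \<mu> {y \<in> K. nrm (y - t) < 1} = ennreal (1 / real (card R))"
proof -
  have "emeasure \<mu> {y \<in> K. nrm (y - t) < 1} = emeasure \<mu> {y \<in> K. nrm y < 1}"
    using emeasure_translate[OF assms, of "{y \<in> K. nrm y < 1}"] ball_sets[of 1 0]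
    by (simp add: translate_eq[OF assms])
  also have "\<dots> = emeasure \<mu> {y \<in> K. nrm y \<le> nrm \<pi> ^ 1}"
    using ball_eq_cball[of 1] subfield_1[OF subK] by simp
  finally show ?thesis
    using emeasure_cball_power[of 1] by simp
qed

lemma nrm_in_powers: "y \<in> K \<Longrightarrow> y \<noteq> 0 \<Longrightarrow> nrm y \<le> 1 \<Longrightarrow> \<exists>m. nrm y = nrm \<pi> ^ m"
  using nrm_eq_uniformizer_power[OF subK \<pi> le_\<pi>] .

text \<open>An element of norm q^(k+1) lies in the ball \<open>C k\<close> of measure q^(r(k+1)) and
  needs the weight \<open>w k\<close>, that is q^(-2r(k+1)); the terms of the integrated series are
  q^(-r(k+1)). Balls in place of shells only enlarge the majorant. It is measurable, so its integral
  can later be added to another one.\<close>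

lemma integral_outside_bound:
  assumes "nrm \<pi> = 1 / real q" "card R = q ^ r" "2 \<le> q" "0 < r"
  shows "\<exists>h\<in>borel_measurable \<mu>. (\<forall>x\<in>K. 1 < nrm x \<longrightarrow> ennreal (1 / nrm x ^ (2 * r)) \<le> h x)
    \<and> (\<integral>\<^sup>+ x. h x \<partial>\<mu>) \<le> ennreal (2 / real q ^ r)"
proof -
  define C where "C = (\<lambda>k. {y \<in> K. nrm y \<le> (1 / nrm \<pi>) ^ Suc k})"
  define w where "w = (\<lambda>k. (1 / real q ^ (2 * r)) ^ Suc k)"
  define a where "a = 1 / real q ^ r"
  have "2 \<le> real q ^ r"
  proof -
    have "real q ^ 1 \<le> real q ^ r" using assms(3,4) by (intro power_increasing) auto
    moreover have "2 \<le> real q ^ 1" using assms(3) by simp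
    ultimately show ?thesis by linarith
  qed
  then have a: "0 < a" "a \<le> 1 / 2"
    using assms(3) by (simp_all add: a_def divide_le_eq)
  have C: "C k \<in> sets \<mu>" for k
    unfolding C_def using \<pi> by (intro cball_sets) simp
  have bound: "ennreal (1 / nrm x ^ (2 * r)) \<le> (\<Sum>k. ennreal (w k) * indicator (C k) x)"
    if "x \<in> K" and True: "1 < nrm x" for x
  proof -
    have "x \<noteq> 0" using True by auto
    moreover have "nrm (inverse x) \<le> 1"
      using True by (simp add: nrm_inverse inverse_le_1_iff)
    moreover have "inverse x \<in> K"
      using that subK by (intro subfield_inverse)
    ultimately obtain m where m: "nrm (inverse x) = nrm \<pi> ^ m"
      using nrm_in_powers[of "inverse x"] by auto
    then have "inverse (nrm x) = inverse (real q ^ m)"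
      unfolding nrm_inverse assms(1) by (simp add: power_one_over inverse_eq_divide)
    then have x: "nrm x = real q ^ m"
      by (rule inverse_eq_imp_eq)
    then obtain k where k: "m = Suc k" using True by (cases m) auto
    have "1 / nrm x ^ (2 * r) = w k"
      unfolding x w_def k power_one_over by (simp only: power_mult[symmetric] mult.commute)
    moreover have "x \<in> C k"
      using that by (simp add: C_def x k assms(1))
    ultimately have "ennreal (1 / nrm x ^ (2 * r)) = (\<Sum>j\<in>{k}. ennreal (w j) * indicator (C j) x)"
      by (subst sum.insert) auto
    also have "\<dots> \<le> (\<Sum>k. ennreal (w k) * indicator (C k) x)"
      by (rule sum_le_suminf) auto
    finally show ?thesis .
  qed
  have "(\<integral>\<^sup>+ x. (\<Sum>k. ennreal (w k) * indicator (C k) x) \<partial>\<mu>) = (\<Sum>k. ennreal (w k) * emeasure \<mu> (C k))"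
    using C by (subst nn_integral_suminf) (auto simp: nn_integral_cmult_indicator)
  also have "\<dots> = (\<Sum>k. ennreal (a ^ Suc k))"
  proof (intro suminf_cong)
    fix k
    have "1 / real q ^ (2 * r) * real q ^ r = a"
      using assms(3) by (simp add: a_def mult_2 power_add)
    then have "w k * real (card R) ^ Suc k = a ^ Suc k"
      unfolding w_def power_mult_distrib[symmetric] assms(2) by simp
    then show "ennreal (w k) * emeasure \<mu> (C k) = ennreal (a ^ Suc k)"
      unfolding C_def emeasure_cball_neg_power by (simp add: ennreal_mult[symmetric] w_def)
  qed
  also have "\<dots> = ennreal (a / (1 - a))"
  proof (rule suminf_ennreal_eq)
    show "(\<lambda>k. a ^ Suc k) sums (a / (1 - a))"
      using sums_mult[OF geometric_sums[of a], of a] a by simp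
  qed (use a in auto)
  \<comment> \<open>\<open>a \<le> 1 / 2\<close> is the estimate q^r \<ge> 2; this is the origin of
    the constant 2.\<close>
  also have "a / (1 - a) \<le> 2 * a"
    using a by (simp add: field_simps)
  finally have "(\<integral>\<^sup>+ x. (\<Sum>k. ennreal (w k) * indicator (C k) x) \<partial>\<mu>) \<le> ennreal (2 / real q ^ r)"
    by (simp add: a_def ennreal_leI)
  moreover have "(\<lambda>x. \<Sum>k. ennreal (w k) * indicator (C k) x) \<in> borel_measurable \<mu>"
    using C by (intro borel_measurable_suminf_order) auto
  ultimately show ?thesis
    using bound by (intro bexI[of _ "\<lambda>x. \<Sum>k. ennreal (w k) * indicator (C k) x"] conjI ballI impI)
qed

text \<open>\<open>B k\<close> holds the families whose entries are all divisible by
  \<open>\<pi> ^ k\<close> and has measure q^(-(m+1)k); on the layer \<open>B k - B (Suc k)\<close>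
  the maximum is q^(-k), so the integral is a geometric series. \<open>g\<close> is prescribed on
  integral families only, which allows the norm of a polynomial value to be inserted for it.\<close>

lemma integral_Omega:
  assumes q: "nrm \<pi> = 1 / real q" "card R = q" "2 \<le> q" and "0 < r"
    and g: "\<And>Q. Q \<in> {..m} \<rightarrow>\<^sub>E int_ring nrm K \<Longrightarrow> g Q = Max ((\<lambda>i. nrm (Q i)) ` {..m})"
  shows "(\<integral>\<^sup>+ Q. ennreal (g Q ^ r) \<partial>Omega nrm K \<mu> m)
    = ennreal ((1 - 1 / real q ^ Suc m) / (1 - 1 / real q ^ (Suc m + r)))"
proof -
  define M where "M = restrict_space \<mu> (int_ring nrm K)"
  have O: "int_ring nrm K \<in> sets \<mu>"
    unfolding int_ring_def by (rule cball_sets) simp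
  then have O': "int_ring nrm K \<inter> space \<mu> \<in> sets \<mu>" by auto
  have space_M: "space M = int_ring nrm K"
    by (auto simp: M_def space_restrict_space space_\<mu> int_ring_def)
  have sets_M: "A \<in> sets M \<longleftrightarrow> A \<subseteq> int_ring nrm K \<and> A \<in> sets \<mu>" for A
    unfolding M_def by (rule sets_restrict_space_iff[OF O'])
  have em_M: "emeasure M A = emeasure \<mu> A" if "A \<subseteq> int_ring nrm K" for A
    unfolding M_def by (rule emeasure_restrict_space[OF O' that])
  have "emeasure M (space M) = 1"
    using em_M[of "int_ring nrm K"] emeasure_int_ring by (simp add: space_M int_ring_def)
  then interpret M: finite_measure M by (intro finite_measureI) simp
  interpret P: product_sigma_finite "\<lambda>_. M" ..
  define P where "P = PiM {..m} (\<lambda>_. M)"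
  have space_P: "space P = {..m} \<rightarrow>\<^sub>E int_ring nrm K"
    by (simp add: P_def space_PiM space_M)
  define C where "C = (\<lambda>k. {y \<in> K. nrm y \<le> nrm \<pi> ^ k})"
  define B where "B = (\<lambda>k. {..m} \<rightarrow>\<^sub>E C k)"
  have C: "C k \<in> sets M" "C k \<subseteq> int_ring nrm K" for k
  proof -
    show "C k \<subseteq> int_ring nrm K"
      using power_le_one[of "nrm \<pi>" k] \<pi>(3) by (auto simp: C_def int_ring_def)
    then show "C k \<in> sets M"
      using cball_sets[of "nrm \<pi> ^ k"] \<pi> by (auto simp: sets_M C_def)
  qed
  have B: "B k \<in> sets P" for k
    unfolding B_def P_def using C by (intro sets_PiM_I_finite) auto
  define b where "b = 1 / real q ^ Suc m"
  have em_B: "emeasure P (B k) = ennreal (b ^ k)" for k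
  proof -
    have "emeasure P (B k) = (\<Prod>i\<in>{..m}. emeasure M (C k))"
      unfolding B_def P_def using C by (intro P.emeasure_PiM) auto
    also have "\<dots> = (\<Prod>i\<in>{..m}. ennreal (1 / real q ^ k))"
      using em_M[OF C(2)] emeasure_cball_power[of k] q(2) by (simp add: C_def)
    also have "\<dots> = ennreal ((1 / real q ^ k) ^ Suc m)"
      by (simp add: ennreal_power del: power_Suc)
    also have "(1 / real q ^ k) ^ Suc m = b ^ k"
      unfolding b_def power_one_over by (simp only: power_mult[symmetric] mult.commute)
    finally show ?thesis .
  qed
  have mono: "B (Suc k) \<subseteq> B k" for k
  proof -
    have "nrm \<pi> ^ Suc k \<le> nrm \<pi> ^ k" using \<pi>(3) by (intro power_decreasing) auto
    then have "C (Suc k) \<subseteq> C k" by (auto simp: C_def)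
    then show ?thesis by (auto simp: B_def PiE_iff)
  qed
  have b01: "0 < b" "b < 1" using q(3) by (auto simp: b_def intro!: one_less_power simp del: power_Suc)
  have em_diff: "emeasure P (B k - B (Suc k)) = ennreal (b ^ k * (1 - b))" for k
  proof -
    have "emeasure P (B k - B (Suc k)) = ennreal (b ^ k) - ennreal (b ^ Suc k)"
      using B mono em_B by (subst emeasure_Diff) auto
    also have "\<dots> = ennreal (b ^ k - b ^ Suc k)"
      using b01 by (simp add: ennreal_minus)
    finally show ?thesis by (simp add: algebra_simps)
  qed
  define w where "w = (\<lambda>k. (1 / real q ^ r) ^ k)"
  have "ennreal (g Q ^ r) = (\<Sum>k. ennreal (w k) * indicator (B k - B (Suc k)) Q)" if Q: "Q \<in> space P" for Q
  proof -
    have QO: "Q i \<in> int_ring nrm K" if "i \<le> m" for i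
      using Q that by (auto simp: space_P)
    have gQ: "g Q = Max ((\<lambda>i. nrm (Q i)) ` {..m})"
      using Q by (intro g) (simp add: space_P)
    have QB: "Q \<in> B k \<longleftrightarrow> g Q \<le> nrm \<pi> ^ k" for k
      using Q unfolding gQ by (auto simp: B_def C_def space_P PiE_iff int_ring_def)
    have "g Q \<in> (\<lambda>i. nrm (Q i)) ` {..m}"
      unfolding gQ by (rule Max_in) auto
    then obtain j where j: "j \<le> m" "g Q = nrm (Q j)" by auto
    show ?thesis
    \<comment> \<open>The zero family belongs to every \<open>B k\<close> and thus to no layer; as
      \<open>r\<close> is positive, the integrand is 0 there too.\<close>
    proof (cases "Q j = 0")
      case True
      then have "g Q = 0" using j by simp
      then show ?thesis
        using assms(4) \<pi>(2) by (simp add: QB)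
    next
      case False
      then obtain k where k: "g Q = nrm \<pi> ^ k"
        using nrm_in_powers[of "Q j"] QO[OF j(1)] j(2) by (auto simp: int_ring_def)
      have iff: "Q \<in> B l \<longleftrightarrow> l \<le> k" for l
        unfolding QB k using \<pi> power_decreasing_iff[of "nrm \<pi>" k l] by simp
      have "(\<Sum>l. ennreal (w l) * indicator (B l - B (Suc l)) Q) = (\<Sum>l. if l = k then ennreal (w l) else 0)"
        by (intro suminf_cong) (auto simp: iff indicator_def)
      also have "\<dots> = ennreal (w k)"
        by (rule sums_unique[symmetric, OF sums_single])
      also have "w k = g Q ^ r"
        by (simp add: w_def k q(1) power_divide power_mult[symmetric] mult.commute)
      finally show ?thesis by simp
    qed
  qed
  then have "(\<integral>\<^sup>+ Q. ennreal (g Q ^ r) \<partial>P) = (\<integral>\<^sup>+ Q. (\<Sum>k. ennreal (w k) * indicator (B k - B (Suc k)) Q) \<partial>P)"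
    by (intro nn_integral_cong)
  also have "\<dots> = (\<Sum>k. ennreal (w k) * emeasure P (B k - B (Suc k)))"
    using B by (subst nn_integral_suminf) (auto simp: nn_integral_cmult_indicator)
  also have "\<dots> = (\<Sum>k. ennreal ((1 - b) * (1 / real q ^ (Suc m + r)) ^ k))"
  proof (intro suminf_cong)
    fix k
    have "w k * b ^ k = (1 / real q ^ (Suc m + r)) ^ k"
      by (simp add: w_def b_def power_mult_distrib[symmetric] power_add mult_ac)
    then show "ennreal (w k) * emeasure P (B k - B (Suc k)) = ennreal ((1 - b) * (1 / real q ^ (Suc m + r)) ^ k)"
      using b01 by (simp add: em_diff ennreal_mult[symmetric] w_def mult_ac)
  qed
  also have "\<dots> = ennreal ((1 - b) * (1 / (1 - 1 / real q ^ (Suc m + r))))"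
  proof (rule suminf_ennreal_eq)
    have "1 < real q ^ (Suc m + r)" using q(3) by (intro one_less_power) auto
    then show "(\<lambda>k. (1 - b) * (1 / real q ^ (Suc m + r)) ^ k) sums ((1 - b) * (1 / (1 - 1 / real q ^ (Suc m + r))))"
      by (intro sums_mult geometric_sums) simp
  qed (use b01 in auto)
  finally show ?thesis
    by (simp add: Omega_def P_def M_def b_def)
qed

lemma emeasure_space_Omega: "emeasure (Omega nrm K \<mu> m) (space (Omega nrm K \<mu> m)) = 1"
proof -
  define M where "M = restrict_space \<mu> (int_ring nrm K)"
  have O: "int_ring nrm K \<in> sets \<mu>"
    unfolding int_ring_def by (rule cball_sets) simp
  then have "emeasure M (space M) = emeasure \<mu> (int_ring nrm K)"
    unfolding M_def using sets.sets_into_space[OF O]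
    by (subst emeasure_restrict_space) (auto simp: space_restrict_space Int_absorb2)
  then have 1: "emeasure M (space M) = 1"
    using emeasure_int_ring by (simp add: int_ring_def)
  then interpret M: finite_measure M by (intro finite_measureI) simp
  interpret P: product_sigma_finite "\<lambda>_. M" ..
  show ?thesis
    unfolding Omega_def M_def[symmetric] space_PiM
    by (subst P.emeasure_PiM) (auto simp: 1)
qed

end

section \<open>Generators of the residue extension\<close>

lemma sum_mem_adjoin:
  assumes "0 \<in> A" "\<And>i. i < k \<Longrightarrow> c i \<in> A"
  shows "(\<Sum>i<k. c i * x ^ i) \<in> adjoin A x"
proof -
  define P where "P = (\<Sum>i<k. monom (c i) i)"
  have "coeff P i = (if i < k then c i else 0)" for i
    by (simp add: P_def coeff_sum)
  then have "\<forall>i. coeff P i \<in> A" using assms by simp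
  moreover have "poly P x = (\<Sum>i<k. c i * x ^ i)"
    by (simp add: P_def poly_sum poly_monom)
  ultimately show ?thesis unfolding adjoin_def by force
qed

lemma sum_geometric_le:
  fixes q :: real
  assumes "2 \<le> q"
  shows "(\<Sum>s\<le>k. q ^ s) \<le> 2 * q ^ k"
proof (induction k)
  case (Suc k)
  have "2 * q ^ k \<le> q * q ^ k"
    using assms by (intro mult_right_mono) auto
  then show ?case using Suc by simp
qed simp

context resid_ext
begin

lemma period_cong:
  assumes "x \<in> int_ring nrm K" "y \<in> int_ring nrm K" "x \<simeq> y"
  shows "period x = period y"
proof -
  have "x ^ (q ^ s) \<simeq> x \<longleftrightarrow> y ^ (q ^ s) \<simeq> y" for s
  proof -
    have 1: "x ^ (q ^ s) \<simeq> y ^ (q ^ s)"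
      using assms(3) int_ringD(1)[OF assms(1)] by (rule resid_power)
    show ?thesis
      using 1 assms(3) resid_sym resid_trans by blast
  qed
  then show ?thesis by (simp add: period_def)
qed

lemma card_period_le: "0 < s \<Longrightarrow> card {t \<in> R. period t = s} \<le> q ^ s"
  using incong_subset[OF reps_incong[OF R]] reps_finite[OF R] period(2) reps_int_ring[OF R]
  by (intro card_fixed_le) auto

text \<open>A period s below \<open>r\<close> is a proper divisor, hence at most r/2, and belongs to
  at most q^s residues, so the sum is at most that of the q^(2s). Divided by q^r for the index and
  again for the measure of a residue class, this is the share of the residues that do not
  generate.\<close>

lemma sum_bad_period_le: "(\<Sum>t\<in>{t \<in> R. period t < r}. real q ^ period t) \<le> 2 * real q ^ r"
proof -
  have sub: "{t \<in> R. period t < r} = (\<Union>s\<in>{1..r div 2}. {t \<in> R. period t = s \<and> s < r})"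
  proof (intro subset_antisym subsetI)
    fix t assume t: "t \<in> {t \<in> R. period t < r}"
    then have tO: "t \<in> int_ring nrm K" using reps_int_ring[OF R] by auto
    obtain m where m: "r = period t * m" using period_dvd_r[OF tO] by auto
    have "1 < m"
    proof (rule ccontr)
      assume "\<not> 1 < m"
      then have "m = 0 \<or> m = 1" by auto
      then show False using m t r_pos by auto
    qed
    then have "2 * period t \<le> r" using m by (simp add: mult.commute)
    then show "t \<in> (\<Union>s\<in>{1..r div 2}. {t \<in> R. period t = s \<and> s < r})"
      using t period(1)[OF tO] by auto
  qed auto
  have "(\<Sum>t\<in>{t \<in> R. period t < r}. real q ^ period t)
      = (\<Sum>s\<in>{1..r div 2}. \<Sum>t\<in>{t \<in> R. period t = s \<and> s < r}. real q ^ period t)"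
    unfolding sub using reps_finite[OF R] by (intro sum.UNION_disjoint) auto
  also have "\<dots> \<le> (\<Sum>s\<in>{1..r div 2}. real q ^ s * real q ^ s)"
  proof (rule sum_mono)
    fix s assume "s \<in> {1..r div 2}"
    have "(\<Sum>t\<in>{t \<in> R. period t = s \<and> s < r}. real q ^ period t)
        = real (card {t \<in> R. period t = s \<and> s < r}) * real q ^ s"
      by (simp add: sum_constant[symmetric] del: sum_constant)
    also have "card {t \<in> R. period t = s \<and> s < r} \<le> card {t \<in> R. period t = s}"
      using reps_finite[OF R] by (intro card_mono) auto
    also have "\<dots> \<le> q ^ s"
      using \<open>s \<in> _\<close> by (intro card_period_le) auto
    finally show "(\<Sum>t\<in>{t \<in> R. period t = s \<and> s < r}. real q ^ period t) \<le> real q ^ s * real q ^ s"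
      using q_ge_2 by (simp add: mult_right_mono flip: of_nat_power)
  qed
  also have "\<dots> \<le> (\<Sum>s\<le>r div 2. (real q ^ 2) ^ s)"
    unfolding power_mult_distrib[symmetric] power2_eq_square by (intro sum_mono2) auto
  also have "\<dots> \<le> 2 * (real q ^ 2) ^ (r div 2)"
  proof (rule sum_geometric_le)
    have "2 * 1 \<le> real q * real q" using q_ge_2 by (intro mult_mono) auto
    then show "2 \<le> real q ^ 2" by (simp add: power2_eq_square)
  qed
  also have "(real q ^ 2) ^ (r div 2) \<le> real q ^ r"
    unfolding power_mult[symmetric] using q_ge_2 by (intro power_increasing) auto
  finally show ?thesis by simp
qed

text \<open>Members of \<open>R\<close> in the same coset differ by elements of O_F[x]; subtracting
  one of them embeds each fibre into the residues of O_F[x], of which there are at most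
  \<open>q ^ period x\<close>. The hypothesis that \<open>quot_card\<close> is not 0 says that the
  index is finite, since \<open>card\<close> is 0 on infinite sets.\<close>

lemma quot_card_adjoin_ge:
  assumes x: "x \<in> int_ring nrm K" and "quot_card (int_ring nrm K) (adjoin (int_ring nrm F) x) \<noteq> 0"
  shows "q ^ r \<le> quot_card (int_ring nrm K) (adjoin (int_ring nrm F) x) * q ^ period x"
proof -
  define A where "A = adjoin (int_ring nrm F) x"
  define f where "f = (\<lambda>y. (+) y ` A)"
  have qc: "quot_card (int_ring nrm K) A = card (f ` int_ring nrm K)"
    by (simp add: quot_card_def f_def)
  have fin: "finite (f ` int_ring nrm K)"
    using assms(2) qc card.infinite unfolding A_def[symmetric] by metis
  have A0: "0 \<in> A"
    unfolding A_def adjoin_def by (rule CollectI, rule exI[of _ 0]) (simp add: int_ring_0[OF subF])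
  have fiber: "card {t \<in> R. f t = c} \<le> q ^ period x" for c
  proof (cases "{t \<in> R. f t = c} = {}")
    case False
    then obtain t0 where t0: "t0 \<in> R" "f t0 = c" by blast
    have "\<forall>t\<in>R. \<exists>u\<in>R. t - t0 \<simeq> u"
      using reps_ex[OF R] reps_int_ring[OF R] t0(1) int_ring_diff[OF subK] by blast
    then obtain h where h: "\<And>t. t \<in> R \<Longrightarrow> h t \<in> R \<and> t - t0 \<simeq> h t"
      by metis
    have "inj_on h {t \<in> R. f t = c}"
    proof (rule inj_onI)
      fix s t assume st: "s \<in> {t \<in> R. f t = c}" "t \<in> {t \<in> R. f t = c}" "h s = h t"
      then have "s - t0 \<simeq> t - t0"
        using h[of s] h[of t] resid_sym resid_trans by (metis (mono_tags) mem_Collect_eq)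
      then show "s = t"
        using reps_incong[OF R] st by (auto simp: incong_def)
    qed
    moreover have "h ` {t \<in> R. f t = c} \<subseteq> {t \<in> R. \<exists>y\<in>A. t \<simeq> y}"
    proof (rule image_subsetI)
      fix t assume t: "t \<in> {t \<in> R. f t = c}"
      then have "t + 0 \<in> f t0" using t0 A0 unfolding f_def by blast
      then obtain y where "y \<in> A" "t - t0 = y" by (auto simp: f_def)
      then show "h t \<in> {t \<in> R. \<exists>y\<in>A. t \<simeq> y}"
        using h[of t] t resid_sym by blast
    qed
    ultimately have "card {t \<in> R. f t = c} \<le> card {t \<in> R. \<exists>y\<in>A. t \<simeq> y}"
      using reps_finite[OF R] by (intro card_inj_on_le) auto
    also have "\<dots> \<le> q ^ period x"
      unfolding A_def by (rule card_poly_values_le[OF x])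
    finally show ?thesis .
  qed (metis card.empty le0)
  have "R = (\<Union>c\<in>f ` int_ring nrm K. {t \<in> R. f t = c})"
    using reps_int_ring[OF R] by auto
  then have "q ^ r \<le> (\<Sum>c\<in>f ` int_ring nrm K. card {t \<in> R. f t = c})"
    using card_UN_le[OF fin, of "\<lambda>c. {t \<in> R. f t = c}"] card_R by metis
  also have "\<dots> \<le> (\<Sum>c\<in>f ` int_ring nrm K. q ^ period x)"
    by (intro sum_mono fiber)
  finally show ?thesis
    by (simp add: qc A_def[symmetric])
qed

text \<open>After division by a coefficient of largest norm, a value of norm below 1 would be a
  relation modulo the maximal ideal between independent powers of \<open>x\<close>.\<close>

lemma period_r_nrm_sum:
  assumes x: "x \<in> int_ring nrm K" "period x = r" and m: "m < r" and c: "\<And>i. i \<le> m \<Longrightarrow> c i \<in> F"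
  shows "nrm (\<Sum>i\<le>m. c i * x ^ i) = Max ((\<lambda>i. nrm (c i)) ` {..m})"
proof -
  have "Max ((\<lambda>i. nrm (c i)) ` {..m}) \<in> (\<lambda>i. nrm (c i)) ` {..m}"
    by (rule Max_in) auto
  then obtain j where j: "j \<le> m" "nrm (c j) = Max ((\<lambda>i. nrm (c i)) ` {..m})"
    by (metis (no_types, lifting) atMost_iff imageE)
  have le: "nrm (c i) \<le> nrm (c j)" if "i \<le> m" for i
    using that unfolding j(2) by (intro Max_ge) auto
  have "nrm (\<Sum>i\<le>m. c i * x ^ i) = nrm (c j)"
  proof (cases "c j = 0")
    case True
    then have "c i = 0" if "i \<le> m" for i using le[OF that] nrm_pos_iff[of "c i"] by fastforce
    then show ?thesis using True by simp
  next
    case False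
    define a where "a = (\<lambda>i. if i \<le> m then c i / c j else 0)"
    have a: "a i \<in> int_ring nrm F" for i
      using c j(1) le False subF
      by (auto simp: a_def int_ring_def nrm_divide intro: subfield_divide subfield_0)
    have "(\<Sum>i<r. a i * x ^ i) = (\<Sum>i\<le>m. a i * x ^ i)"
      using m by (intro sum.mono_neutral_right) (auto simp: a_def)
    moreover have "(\<Sum>i\<le>m. c i * x ^ i) = c j * (\<Sum>i\<le>m. a i * x ^ i)"
      using False by (auto simp: sum_distrib_left a_def intro!: sum.cong)
    ultimately have eq: "(\<Sum>i\<le>m. c i * x ^ i) = c j * (\<Sum>i<r. a i * x ^ i)" by simp
    have "\<not> (\<Sum>i<r. a i * x ^ i) \<simeq> 0"
    proof
      assume "(\<Sum>i<r. a i * x ^ i) \<simeq> 0"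
      then have "a j \<simeq> 0" using period_r_independent[of x a j] x a j(1) m by simp
      then show False using j(1) False by (simp add: a_def)
    qed
    moreover have "nrm (\<Sum>i<r. a i * x ^ i) \<le> 1"
      using int_ringD(1)[OF a] int_ringD(1)[OF x(1)]
      by (intro nrm_sum_le nrm_mult_le_1 nrm_power_le_1) auto
    ultimately have "nrm (\<Sum>i<r. a i * x ^ i) = 1" by simp
    then show ?thesis by (simp add: eq nrm_mult)
  qed
  then show ?thesis by (simp add: j(2))
qed

context
  fixes b assumes b: "is_basis F K r b"
begin

text \<open>\<open>period_r_nrm_sum\<close> makes the powers of \<open>x\<close> independent over
  \<open>F\<close> and bounds the coefficients by the norm of \<open>y\<close>; the bound settles
  the ring of integers along with the field.\<close>

lemma period_r_span:
  assumes x: "x \<in> int_ring nrm K" "period x = r" and y: "y \<in> K"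
  shows "\<exists>c. (\<forall>i<r. c i \<in> F \<and> nrm (c i) \<le> nrm y) \<and> y = (\<Sum>i<r. c i * x ^ i)"
proof -
  obtain m where m: "r = Suc m" using r_pos by (cases r) auto
  have Max: "nrm (c i) \<le> nrm (\<Sum>i<r. c i * x ^ i)" if "\<And>i. i < r \<Longrightarrow> c i \<in> F" "i < r" for c i
  proof -
    have "nrm (\<Sum>i\<le>m. c i * x ^ i) = Max ((\<lambda>i. nrm (c i)) ` {..m})"
      using that m by (intro period_r_nrm_sum[OF x]) auto
    then show ?thesis
      using that(2) m by (simp add: lessThan_Suc_atMost)
  qed
  have "\<exists>c. (\<forall>i<r. c i \<in> F) \<and> y = (\<Sum>i<r. c i * x ^ i)"
  proof (rule independent_spans[OF subF subK FK b _ _ y])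
    show "x ^ i \<in> K" for i using int_ringD(2)[OF x(1)] subK by (intro subfield_power)
    show "c i = 0" if "\<And>i. i < r \<Longrightarrow> c i \<in> F" "(\<Sum>i<r. c i * x ^ i) = 0" "i < r" for c i
      using Max[of c i] that nrm_pos_iff[of "c i"] by fastforce
  qed
  then obtain c where c: "\<forall>i<r. c i \<in> F" "y = (\<Sum>i<r. c i * x ^ i)" by auto
  then show ?thesis using Max[of c] by (intro exI[of _ c]) auto
qed

lemma period_r_adjoin_field:
  assumes x: "x \<in> int_ring nrm K" "period x = r"
  shows "adjoin F x = K"
proof (intro subset_antisym subsetI)
  fix y assume "y \<in> adjoin F x"
  then obtain P where "y = poly P x" "\<forall>i. coeff P i \<in> F" by (auto simp: adjoin_def)
  then show "y \<in> K"
    using FK int_ringD(2)[OF x(1)] subK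
    by (auto simp: poly_altdef intro!: subfield_sum subfield_mult subfield_power)
next
  fix y assume "y \<in> K"
  then show "y \<in> adjoin F x"
    using period_r_span[OF x] sum_mem_adjoin[of F r _ x] subfield_0[OF subF] by metis
qed

lemma period_r_adjoin_int_ring:
  assumes x: "x \<in> int_ring nrm K" "period x = r"
  shows "adjoin (int_ring nrm F) x = int_ring nrm K"
proof (intro subset_antisym subsetI)
  fix y assume "y \<in> adjoin (int_ring nrm F) x"
  then obtain P where "y = poly P x" "\<forall>i. coeff P i \<in> int_ring nrm F" by (auto simp: adjoin_def)
  then show "y \<in> int_ring nrm K"
    using int_ring_F_K x(1) subK
    by (auto simp: poly_altdef intro!: int_ring_sum int_ring_mult int_ring_power)
next
  fix y assume y: "y \<in> int_ring nrm K"
  then obtain c where "\<forall>i<r. c i \<in> F \<and> nrm (c i) \<le> nrm y" "y = (\<Sum>i<r. c i * x ^ i)"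
    using period_r_span[OF x] int_ringD(2) by blast
  then show "y \<in> adjoin (int_ring nrm F) x"
    using sum_mem_adjoin[of "int_ring nrm F" r c x] int_ring_0[OF subF] int_ringD(1)[OF y]
    by (fastforce simp: int_ring_def)
qed

lemma period_r_quot_card:
  assumes x: "x \<in> int_ring nrm K" "period x = r"
  shows "quot_card (int_ring nrm K) (adjoin (int_ring nrm F) x) = 1"
proof -
  have "(+) y ` int_ring nrm K = int_ring nrm K" if "y \<in> int_ring nrm K" for y
  proof (intro subset_antisym subsetI)
    fix z assume "z \<in> int_ring nrm K"
    then show "z \<in> (+) y ` int_ring nrm K"
      using that subK by (intro image_eqI[of _ _ "z - y"]) (auto intro: int_ring_diff)
  qed (use that subK in \<open>auto intro: int_ring_add\<close>)
  then have "(\<lambda>y. (+) y ` int_ring nrm K) ` int_ring nrm K = {int_ring nrm K}"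
    using int_ring_0[OF subK] by auto
  then show ?thesis
    by (simp add: quot_card_def period_r_adjoin_int_ring[OF x])
qed

end

end

definition triv_nrm :: "'a::field \<Rightarrow> real" where
  "triv_nrm x = (if x = 0 then 0 else 1)"

text \<open>With the trivial absolute value, a finite field is its own residue field.\<close>

lemma resid_ext_finite_field:
  fixes Fq :: "'e::{field,finite} set"
  assumes "is_subfield Fq" "card Fq = q" "CARD('e) = q ^ r" "0 < r"
  shows "resid_ext triv_nrm Fq UNIV Fq (UNIV :: 'e set) q r"
proof
  show "is_nonarch_abs (triv_nrm :: 'e \<Rightarrow> real)"
    by (auto simp: is_nonarch_abs_def triv_nrm_def)
  have *: "triv_nrm (x - y :: 'e) < 1 \<longleftrightarrow> x = y" for x y
    by (simp add: triv_nrm_def)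
  show "is_reps triv_nrm Fq Fq" "is_reps triv_nrm UNIV (UNIV :: 'e set)"
    unfolding is_reps_def * by (auto simp: int_ring_def triv_nrm_def)
  show "is_subfield (UNIV :: 'e set)" by (simp add: is_subfield_def)
qed (use assms in auto)

text \<open>For the trivial norm congruence is equality, so \<open>card_poly_values_le\<close>
  bounds the size of the adjunction by q^period, and \<open>period_r_generates\<close> gives the
  converse.\<close>

lemma adjoin_eq_UNIV_iff_period:
  fixes Fq :: "'e::{field,finite} set"
  assumes "is_subfield Fq" "card Fq = q" "CARD('e) = q ^ r" "0 < r"
  shows "adjoin Fq \<alpha> = UNIV \<longleftrightarrow> resid_ext.period triv_nrm q \<alpha> = r"
proof -
  interpret resid_ext triv_nrm Fq UNIV Fq "UNIV :: 'e set" q r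
    by (rule resid_ext_finite_field[OF assms])
  have eq_iff: "triv_nrm (x - y) < 1 \<longleftrightarrow> x = y" for x y :: 'e
    by (simp add: triv_nrm_def)
  have O: "int_ring triv_nrm S = S" for S :: "'e set"
    by (auto simp: int_ring_def triv_nrm_def)
  show ?thesis
  proof
    assume "adjoin Fq \<alpha> = UNIV"
    then have "CARD('e) \<le> q ^ period \<alpha>"
      using card_poly_values_le[of \<alpha>] unfolding eq_iff O by simp
    then have "r \<le> period \<alpha>"
      using q_ge_2 assms(3) by simp
    moreover have "period \<alpha> \<le> r"
      using period_dvd_r[of \<alpha>] r_pos unfolding O by (intro dvd_imp_le) auto
    ultimately show "period \<alpha> = r" by simp
  next
    assume "period \<alpha> = r"
    then have "\<exists>c. (\<forall>i<r. c i \<in> Fq) \<and> y = (\<Sum>i<r. c i * \<alpha> ^ i)" for y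
      using period_r_generates[of \<alpha> y] unfolding eq_iff O by simp
    then show "adjoin Fq \<alpha> = UNIV"
      using sum_mem_adjoin[of Fq r _ \<alpha>] subfield_0[OF assms(1)] by (metis UNIV_eq_I)
  qed
qed

text \<open>Equal divisor sums take the place of an isomorphism between finite fields of the same
  size.\<close>

lemma card_period_r_unique:
  assumes "resid_ext nrm F K RF R q r" "resid_ext nrm' F' K' RF' R' q r"
  shows "card {t \<in> R. resid_ext.period nrm q t = r} = card {t \<in> R'. resid_ext.period nrm' q t = r}"
proof -
  interpret A: resid_ext nrm F K RF R q r by fact
  interpret B: resid_ext nrm' F' K' RF' R' q r by fact
  show ?thesis
    using A.sum_card_period B.sum_card_period A.r_pos
    by (intro divisor_sum_determines[of r "\<lambda>s. card {t \<in> R. A.period t = s}" "\<lambda>s. card {t \<in> R'. B.period t = s}"]) auto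
qed

section \<open>Representatives and bases for an unramified extension\<close>

lemma (in nonarch) reps_of_quot_card:
  assumes K: "is_subfield K" and "quot_card (int_ring nrm K) (max_ideal nrm K) = q" "0 < q"
  shows "\<exists>R. is_reps nrm K R \<and> card R = q"
proof -
  define f where "f = (\<lambda>y. (+) y ` max_ideal nrm K)"
  have f_eq: "f x = f y \<longleftrightarrow> x \<simeq> y" if x: "x \<in> int_ring nrm K" and y: "y \<in> int_ring nrm K" for x y
  proof
    assume "f x = f y"
    moreover have "x + 0 \<in> f x"
      unfolding f_def using subfield_0[OF K] by (intro imageI) (simp add: max_ideal_def)
    ultimately have "x \<in> f y" by simp
    then show "x \<simeq> y" by (auto simp: f_def max_ideal_def)
  next
    have sub: "f x \<subseteq> f y" if xy: "x \<in> K" "y \<in> K" "x \<simeq> y" for x y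
    proof
      fix z assume "z \<in> f x"
      then obtain w where w: "w \<in> K" "nrm w < 1" "z = x + w" by (auto simp: f_def max_ideal_def)
      have "x - y + w \<in> max_ideal nrm K"
        using xy w K nrm_add_less[of "x - y" 1 w] by (auto simp: max_ideal_def intro: subfield_add subfield_diff)
      then show "z \<in> f y"
        unfolding f_def by (intro image_eqI[of _ _ "x - y + w"]) (auto simp: w)
    qed
    assume "x \<simeq> y"
    then show "f x = f y"
      using sub[of x y] sub[of y x] int_ringD(2)[OF x] int_ringD(2)[OF y] resid_sym by blast
  qed
  obtain R where R: "R \<subseteq> int_ring nrm K" "inj_on f R" "f ` int_ring nrm K = f ` R"
    using subset_image_inj[of "f ` int_ring nrm K" f "int_ring nrm K"] by auto
  have card: "card R = q"
    using assms(2) card_image[OF R(2)] R(3) unfolding quot_card_def f_def[symmetric] by simp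
  have "\<exists>!t. t \<in> R \<and> x \<simeq> t" if x: "x \<in> int_ring nrm K" for x
  proof (rule ex_ex1I)
    obtain t where "t \<in> R" "f x = f t" using x R(3) by blast
    then show "\<exists>t. t \<in> R \<and> x \<simeq> t" using f_eq[OF x] R(1) by blast
    fix s t assume st: "s \<in> R \<and> x \<simeq> s" "t \<in> R \<and> x \<simeq> t"
    then have "s \<in> int_ring nrm K" "t \<in> int_ring nrm K" using R(1) by blast+
    then have "f s = f t" using f_eq[OF x, of s] f_eq[OF x, of t] st by metis
    then show "s = t" using st inj_onD[OF R(2), of s t] by blast
  qed
  moreover have "finite R" using card assms(3) by (auto intro: card_ge_0_finite)
  ultimately have "is_reps nrm K R" using R(1) unfolding is_reps_def by blast
  then show ?thesis using card by blast
qed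

text \<open>There is a single coset of the value group of \<open>F\<close>, so that of
  \<open>nrm x\<close> equals that of 1.\<close>

lemma (in nonarch) unramified_same_values:
  assumes F: "is_subfield F" "F \<subseteq> K" and "unramified nrm F K" "x \<in> K" "x \<noteq> 0"
  shows "\<exists>a\<in>F. nrm a = nrm x"
proof -
  define V where "V = nrm ` (F - {0})"
  have one: "1 \<in> V" unfolding V_def using subfield_1[OF F(1)] by (force intro: image_eqI[of _ _ 1])
  have "card ((\<lambda>v. (*) v ` V) ` nrm ` (K - {0})) = 1"
    using assms(3) by (simp add: unramified_def ram_index_def V_def)
  then obtain S where S: "(\<lambda>v. (*) v ` V) ` nrm ` (K - {0}) = {S}"
    by (rule card_1_singletonE)
  have coset: "(*) (nrm y) ` V = S" if "y \<in> K" "y \<noteq> 0" for y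
    using S that by blast
  have "(*) (nrm x) ` V = (*) (nrm 1) ` V"
    using coset[OF assms(4,5)] coset[of 1] F subfield_1[OF F(1)] by auto
  moreover have "nrm x * 1 \<in> (*) (nrm x) ` V" using one by (rule imageI)
  ultimately have "nrm x \<in> V" by simp
  then show ?thesis by (auto simp: V_def)
qed

text \<open>An element of \<open>K\<close> is scaled into O_K by an element of \<open>F\<close> of
  the same norm, and a relation over \<open>F\<close> into one over O_F by its largest coefficient.
  The discriminant comes with a basis over O_F, while the trace form is treated with one over
  \<open>F\<close>.\<close>

lemma (in nonarch) int_basis_imp_field_basis:
  assumes F: "is_subfield F" and K: "is_subfield K" and FK: "F \<subseteq> K"
    and b: "is_basis (int_ring nrm F) (int_ring nrm K) r b"
    and vals: "\<And>x. x \<in> K \<Longrightarrow> x \<noteq> 0 \<Longrightarrow> \<exists>a\<in>F. nrm a = nrm x"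
  shows "is_basis F K r b"
proof -
  have indep: "c i = 0" if c: "\<And>i. i < r \<Longrightarrow> c i \<in> F" "(\<Sum>i<r. c i * b i) = 0" "i < r" for c i
  proof (rule ccontr)
    assume ci: "c i \<noteq> 0"
    define M where "M = Max ((\<lambda>i. nrm (c i)) ` {..<r})"
    have "M \<in> (\<lambda>i. nrm (c i)) ` {..<r}"
      unfolding M_def using c(3) by (intro Max_in) auto
    then obtain j where j: "j < r" "nrm (c j) = M" by auto
    have le: "nrm (c i) \<le> nrm (c j)" if "i < r" for i
      using that unfolding j(2) M_def by (intro Max_ge) auto
    have cj: "c j \<noteq> 0" using le[OF c(3)] ci nrm_pos_iff[of "c i"] by fastforce
    have "c j / c j = 0"
    proof (rule is_basis_unique[OF b, where c = "\<lambda>i. c i / c j" and c' = "\<lambda>_. 0"])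
      show "c i / c j \<in> int_ring nrm F" if "i < r" for i
        using c(1) j(1) that le[OF that] cj F by (auto simp: int_ring_def nrm_divide intro: subfield_divide)
      have "(\<Sum>i<r. c i / c j * b i) = 0"
        using c(2) by (simp add: sum_divide_distrib[symmetric])
      then show "(\<Sum>i<r. c i / c j * b i) = (\<Sum>i<r. 0 * b i)" "(\<Sum>i<r. c i / c j * b i) \<in> int_ring nrm K"
        using int_ring_0[OF K] by auto
    qed (use j int_ring_0[OF F] in auto)
    then show False using cj by simp
  qed
  have ex: "\<exists>c. (\<forall>i<r. c i \<in> F) \<and> x = (\<Sum>i<r. c i * b i)" if x: "x \<in> K" for x
  proof (cases "x = 0")
    case True
    then show ?thesis using subfield_0[OF F] by (intro exI[of _ "\<lambda>_. 0"]) auto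
  next
    case False
    then obtain a where a: "a \<in> F" "nrm a = nrm x" using vals[OF x] by blast
    have a0: "a \<noteq> 0" using a False by auto
    have "x / a \<in> int_ring nrm K"
      using x a a0 K FK by (auto simp: int_ring_def nrm_divide intro: subfield_divide)
    then obtain c where c: "\<forall>i<r. c i \<in> int_ring nrm F" "x / a = (\<Sum>i<r. c i * b i)"
      using is_basis_ex[OF b] by blast
    have "x = a * (x / a)" using a0 by simp
    also have "\<dots> = (\<Sum>i<r. a * c i * b i)"
      unfolding c(2) by (simp add: sum_distrib_left mult.assoc)
    finally show ?thesis
      using c(1) a F by (intro exI[of _ "\<lambda>i. a * c i"]) (auto simp: int_ring_def intro: subfield_mult)
  qed
  show ?thesis
    unfolding is_basis_def
  proof (intro conjI allI impI ballI)
    show "b i \<in> K" if "i < r" for i using is_basis_mem[OF b that] by (rule int_ringD(2))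
    fix x assume "x \<in> K"
    show "\<exists>!c. c \<in> {..<r} \<rightarrow>\<^sub>E F \<and> x = (\<Sum>i<r. c i * b i)"
    proof (rule ex_ex1I)
      obtain c where c: "\<forall>i<r. c i \<in> F" "x = (\<Sum>i<r. c i * b i)" using ex[OF \<open>x \<in> K\<close>] by blast
      then show "\<exists>c. c \<in> {..<r} \<rightarrow>\<^sub>E F \<and> x = (\<Sum>i<r. c i * b i)"
        by (intro exI[of _ "restrict c {..<r}"]) auto
      fix c c' assume c: "c \<in> {..<r} \<rightarrow>\<^sub>E F \<and> x = (\<Sum>i<r. c i * b i)"
        and c': "c' \<in> {..<r} \<rightarrow>\<^sub>E F \<and> x = (\<Sum>i<r. c' i * b i)"
      show "c = c'"
      proof (rule PiE_ext[OF c[THEN conjunct1] c'[THEN conjunct1]])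
        fix i assume i: "i \<in> {..<r}"
        have "(\<Sum>i<r. (c i - c' i) * b i) = 0"
          using c c' by (simp add: left_diff_distrib sum_subtractf)
        then have "c i - c' i = 0"
          using c c' i F by (intro indep[of "\<lambda>i. c i - c' i"]) (auto intro!: subfield_diff)
        then show "c i = c' i" by simp
      qed
    qed
  qed
qed

lemma (in nonarch) reps_of_int_basis:
  assumes F: "is_subfield F" and K: "is_subfield K" and FK: "F \<subseteq> K"
    and b: "is_basis (int_ring nrm F) (int_ring nrm K) r b"
    and vals: "\<And>x. x \<in> K \<Longrightarrow> x \<noteq> 0 \<Longrightarrow> \<exists>a\<in>F. nrm a = nrm x"
    and RF: "is_reps nrm F RF"
  shows "\<exists>R. is_reps nrm K R \<and> card R = card RF ^ r"
proof -
  define g where "g = (\<lambda>c. \<Sum>i<r. c i * b i)"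
  have gK: "g c \<in> int_ring nrm K" if "\<And>i. i < r \<Longrightarrow> c i \<in> int_ring nrm F" for c
    unfolding g_def using that is_basis_mem[OF b] FK K
    by (auto simp: int_ring_def intro!: nrm_sum_le nrm_mult_le_1 subfield_sum subfield_mult)
  \<comment> \<open>Here the equality of the value groups enters: a nonzero combination in the
    maximal ideal is an element of \<open>F\<close> of norm below 1 times an integral element, and
    by uniqueness of coordinates each coefficient is divisible by that element of
    \<open>F\<close>.\<close>
  have small: "nrm (c i) < 1" if c: "\<And>i. i < r \<Longrightarrow> c i \<in> int_ring nrm F" "nrm (g c) < 1" "i < r" for c i
  proof (cases "g c = 0")
    case True
    have "c i = 0"
      using is_basis_unique[OF b, of c "\<lambda>_. 0"] c True int_ring_0[OF F] int_ring_0[OF K]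
      by (simp add: g_def)
    then show ?thesis by simp
  next
    case False
    have gc: "g c \<in> K" using gK[of c] c(1) int_ringD(2) by blast
    then obtain a where a: "a \<in> F" "nrm a = nrm (g c)" using vals False by blast
    have a0: "a \<noteq> 0" using a False by auto
    have "g c / a \<in> int_ring nrm K"
      using gc a a0 K FK by (auto simp: int_ring_def nrm_divide intro: subfield_divide)
    then obtain e where e: "\<forall>i<r. e i \<in> int_ring nrm F" "g c / a = (\<Sum>i<r. e i * b i)"
      using is_basis_ex[OF b] by blast
    have aO: "a \<in> int_ring nrm F" using a c(2) by (simp add: int_ring_def)
    have "g c = a * (g c / a)" using a0 by simp
    also have "\<dots> = (\<Sum>i<r. a * e i * b i)"
      unfolding e(2) by (simp add: sum_distrib_left mult.assoc)
    finally have "c i = a * e i"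
      using is_basis_unique[OF b, of c "\<lambda>i. a * e i" i] c gK[of c] e(1) aO int_ring_mult[OF F]
      by (simp add: g_def)
    then show ?thesis
      using nrm_mult_less[of "e i" a 1] e(1) c(2,3) a(2) by (simp add: int_ring_def mult.commute)
  qed
  define R where "R = g ` ({..<r} \<rightarrow>\<^sub>E RF)"
  have inj: "c = c'" if c: "c \<in> {..<r} \<rightarrow>\<^sub>E RF" and c': "c' \<in> {..<r} \<rightarrow>\<^sub>E RF" and "g c \<simeq> g c'" for c c'
  proof (rule PiE_ext[OF c c'])
    fix i assume i: "i \<in> {..<r}"
    have O: "c i \<in> int_ring nrm F" "c' i \<in> int_ring nrm F" if "i < r" for i
      using c c' that reps_int_ring[OF RF] by (auto simp: PiE_iff)
    have "g (\<lambda>i. c i - c' i) = g c - g c'"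
      by (simp add: g_def left_diff_distrib sum_subtractf)
    then have "nrm (c i - c' i) < 1"
      using small[of "\<lambda>i. c i - c' i" i] \<open>g c \<simeq> g c'\<close> O int_ring_diff[OF F] i by simp
    then show "c i = c' i"
      using reps_incong[OF RF] c c' i unfolding incong_def by (auto simp: PiE_iff)
  qed
  have "inj_on g ({..<r} \<rightarrow>\<^sub>E RF)"
    using inj by (intro inj_onI) auto
  then have "card R = card RF ^ r"
    by (simp add: R_def card_image card_PiE)
  moreover have "is_reps nrm K R"
    unfolding is_reps_def
  proof (intro conjI ballI)
    show "R \<subseteq> int_ring nrm K"
      using gK reps_int_ring[OF RF] by (auto simp: R_def PiE_iff)
    show "finite R" using reps_finite[OF RF] by (auto simp: R_def intro: finite_PiE)
    fix x assume "x \<in> int_ring nrm K"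
    then obtain c where c: "\<forall>i<r. c i \<in> int_ring nrm F" "x = g c"
      using is_basis_ex[OF b] unfolding g_def by blast
    have "\<forall>i\<in>{..<r}. \<exists>t. t \<in> RF \<and> c i \<simeq> t" using reps_ex[OF RF] c(1) by auto
    from bchoice[OF this] obtain t where t: "\<And>i. i < r \<Longrightarrow> t i \<in> RF \<and> c i \<simeq> t i" by auto
    have "g c \<simeq> g (restrict t {..<r})"
      unfolding g_def using t c(1) is_basis_mem[OF b]
      by (intro resid_sum resid_mult) (auto simp: int_ring_def)
    moreover have "restrict t {..<r} \<in> {..<r} \<rightarrow>\<^sub>E RF" using t by auto
    ultimately have ex: "\<exists>s\<in>R. x \<simeq> s" unfolding R_def c(2) by blast
    show "\<exists>!s. s \<in> R \<and> x \<simeq> s"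
    proof (rule ex_ex1I)
      show "\<exists>s. s \<in> R \<and> x \<simeq> s" using ex by blast
      fix s s' assume ss: "s \<in> R \<and> x \<simeq> s" "s' \<in> R \<and> x \<simeq> s'"
      then have "s \<simeq> s'" using resid_sym resid_trans by blast
      then show "s = s'" using ss inj by (auto simp: R_def)
    qed
  qed
  ultimately show ?thesis by blast
qed

section \<open>The density function\<close>

locale unram_ext = resid_ext nrm F K RF R q r
    + HF: local_haar nrm F lamF RF \<pi> + HK: local_haar nrm K lamK R \<pi>
  for nrm :: "'a::field \<Rightarrow> real" and F K RF R q r lamF lamK \<pi> +
  fixes b :: "nat \<Rightarrow> 'a" and D :: 'a and n :: nat
  assumes b: "is_basis F K r b" and nrm_\<pi>: "nrm \<pi> = 1 / real q" and D: "D \<noteq> 0"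
    and n: "r \<le> n" "n \<le> 2 * r - 1"
begin

definition main_factor :: real where
  "main_factor = (real q ^ (n + 1) - real q ^ r) / (real q ^ (n + 1) - 1)"

definition residue_class :: "'a \<Rightarrow> 'a set" where
  "residue_class t = {y \<in> K. nrm (y - t) < 1}"

lemma main_factor_nonneg: "0 \<le> main_factor"
proof -
  have "real q ^ r \<le> real q ^ (n + 1)" "1 \<le> real q ^ (n + 1)"
    using q_ge_2 n by (auto intro!: power_increasing one_le_power simp del: power_Suc)
  then show ?thesis by (simp add: main_factor_def)
qed

lemma inner_integral_good:
  assumes "x \<in> int_ring nrm K" "period x = r"
  shows "(\<integral>\<^sup>+ Q. ennreal (nrm (\<Sum>i\<le>n - r. Q i * x ^ i) ^ r) \<partial>Omega nrm F lamF (n - r)) = ennreal main_factor"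
proof -
  have "(\<integral>\<^sup>+ Q. ennreal (nrm (\<Sum>i\<le>n - r. Q i * x ^ i) ^ r) \<partial>Omega nrm F lamF (n - r))
      = ennreal ((1 - 1 / real q ^ Suc (n - r)) / (1 - 1 / real q ^ (Suc (n - r) + r)))"
  proof (rule HF.integral_Omega[OF nrm_\<pi> card_RF q_ge_2 r_pos])
    fix Q assume "Q \<in> {..n - r} \<rightarrow>\<^sub>E int_ring nrm F"
    \<comment> \<open>\<open>n \<le> 2 * r - 1\<close> with \<open>0 < r\<close> means
      \<open>n - r < r\<close>, so the powers of \<open>x\<close> that occur are
      independent.\<close>
    then show "nrm (\<Sum>i\<le>n - r. Q i * x ^ i) = Max ((\<lambda>i. nrm (Q i)) ` {..n - r})"
      using n r_pos by (intro period_r_nrm_sum[OF assms]) (auto simp: PiE_iff int_ring_def)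
  qed
  also have "(1 - 1 / real q ^ Suc (n - r)) / (1 - 1 / real q ^ (Suc (n - r) + r)) = main_factor"
  proof -
    define A B where "A = real q ^ Suc (n - r)" and "B = real q ^ r"
    have AB: "real q ^ (n + 1) = A * B" "real q ^ (Suc (n - r) + r) = A * B"
      using n(1) by (simp_all only: A_def B_def power_add[symmetric]) simp
    have "1 < A" "1 < B"
      unfolding A_def B_def using q_ge_2 r_pos by (auto intro!: one_less_power simp del: power_Suc)
    then have "1 < A * B" by (simp add: less_1_mult)
    have "(1 - 1 / A) / (1 - 1 / (A * B)) = ((1 - 1 / A) * (A * B)) / ((1 - 1 / (A * B)) * (A * B))"
      using \<open>1 < A * B\<close> by (subst mult_divide_mult_cancel_right) auto
    also have "\<dots> = (A * B - B) / (A * B - 1)"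
      using \<open>1 < A\<close> \<open>1 < B\<close> by (simp add: left_diff_distrib)
    finally show ?thesis
      unfolding main_factor_def AB A_def[symmetric] B_def[symmetric] .
  qed
  finally show ?thesis .
qed

lemma inner_integral_le_1:
  assumes "x \<in> int_ring nrm K"
  shows "(\<integral>\<^sup>+ Q. ennreal (nrm (\<Sum>i\<le>n - r. Q i * x ^ i) ^ r) \<partial>Omega nrm F lamF (n - r)) \<le> 1"
proof -
  have "(\<integral>\<^sup>+ Q. ennreal (nrm (\<Sum>i\<le>n - r. Q i * x ^ i) ^ r) \<partial>Omega nrm F lamF (n - r))
      \<le> (\<integral>\<^sup>+ Q. 1 \<partial>Omega nrm F lamF (n - r))"
  proof (rule nn_integral_mono)
    fix Q assume "Q \<in> space (Omega nrm F lamF (n - r))"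
    then have "nrm (Q i) \<le> 1" if "i \<le> n - r" for i
      using that by (auto simp: Omega_def space_PiM space_restrict_space PiE_iff int_ring_def)
    then have "nrm (\<Sum>i\<le>n - r. Q i * x ^ i) \<le> 1"
      using int_ringD(1)[OF assms] by (intro nrm_sum_le nrm_mult_le_1 nrm_power_le_1) auto
    then have "nrm (\<Sum>i\<le>n - r. Q i * x ^ i) ^ r \<le> 1"
      by (intro power_le_one) auto
    then show "ennreal (nrm (\<Sum>i\<le>n - r. Q i * x ^ i) ^ r) \<le> 1"
      by (simp add: ennreal_le_1)
  qed
  then show ?thesis
    by (simp add: HF.emeasure_space_Omega)
qed

lemma rho_int_good:
  assumes "x \<in> int_ring nrm K" "period x = r"
  shows "rho_int nrm F K r D lamF n x = ennreal (nrm D * main_factor)"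
  using inner_integral_good[OF assms] period_r_adjoin_field[OF b assms] period_r_quot_card[OF b assms] n(1)
    main_factor_nonneg
  by (simp add: rho_int_def ennreal_mult)

lemma rho_int_le:
  assumes x: "x \<in> int_ring nrm K"
  shows "rho_int nrm F K r D lamF n x \<le> ennreal (nrm D / real q ^ (r - period x))"
proof (cases "adjoin F x = K")
  case True
  define C where "C = quot_card (int_ring nrm K) (adjoin (int_ring nrm F) x)"
  have "nrm D / real C \<le> nrm D / real q ^ (r - period x)"
  \<comment> \<open>\<open>C = 0\<close> encodes an infinite index, and the division by it gives
    0.\<close>
  proof (cases "C = 0")
    case False
    have le: "period x \<le> r" using period_dvd_r[OF x] r_pos by (intro dvd_imp_le) auto
    have "q ^ (r - period x) * q ^ period x \<le> C * q ^ period x"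
      using quot_card_adjoin_ge[OF x] False le by (simp add: C_def power_add[symmetric])
    then have "q ^ (r - period x) \<le> C" using q_ge_2 by simp
    then have "real q ^ (r - period x) \<le> real C" by (simp flip: of_nat_power)
    then show ?thesis using q_ge_2 False by (intro divide_left_mono) auto
  qed simp
  then have "ennreal (nrm D / real C) * (\<integral>\<^sup>+ Q. ennreal (nrm (\<Sum>i\<le>n - r. Q i * x ^ i) ^ r) \<partial>Omega nrm F lamF (n - r))
      \<le> ennreal (nrm D / real q ^ (r - period x)) * 1"
    by (intro mult_mono inner_integral_le_1[OF x] ennreal_leI) auto
  then show ?thesis
    using True n(1) by (simp add: rho_int_def C_def)
qed (simp add: rho_int_def)

text \<open>Up to the factor \<open>nrm D\<close>, the exact density on the residue class of
  \<open>t\<close> if its period is \<open>r\<close>, and otherwise the bound that follows from the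
  index.\<close>

definition weight :: "'a \<Rightarrow> real" where
  "weight t = (if period t = r then main_factor else 1 / real q ^ (r - period t))"

lemma weight_nonneg: "0 \<le> weight t"
  using main_factor_nonneg by (simp add: weight_def)

lemma sum_residue_classes:
  fixes f :: "'a \<Rightarrow> ennreal"
  assumes "S \<subseteq> R" "x \<in> int_ring nrm K" "t \<in> R" "x \<simeq> t"
  shows "(\<Sum>s\<in>S. f s * indicator (residue_class s) x) = (if t \<in> S then f t else 0)"
proof -
  have "x \<in> residue_class s \<longleftrightarrow> s = t" if "s \<in> S" for s
  proof
    assume "x \<in> residue_class s"
    then have "x \<simeq> s" by (simp add: residue_class_def)
    then have "s \<simeq> t" using resid_trans[OF resid_sym assms(4)] by blast
    then show "s = t" using reps_incong[OF R] assms(1,3) that unfolding incong_def by blast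
  qed (use assms int_ringD(2)[OF assms(2)] in \<open>auto simp: residue_class_def\<close>)
  then have "(\<Sum>s\<in>S. f s * indicator (residue_class s) x) = (\<Sum>s\<in>S. if s = t then f s else 0)"
    by (intro sum.cong) auto
  then show ?thesis
    using finite_subset[OF assms(1) reps_finite[OF R]] by simp
qed

lemma emeasure_residue_class:
  assumes "t \<in> R"
  shows "emeasure lamK (residue_class t) = ennreal (1 / real q ^ r)" "residue_class t \<in> sets lamK"
  using HK.emeasure_residue_class[of t] HK.ball_sets[of 1 t] int_ringD(2)[OF reps_int_ring[OF R assms]] card_R
  by (auto simp: residue_class_def)

lemma integral_residue_classes:
  assumes "S \<subseteq> R" "\<And>t. 0 \<le> f t"
  shows "(\<integral>\<^sup>+ x. (\<Sum>t\<in>S. ennreal (f t) * indicator (residue_class t) x) \<partial>lamK)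
    = ennreal ((\<Sum>t\<in>S. f t) / real q ^ r)"
proof -
  have "(\<integral>\<^sup>+ x. (\<Sum>t\<in>S. ennreal (f t) * indicator (residue_class t) x) \<partial>lamK)
      = (\<Sum>t\<in>S. \<integral>\<^sup>+ x. ennreal (f t) * indicator (residue_class t) x \<partial>lamK)"
    using assms(1) emeasure_residue_class(2) by (intro nn_integral_sum) auto
  also have "\<dots> = (\<Sum>t\<in>S. ennreal (f t / real q ^ r))"
    using assms emeasure_residue_class
    by (intro sum.cong refl) (auto simp: nn_integral_cmult_indicator ennreal_mult[symmetric] subset_iff)
  also have "\<dots> = ennreal ((\<Sum>t\<in>S. f t) / real q ^ r)"
    using assms(2) by (simp add: sum_divide_distrib)
  finally show ?thesis .
qed

lemma rho_int_le_weight: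
  assumes "x \<in> int_ring nrm K" "t \<in> R" "x \<simeq> t"
  shows "rho_int nrm F K r D lamF n x \<le> ennreal (nrm D * weight t)"
proof -
  have "period x = period t"
    using assms reps_int_ring[OF R] by (intro period_cong) auto
  then show ?thesis
    using rho_int_good[OF assms(1)] rho_int_le[OF assms(1)] by (simp add: weight_def)
qed

text \<open>The density is majorized by the step function \<open>W\<close> on O_K and by a multiple
  of \<open>h\<close> outside. Additivity of the integral is applied to these two measurable
  functions, while for the density monotonicity is enough.\<close>

lemma rho_total_le:
  "rho_total nrm F K r D lamF lamK n \<le> ennreal (nrm D * ((\<Sum>t\<in>R. weight t) / real q ^ r + 2 / real q ^ r))"
proof -
  obtain h where h: "h \<in> borel_measurable lamK"
    "\<And>x. x \<in> K \<Longrightarrow> 1 < nrm x \<Longrightarrow> ennreal (1 / nrm x ^ (2 * r)) \<le> h x"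
    "(\<integral>\<^sup>+ x. h x \<partial>lamK) \<le> ennreal (2 / real q ^ r)"
    using HK.integral_outside_bound[OF nrm_\<pi> card_R q_ge_2 r_pos] by blast
  define W where "W = (\<lambda>x. \<Sum>t\<in>R. ennreal (weight t) * indicator (residue_class t) x)"
  have W: "W \<in> borel_measurable lamK"
    unfolding W_def using emeasure_residue_class(2) by (intro borel_measurable_sum) auto
  have "rho nrm F K r D lamF n x \<le> ennreal (nrm D) * (W x + h x)" if x: "x \<in> K" for x
  proof (cases "x \<in> int_ring nrm K")
    case True
    obtain t where t: "t \<in> R" "x \<simeq> t" using reps_ex[OF R True] by blast
    have "rho nrm F K r D lamF n x \<le> ennreal (nrm D * weight t)"
      using rho_int_le_weight[OF True t] True by (simp add: rho_def)
    also have "\<dots> = ennreal (nrm D) * W x"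
      using sum_residue_classes[OF subset_refl True t] t weight_nonneg
      by (simp add: W_def ennreal_mult)
    also have "\<dots> \<le> ennreal (nrm D) * (W x + h x)"
      by (intro mult_left_mono) auto
    finally show ?thesis .
  next
    case False
    then have x1: "1 < nrm x" using x by (simp add: int_ring_def)
    then have inv: "inverse x \<in> int_ring nrm K"
      using x subK by (auto simp: int_ring_def nrm_inverse inverse_le_1_iff intro: subfield_inverse)
    \<comment> \<open>Outside O_K the index is estimated trivially; the decay is supplied by the
      factor \<open>1 / nrm x ^ (2 * r)\<close>.\<close>
    have "nrm D / real q ^ (r - period (inverse x)) \<le> nrm D / 1"
      using q_ge_2 by (intro divide_left_mono) (auto intro: one_le_power)
    then have "rho_int nrm F K r D lamF n (inverse x) \<le> ennreal (nrm D)"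
      using rho_int_le[OF inv] ennreal_leI order_trans by fastforce
    then have "rho nrm F K r D lamF n x \<le> h x * ennreal (nrm D)"
      using False h(2)[OF x x1] by (simp add: rho_def mult_mono)
    also have "\<dots> \<le> ennreal (nrm D) * (W x + h x)"
      unfolding mult.commute[of "h x"] by (intro mult_left_mono) auto
    finally show ?thesis .
  qed
  then have "rho_total nrm F K r D lamF lamK n \<le> (\<integral>\<^sup>+ x. ennreal (nrm D) * (W x + h x) \<partial>lamK)"
    unfolding rho_total_def by (intro nn_integral_mono) (simp add: HK.space_\<mu>)
  also have "\<dots> = ennreal (nrm D) * ((\<integral>\<^sup>+ x. W x \<partial>lamK) + (\<integral>\<^sup>+ x. h x \<partial>lamK))"
    using W h(1) by (simp add: nn_integral_cmult nn_integral_add)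
  also have "\<dots> \<le> ennreal (nrm D) * (ennreal ((\<Sum>t\<in>R. weight t) / real q ^ r) + ennreal (2 / real q ^ r))"
    unfolding W_def using integral_residue_classes[OF subset_refl weight_nonneg] h(3)
    by (intro mult_left_mono add_mono) auto
  also have "\<dots> = ennreal (nrm D * ((\<Sum>t\<in>R. weight t) / real q ^ r + 2 / real q ^ r))"
    using weight_nonneg by (simp add: ennreal_mult sum_nonneg)
  finally show ?thesis .
qed

lemma rho_total_ge:
  "ennreal (nrm D * main_factor * real (card {t \<in> R. period t = r}) / real q ^ r) \<le> rho_total nrm F K r D lamF lamK n"
proof -
  define S where "S = {t \<in> R. period t = r}"
  have S: "S \<subseteq> R" by (auto simp: S_def)
  have "(\<Sum>t\<in>S. ennreal (nrm D * main_factor) * indicator (residue_class t) x) \<le> rho nrm F K r D lamF n x"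
    if x: "x \<in> K" for x
  proof (cases "x \<in> int_ring nrm K")
    case True
    obtain t where t: "t \<in> R" "x \<simeq> t" using reps_ex[OF R True] by blast
    have "period x = period t"
      using t True reps_int_ring[OF R] by (intro period_cong) auto
    then show ?thesis
      using sum_residue_classes[OF S True t, of "\<lambda>_. ennreal (nrm D * main_factor)"] True rho_int_good[OF True] t
      by (auto simp: rho_def S_def)
  next
    case False
    have "x \<notin> residue_class t" if "t \<in> S" for t
    proof
      assume "x \<in> residue_class t"
      moreover have "nrm t \<le> 1" using that S int_ringD(1)[OF reps_int_ring[OF R]] by auto
      ultimately have "nrm x \<le> 1" using resid_nrm_le[of t x] resid_sym[of x t] by (auto simp: residue_class_def)
      then show False using False x by (simp add: int_ring_def)
    qed
    then have "(\<Sum>t\<in>S. ennreal (nrm D * main_factor) * indicator (residue_class t) x) = 0"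
      by (intro sum.neutral) auto
    then show ?thesis by simp
  qed
  then have "(\<integral>\<^sup>+ x. (\<Sum>t\<in>S. ennreal (nrm D * main_factor) * indicator (residue_class t) x) \<partial>lamK)
      \<le> rho_total nrm F K r D lamF lamK n"
    unfolding rho_total_def by (intro nn_integral_mono) (simp add: HK.space_\<mu>)
  moreover have "(\<integral>\<^sup>+ x. (\<Sum>t\<in>S. ennreal (nrm D * main_factor) * indicator (residue_class t) x) \<partial>lamK)
      = ennreal ((\<Sum>t\<in>S. nrm D * main_factor) / real q ^ r)"
    using main_factor_nonneg by (intro integral_residue_classes[OF S]) simp
  ultimately show ?thesis
    by (simp add: S_def mult_ac)
qed

lemma sum_weight_le:
  "(\<Sum>t\<in>R. weight t) \<le> main_factor * real (card {t \<in> R. period t = r}) + 2"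
proof -
  have le: "period t \<le> r" if "t \<in> R" for t
    using period_dvd_r[OF reps_int_ring[OF R that]] r_pos by (intro dvd_imp_le) auto
  have "R = {t \<in> R. period t = r} \<union> {t \<in> R. period t < r}" using le by force
  then have "(\<Sum>t\<in>R. weight t) = (\<Sum>t\<in>{t \<in> R. period t = r} \<union> {t \<in> R. period t < r}. weight t)" by simp
  also have "\<dots> = (\<Sum>t\<in>{t \<in> R. period t = r}. weight t) + (\<Sum>t\<in>{t \<in> R. period t < r}. weight t)"
    using reps_finite[OF R] by (intro sum.union_disjoint) auto
  also have "(\<Sum>t\<in>{t \<in> R. period t = r}. weight t) = main_factor * real (card {t \<in> R. period t = r})"
    by (simp add: weight_def)
  also have "(\<Sum>t\<in>{t \<in> R. period t < r}. weight t) = (\<Sum>t\<in>{t \<in> R. period t < r}. real q ^ period t) / real q ^ r"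
    unfolding sum_divide_distrib using q_ge_2
    by (intro sum.cong) (auto simp: weight_def power_diff)
  also have "\<dots> \<le> 2"
    using sum_bad_period_le q_ge_2 by (simp add: divide_le_eq)
  finally show ?thesis by simp
qed

lemma rho_total_bounds:
  defines "\<Delta> \<equiv> enn2real (rho_total nrm F K r D lamF lamK n) / nrm D
    - main_factor * (real (card {t \<in> R. period t = r}) / real q ^ r)"
  shows "0 \<le> \<Delta>" "\<Delta> \<le> 4 / real q ^ r"
proof -
  define g where "g = real (card {t \<in> R. period t = r})"
  define T where "T = enn2real (rho_total nrm F K r D lamF lamK n)"
  \<comment> \<open>\<open>enn2real\<close> sends infinity to 0, so it preserves an inequality only
    if the larger side is finite.\<close>
  have fin: "rho_total nrm F K r D lamF lamK n < \<infinity>"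
    using rho_total_le by (rule order_le_less_trans) simp
  have Dpos: "0 < nrm D" using D by simp
  have qpos: "0 < real q ^ r" using q_ge_2 by simp
  have "nrm D * main_factor * g / real q ^ r \<le> T"
    using enn2real_mono[OF rho_total_ge, unfolded infinity_ennreal_def[symmetric], OF fin] main_factor_nonneg by (simp add: g_def T_def)
  then have "main_factor * (g / real q ^ r) \<le> T / nrm D"
    using Dpos by (simp add: pos_le_divide_eq mult_ac)
  then show "0 \<le> \<Delta>"
    by (simp add: \<Delta>_def g_def T_def)
  have "T \<le> nrm D * ((\<Sum>t\<in>R. weight t) / real q ^ r + 2 / real q ^ r)"
    using enn2real_mono[OF rho_total_le] weight_nonneg by (simp add: T_def sum_nonneg)
  then have "T / nrm D \<le> (\<Sum>t\<in>R. weight t) / real q ^ r + 2 / real q ^ r"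
    using Dpos by (simp add: pos_divide_le_eq mult.commute)
  also have "\<dots> \<le> (main_factor * g + 2) / real q ^ r + 2 / real q ^ r"
    using sum_weight_le qpos by (intro add_right_mono divide_right_mono) (auto simp: g_def)
  also have "\<dots> = main_factor * (g / real q ^ r) + 4 / real q ^ r"
    by (simp add: add_divide_distrib)
  finally show "\<Delta> \<le> 4 / real q ^ r"
    by (simp add: \<Delta>_def g_def T_def)
qed

end

theorem theorem3p7:
  fixes nrm :: "'a::{alg_closed_field,field_char_0} \<Rightarrow> real"
    and Qp F K :: "'a set"
    and lamF lamK :: "'a measure"
    and D :: 'a
    and Fq :: "'e::{field,finite} set"
    and p d q r n :: nat
  assumes "prime p"
    and "is_nonarch_abs nrm"
    and "is_completion_of_Rats nrm Qp"
    and "field_ext Qp F d"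
    and "nrm (of_nat p) = 1 / real p ^ d"
    and "\<forall>x. algebraic_over F x"
    and "q = quot_card (int_ring nrm F) (max_ideal nrm F)"
    and "is_haar nrm F lamF"
    and "field_ext F K r"
    and "unramified nrm F K"
    and "is_haar nrm K lamK"
    and "is_discriminant nrm F K r D"
    and "is_subfield Fq" and "card Fq = q" and "CARD('e) = q ^ r"
    and "r \<le> n" and "n \<le> 2 * r - 1"
  defines "G \<equiv> card {\<alpha>::'e. adjoin Fq \<alpha> = UNIV}"
  defines "\<Delta> \<equiv> enn2real (rho_total nrm F K r D lamF lamK n) / nrm D
      - (real q ^ (n + 1) - real q ^ r) / (real q ^ (n + 1) - 1) * (real G / real q ^ r)"
  shows "- (1 / real q ^ r) \<le> \<Delta> \<and> \<Delta> \<le> 4 / real q ^ r"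
proof -
  interpret nonarch nrm by standard fact
  obtain bQ where Qp: "is_subfield Qp" "is_subfield F" "Qp \<subseteq> F" "is_basis Qp F d bQ"
    using assms(4) by (auto simp: field_ext_def)
  have K: "is_subfield K" "F \<subseteq> K" using assms(9) by (auto simp: field_ext_def)
  have "0 < d" using basis_size_pos[OF Qp] .
  then have "1 < real p ^ d"
    using prime_gt_1_nat[OF assms(1)] by (intro one_less_power) auto
  then have "nrm (of_nat p) < 1" by (simp add: assms(5) divide_less_eq)
  then interpret P: padic nrm Qp F p d bQ
    using assms(1,3) Qp by unfold_locales
  obtain \<pi> m where \<pi>: "\<pi> \<in> F" "\<pi> \<noteq> 0" "nrm \<pi> < 1" "\<And>x. x \<in> F \<Longrightarrow> nrm x < 1 \<Longrightarrow> nrm x \<le> nrm \<pi>"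
    and m: "0 < m" "nrm \<pi> ^ m = nrm (of_nat p)"
    using P.uniformizer_ex by blast
  \<comment> \<open>A positive \<open>q\<close> excludes the value 0 that \<open>quot_card\<close>
    takes on infinite quotients; it comes from the finite field \<open>Fq\<close> of the same
    size.\<close>
  have "0 < q"
    using assms(13,14) subfield_0[OF assms(13)] by (auto simp: card_gt_0_iff)
  then obtain RF where RF: "is_reps nrm F RF" "card RF = q"
    using reps_of_quot_card[OF Qp(2)] assms(7) by blast
  interpret HF: local_haar nrm F lamF RF \<pi>
    using Qp(2) assms(8) RF(1) \<pi> by unfold_locales
  have vals: "\<exists>a\<in>F. nrm a = nrm x" if "x \<in> K" "x \<noteq> 0" for x
    using unramified_same_values[OF Qp(2) K(2) assms(10) that] .
  obtain b where b: "is_basis (int_ring nrm F) (int_ring nrm K) r b"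
    and D: "D = Determinant.det (Matrix.mat r r (\<lambda>(i, j). ext_trace F r b (b i * b j)))"
    using assms(12) by (auto simp: is_discriminant_def)
  have bK: "is_basis F K r b"
    using int_basis_imp_field_basis[OF Qp(2) K(1,2) b vals] .
  have r: "0 < r" using basis_size_pos[OF Qp(2) K(1,2) bK] .
  have "D \<noteq> 0"
    unfolding D by (rule trace_form_det_nonzero[OF Qp(2) K(1,2) bK]) (use r in simp)
  obtain R where R: "is_reps nrm K R" "card R = q ^ r"
    using reps_of_int_basis[OF Qp(2) K(1,2) b vals RF(1)] RF(2) by blast
  \<comment> \<open>\<open>\<pi>\<close> remains a uniformizer in \<open>K\<close>, because every
    norm on \<open>K\<close> is attained on \<open>F\<close>.\<close>
  have le_\<pi>: "nrm x \<le> nrm \<pi>" if x: "x \<in> K" "nrm x < 1" for x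
  proof (cases "x = 0")
    case False
    then obtain a where "a \<in> F" "nrm a = nrm x" using vals[OF x(1)] by blast
    then show ?thesis using \<pi>(4)[of a] x(2) by simp
  qed simp
  obtain T where T: "finite T" "card T = p ^ d" "T \<subseteq> int_ring nrm F"
    "\<forall>x\<in>int_ring nrm F. \<exists>!t. t \<in> T \<and> nrm (x - t) \<le> nrm (of_nat p)"
    using P.reps_mod_p by blast
  \<comment> \<open>The ball p O_F measured twice: by its p^d translates in O_F, and as the ball of
    radius \<open>nrm \<pi> ^ m\<close>. The outcome is p^d = q^m.\<close>
  have "1 = of_nat (p ^ d) * emeasure lamF {y \<in> F. nrm y \<le> nrm \<pi> ^ m}"
    using HF.emeasure_cball_reps[OF T(1,3,4)] P.\<omega>_pos P.nrm_p T(2) m(2) by simp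
  also have "\<dots> = ennreal (real p ^ d / real q ^ m)"
    unfolding HF.emeasure_cball_power RF(2)
    by (simp add: ennreal_of_nat_eq_real_of_nat ennreal_mult[symmetric])
  finally have "real p ^ d / real q ^ m = 1"
    by (metis ennreal_1 ennreal_inj divide_nonneg_nonneg zero_le_one of_nat_0_le_iff zero_le_power)
  \<comment> \<open>Here the normalization |p| = p^(-d) enters; the exponent \<open>m\<close> is
    positive, so the root can be taken.\<close>
  then have "nrm \<pi> ^ m = (1 / real q) ^ m"
    using m(2) assms(5) \<open>0 < q\<close> by (simp add: power_one_over field_simps)
  then have nrm_\<pi>: "nrm \<pi> = 1 / real q"
    using m(1) power_eq_iff_eq_base[of m "nrm \<pi>" "1 / real q"] by simp
  interpret U: unram_ext nrm F K RF R q r lamF lamK \<pi> b D n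
    using Qp(2) K RF R r assms(8,11,16,17) \<pi> le_\<pi> bK nrm_\<pi> \<open>D \<noteq> 0\<close> by unfold_locales auto
  \<comment> \<open>The generators in \<open>'e\<close> are the elements of period \<open>r\<close>
    for the trivial norm, and these are as many as the residues of period \<open>r\<close> in
    \<open>R\<close>.\<close>
  have "G = card {\<alpha> \<in> UNIV :: 'e set. resid_ext.period triv_nrm q \<alpha> = r}"
    using adjoin_eq_UNIV_iff_period[OF assms(13-15) r] by (simp add: G_def)
  also have "\<dots> = card {t \<in> R. U.period t = r}"
    by (rule card_period_r_unique[OF resid_ext_finite_field[OF assms(13-15) r] U.resid_ext_axioms])
  finally have "\<Delta> = enn2real (rho_total nrm F K r D lamF lamK n) / nrm D
      - U.main_factor * (real (card {t \<in> R. U.period t = r}) / real q ^ r)"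
    by (simp add: \<Delta>_def U.main_factor_def)
  moreover have "- (1 / real q ^ r) \<le> 0" by simp
  ultimately show ?thesis
    using U.rho_total_bounds by linarith
qed

end
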